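(* Let $n\ge 1$ be an integer, $0<s<1$, and let $f=f(x,\tau)$ be a real function of $x\in\mathbb{R}^n$ and $\tau\ge 0$ satisfying: (f1) $f(x,\tau)$ is uniformly Hölder continuous with respect to $x$ and continuous with respect to $\tau$. (f2) There exists a constant $C_0>0$ such that $0\le f(x,\tau)\le C_0(1+\tau^p)$ uniformly for all $x$, and $$\lim_{\tau\to\infty}\frac{f(x,\tau)}{\tau^p}=K(x),\qquad 1<p<\frac{n+2}{n+2-2s},$$ where $K(x)\in(0,\infty)$ is uniformly continuous and $\lim_{|x|\to\infty}K(x)=\bar C\in(0,\infty)$. Then there exists a constant $C$ such that every nonnegative (classical entire) solution $u$ of $$(\partial_t-\Delta)^s u(x,t)=f(x,u(x,t)),\quad (x,t)\in\mathbb{R}^n\times\mathbb{R},$$ satisfies $$u(x,t)\le C\qquad\forall\,(x,t)\in\mathbb{R}^n\times\mathbb{R}.$$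
   Context: Operator: for $0<s<1$, $$(\partial_t-\Delta)^s u(x,t)=C_{n,s}\int_{-\infty}^t\int_{\mathbb{R}^n}\frac{u(x,t)-u(y,\tau)}{(t-\tau)^{\frac n2+1+s}}e^{-\frac{|x-y|^2}{4(t-\tau)}}\,dy\,d\tau,\qquad C_{n,s}=\frac{1}{(4\pi)^{n/2}|\Gamma(-s)|},$$ the $y$-integral being in the Cauchy principal value sense. Classical entire solution: $u\in C^{2s+\epsilon,s+\epsilon}_{x,t,\mathrm{loc}}(\mathbb{R}^n\times\mathbb{R})\cap\mathcal{L}(\mathbb{R}^n\times\mathbb{R})$ for some $\epsilon>0$ (locally Hölder of order $2s+\epsilon$ in $x$ and $s+\epsilon$ in $t$, with orders above 1 meaning Hölder continuity of derivatives) and the equation holds pointwise. Here $\mathcal{L}(\mathbb{R}^n\times\mathbb{R})$ is the set of $u\in L^1_{\rm loc}(\mathbb{R}^n\times\mathbb{R})$ with $$\int_{-\infty}^t\int_{\mathbb{R}^n}\frac{|u(x,\tau)|e^{-\frac{|x|^2}{4(t-\tau)}}}{1+(t-\tau)^{\frac n2+1+s}}\,dx\,d\tau<\infty\quad\text{for all } t\in\mathbb{R}.$$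
   Formalization: The limit of f(x,τ)/τ^p as τ→∞ in (f2) is assumed to be uniform in x; with only a pointwise limit the claim fails, since for n > 2s one can build f satisfying (f1), (f2) with K = 1 that has an unbounded nonnegative stationary solution. *)

theory Defs
  imports "HOL-Analysis.Analysis"
begin

text \<open>
  Functions on space-time are curried, \<open>u x t\<close> with \<open>x\<close> in a Euclidean space and \<open>t\<close> real.
  The first variable below is the one in which regularity is measured, the second one is a
  parameter; the Hoelder constants are uniform on compact subsets of the product.
  The first argument is the number of derivatives, the second one the Hoelder exponent
  of the derivatives of that order.
\<close>

primrec local_holder_deriv ::
  "nat \<Rightarrow> real \<Rightarrow> ('a::euclidean_space \<Rightarrow> 'b::euclidean_space \<Rightarrow> real) \<Rightarrow> bool" where
  "local_holder_deriv 0 \<gamma> u \<longleftrightarrow>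
     (\<forall>Q. compact Q \<longrightarrow>
        (\<exists>M. \<forall>x y t. (x, t) \<in> Q \<longrightarrow> (y, t) \<in> Q \<longrightarrow> \<bar>u x t - u y t\<bar> \<le> M * dist x y powr \<gamma>))"
| "local_holder_deriv (Suc k) \<gamma> u \<longleftrightarrow>
     (\<forall>x t. (\<lambda>z. u z t) differentiable (at x)) \<and>
     (\<forall>b\<in>Basis. local_holder_deriv k \<gamma> (\<lambda>x t. frechet_derivative (\<lambda>z. u z t) (at x) b))"

text \<open>
  A real order \<open>a > 0\<close> is split as \<open>a = k + \<gamma>\<close> with \<open>k\<close> a natural number and
  \<open>0 < \<gamma> \<le> 1\<close>.
\<close>

definition local_holder ::
  "real \<Rightarrow> ('a::euclidean_space \<Rightarrow> 'b::euclidean_space \<Rightarrow> real) \<Rightarrow> bool" where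
  "local_holder a u \<longleftrightarrow>
     (let k = nat (\<lceil>a\<rceil> - 1) in local_holder_deriv k (a - real k) u)"

definition parabolic_local_holder ::
  "real \<Rightarrow> real \<Rightarrow> ('a::euclidean_space \<Rightarrow> real \<Rightarrow> real) \<Rightarrow> bool" where
  "parabolic_local_holder a b u \<longleftrightarrow> local_holder a u \<and> local_holder b (\<lambda>t x. u x t)"

definition slowly_growing :: "real \<Rightarrow> ('a::euclidean_space \<Rightarrow> real \<Rightarrow> real) \<Rightarrow> bool" where
  "slowly_growing s u \<longleftrightarrow>
     (\<forall>Q. compact Q \<longrightarrow> set_integrable lborel Q (\<lambda>(x, t). u x t)) \<and>
     (\<forall>t. (\<integral>\<^sup>+ \<tau> \<in> {..<t}.
             (\<integral>\<^sup>+ x. ennreal (\<bar>u x \<tau>\<bar> * exp (- (norm x)\<^sup>2 / (4 * (t - \<tau>)))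
                 / (1 + (t - \<tau>) powr (real DIM('a) / 2 + 1 + s))) \<partial>lborel)
           \<partial>lborel) < \<infinity>)"

text \<open>Cauchy principal value of an integral over the whole space, singular at \<open>x\<close>.\<close>

definition has_principal_value :: "('a::euclidean_space \<Rightarrow> real) \<Rightarrow> 'a \<Rightarrow> real \<Rightarrow> bool" where
  "has_principal_value g x v \<longleftrightarrow>
     (\<forall>\<delta>>0. set_integrable lborel {y. \<delta> < dist x y} g) \<and>
     ((\<lambda>\<delta>. LINT y:{y. \<delta> < dist x y}|lborel. g y) \<longlongrightarrow> v) (at_right 0)"

definition master_const :: "nat \<Rightarrow> real \<Rightarrow> real" where
  "master_const n s = 1 / ((4 * pi) powr (real n / 2) * \<bar>Gamma (- s)\<bar>)"

text \<open>
  The fractional heat operator of order \<open>s\<close> applied to \<open>u\<close> is defined at \<open>(x, t)\<close> and has the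
  value \<open>v\<close> there. A relation is used because Lebesgue integrals in HOL are total functions with
  an arbitrary value in the divergent case. The function \<open>I\<close> is the inner \<open>y\<close>-integral, which
  for \<open>u\<close> in the class \<^const>\<open>slowly_growing\<close> needs to exist only for almost every \<open>\<tau>\<close>.
\<close>

definition has_fractional_heat ::
  "real \<Rightarrow> ('a::euclidean_space \<Rightarrow> real \<Rightarrow> real) \<Rightarrow> 'a \<Rightarrow> real \<Rightarrow> real \<Rightarrow> bool" where
  "has_fractional_heat s u x t v \<longleftrightarrow>
     (\<exists>I :: real \<Rightarrow> real.
        (AE \<tau> in lborel. \<tau> < t \<longrightarrow>
           has_principal_value
             (\<lambda>y. (u x t - u y \<tau>) / (t - \<tau>) powr (real DIM('a) / 2 + 1 + s)
                    * exp (- (norm (x - y))\<^sup>2 / (4 * (t - \<tau>))))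
             x (I \<tau>)) \<and>
        set_integrable lborel {..<t} I \<and>
        v = master_const DIM('a) s * (LINT \<tau>:{..<t}|lborel. I \<tau>))"

definition classical_entire_solution ::
  "real \<Rightarrow> ('a::euclidean_space \<Rightarrow> real \<Rightarrow> real) \<Rightarrow> ('a \<Rightarrow> real \<Rightarrow> real) \<Rightarrow> bool" where
  "classical_entire_solution s f u \<longleftrightarrow>
     (\<exists>\<epsilon>>0. parabolic_local_holder (2 * s + \<epsilon>) (s + \<epsilon>) u) \<and>
     slowly_growing s u \<and>
     (\<forall>x t. has_fractional_heat s u x t (f x (u x t)))"

text \<open>
  For each fixed \<open>\<tau>\<close> the Hoelder constant is uniform over the whole space, but it may depend on
  \<open>\<tau>\<close>: a constant independent of \<open>\<tau>\<close> would force the limit of \<open>f x \<tau> / \<tau> powr p\<close> as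
  \<open>\<tau>\<close> tends to infinity to be constant in \<open>x\<close>.
\<close>

definition holder_in_space :: "('a::euclidean_space \<Rightarrow> real \<Rightarrow> real) \<Rightarrow> bool" where
  "holder_in_space f \<longleftrightarrow>
     (\<exists>\<alpha>. 0 < \<alpha> \<and> \<alpha> \<le> 1 \<and>
        (\<forall>\<tau>\<ge>0. \<exists>M. \<forall>x y. \<bar>f x \<tau> - f y \<tau>\<bar> \<le> M * dist x y powr \<alpha>))"

end

theory Submission
  imports Defs "HOL-Probability.Distributions"
begin

text \<open>
  In the range \<open>p < (n + 2) / (n + 2 - 2 * s)\<close> a nonnegative solution is bounded for a reason
  that uses the equation only pointwise, at points where the solution touches an explicit barrier.

  Write the operator with the kernel \<open>J z r = r powr - (n / 2 + 1 + s) * exp (- norm z ^ 2 / (4 * r))\<close>.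
  If \<open>u - v\<close> has a minimum over the past at a point, then the equation there bounds
  \<open>F = f x u\<close> together with the mass of \<open>u J\<close> in the remote past by the operator applied to the barrier \<open>v\<close>.
  Paraboloids as barriers show that a large mass in the past forces \<open>u\<close> to be large on a later cylinder,
  and that \<open>u\<close> cannot be large on a unit cylinder: it would double on shrinking cylinders until it is
  infinite at a point. So the mass at unit distance in the past has a universal bound.

  If \<open>u\<close> takes a huge value, a weighted maximum produces a value \<open>U\<close> at a point where \<open>u\<close> is touched from above
  by a paraboloid on a cylinder whose size is a small negative power of \<open>U\<close>. The equation at this point shows that the
  past at distance \<open>\<delta> = c * U powr (- (p - 1) / s)\<close> carries mass of order \<open>U powr p\<close>, so \<open>u\<close> is of order \<open>U\<close>
  on a cylinder of time length \<open>\<delta>\<close>, where \<open>F\<close> is of order \<open>U powr p\<close>. The last barrier, the truncation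
  \<open>max 0 (w - l)\<close> of a Gaussian times \<open>max 0 t powr s - max 0 (t - h) powr s\<close>, transports this to
  \<open>u \<ge> c * U powr p * h powr (n / 2 + 1)\<close> on a unit cylinder. With \<open>h\<close> slightly smaller than \<open>\<delta>\<close> the exponent of \<open>U\<close>
  is positive exactly in the stated range of \<open>p\<close>, which contradicts the bound on unit cylinders.
\<close>


subsection \<open>Continuity of solutions\<close>

lemma frechet_derivative_real:
  fixes w :: "real \<Rightarrow> real"
  assumes "w differentiable (at t)"
  shows "(w has_real_derivative frechet_derivative w (at t) 1) (at t)"
proof -
  have 1: "(w has_derivative frechet_derivative w (at t)) (at t)"
    using assms frechet_derivative_works by blast
  have "frechet_derivative w (at t) = (\<lambda>h. h * frechet_derivative w (at t) 1)"
  proof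
    fix h :: real
    show "frechet_derivative w (at t) h = h * frechet_derivative w (at t) 1"
      using linear_cmul[OF has_derivative_linear[OF 1], of h 1] by simp
  qed
  with 1 show ?thesis by (metis has_derivative_imp_has_field_derivative)
qed

text \<open>\<open>local_holder\<close> asserts no joint continuity of the intermediate derivatives,
  so local bounds have to be recovered. The top derivative oscillates by a bounded amount over
  \<open>{a..b}\<close>, uniformly in \<open>x\<close>, hence one bounded value per \<open>x\<close>
  suffices. This weak hypothesis passes to the derivative by the mean value theorem, and the bound
  obtained for the derivative passes back to \<open>w\<close>.\<close>

lemma local_holder_deriv_bounded:
  fixes w :: "real \<Rightarrow> 'b::euclidean_space \<Rightarrow> real"
  assumes "local_holder_deriv k \<gamma> w" "0 \<le> \<gamma>"
    and "\<And>X a b. compact X \<Longrightarrow> a < b \<Longrightarrow> \<exists>B. \<forall>x\<in>X. \<exists>t\<in>{a..b}. \<bar>w t x\<bar> \<le> B"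
    and "compact X" "a < b"
  shows "\<exists>B. \<forall>x\<in>X. \<forall>t\<in>{a..b}. \<bar>w t x\<bar> \<le> B"
  using assms
proof (induction k arbitrary: w)
  case 0
  obtain B where B: "\<And>x. x \<in> X \<Longrightarrow> \<exists>t\<in>{a..b}. \<bar>w t x\<bar> \<le> B"
    using 0(3)[OF 0(4,5)] by blast
  have "compact ({a..b} \<times> X)"
    using 0(4) by (intro compact_Times) auto
  then obtain M where M: "\<And>t t' x. (t, x) \<in> {a..b} \<times> X \<Longrightarrow> (t', x) \<in> {a..b} \<times> X
      \<Longrightarrow> \<bar>w t x - w t' x\<bar> \<le> M * dist t t' powr \<gamma>"
    using 0(1) unfolding local_holder_deriv.simps by meson
  have "\<bar>w t x\<bar> \<le> B + \<bar>M\<bar> * (b - a) powr \<gamma>" if x: "x \<in> X" and t: "t \<in> {a..b}" for x t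
  proof -
    obtain t' where t': "t' \<in> {a..b}" "\<bar>w t' x\<bar> \<le> B" using B[OF x] by blast
    have "\<bar>w t x - w t' x\<bar> \<le> M * dist t t' powr \<gamma>" using M t t'(1) x by blast
    also have "\<dots> \<le> \<bar>M\<bar> * dist t t' powr \<gamma>" by (intro mult_right_mono) auto
    also have "\<dots> \<le> \<bar>M\<bar> * (b - a) powr \<gamma>"
      using t t' 0(2) by (intro mult_left_mono powr_mono2) (auto simp: dist_real_def)
    finally show ?thesis using t'(2) by linarith
  qed
  then show ?case by blast
next
  case (Suc k)
  define w' where "w' = (\<lambda>t x. frechet_derivative (\<lambda>z. w z x) (at t) 1)"
  have diff: "(\<lambda>z. w z x) differentiable (at t)" for t x using Suc.prems(1) by simp
  have lh: "local_holder_deriv k \<gamma> w'" using Suc.prems(1) by (simp add: w'_def)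
  have der: "((\<lambda>z. w z x) has_real_derivative w' t x) (at t)" for t x
    unfolding w'_def by (rule frechet_derivative_real[OF diff])
  have w'b: "\<exists>B. \<forall>x\<in>X. \<exists>t\<in>{a..b}. \<bar>w' t x\<bar> \<le> B" if X: "compact X" and ab: "a < b" for X a b
  proof -
    \<comment> \<open>Points in the two outer thirds of the interval are at distance at least
      \<open>d\<close>, so the difference quotient of the bounded values there is bounded.\<close>
    define d where "d = (b - a) / 3"
    have d: "d > 0" using ab by (simp add: d_def)
    obtain B1 where B1: "\<And>x. x \<in> X \<Longrightarrow> \<exists>t\<in>{a..a + d}. \<bar>w t x\<bar> \<le> B1"
      using Suc.prems(3)[OF X, of a "a + d"] d by auto
    obtain B2 where B2: "\<And>x. x \<in> X \<Longrightarrow> \<exists>t\<in>{a + 2 * d..b}. \<bar>w t x\<bar> \<le> B2"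
      using Suc.prems(3)[OF X, of "a + 2 * d" b] d by (auto simp: d_def field_simps)
    have "\<exists>t\<in>{a..b}. \<bar>w' t x\<bar> \<le> (B1 + B2) / d" if x: "x \<in> X" for x
    proof -
      obtain t1 where t1: "t1 \<in> {a..a + d}" "\<bar>w t1 x\<bar> \<le> B1" using B1[OF x] by blast
      obtain t2 where t2: "t2 \<in> {a + 2 * d..b}" "\<bar>w t2 x\<bar> \<le> B2" using B2[OF x] by blast
      have gap: "t2 - t1 \<ge> d" using t1 t2 by auto
      then have "t1 < t2" using d by auto
      then obtain z where z: "z > t1" "z < t2" "w t2 x - w t1 x = (t2 - t1) * w' z x"
        using MVT2[of t1 t2 "\<lambda>z. w z x" "\<lambda>z. w' z x"] der by blast
      have "\<bar>w' z x\<bar> * d \<le> \<bar>w' z x\<bar> * (t2 - t1)" using gap by (intro mult_left_mono) auto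
      also have "\<dots> = \<bar>w t2 x - w t1 x\<bar>" using z(3) \<open>t1 < t2\<close> by (simp add: abs_mult)
      also have "\<dots> \<le> B1 + B2" using t1 t2 by linarith
      finally have "\<bar>w' z x\<bar> \<le> (B1 + B2) / d" using d by (simp add: field_simps)
      moreover have "z \<in> {a..b}" using z t1 t2 d by auto
      ultimately show ?thesis by blast
    qed
    then show ?thesis by blast
  qed
  obtain B' where B': "\<And>x t. x \<in> X \<Longrightarrow> t \<in> {a..b} \<Longrightarrow> \<bar>w' t x\<bar> \<le> B'"
    using Suc.IH[OF lh Suc.prems(2) w'b Suc.prems(4,5)] by blast
  obtain B where B: "\<And>x. x \<in> X \<Longrightarrow> \<exists>t\<in>{a..b}. \<bar>w t x\<bar> \<le> B"
    using Suc.prems(3)[OF Suc.prems(4,5)] by blast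
  have "\<bar>w t x\<bar> \<le> B + B' * (b - a)" if x: "x \<in> X" and t: "t \<in> {a..b}" for x t
  proof -
    obtain t' where t': "t' \<in> {a..b}" "\<bar>w t' x\<bar> \<le> B" using B[OF x] by blast
    have "norm (w t x - w t' x) \<le> B' * norm (t - t')"
      by (rule field_differentiable_bound[of "{a..b}" "\<lambda>z. w z x" "\<lambda>z. w' z x"])
        (use der B' x t t' in \<open>auto intro: has_field_derivative_at_within\<close>)
    also have "\<dots> \<le> B' * (b - a)" using B'[OF x t] t t' by (intro mult_left_mono) auto
    finally show ?thesis using t' by simp
  qed
  then show ?case by blast
qed

lemma local_holder_deriv_isCont:
  fixes u :: "'a::euclidean_space \<Rightarrow> 'b::euclidean_space \<Rightarrow> real"
  assumes "local_holder_deriv k \<gamma> u" "0 < \<gamma>"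
  shows "continuous_on UNIV (\<lambda>x. u x t)"
proof (cases k)
  case 0
  have "isCont (\<lambda>x. u x t) x" for x
  proof -
    have "compact (cball x 1 \<times> {t})" by (intro compact_Times) auto
    then obtain M where M: "\<And>y. y \<in> cball x 1 \<Longrightarrow> \<bar>u y t - u x t\<bar> \<le> M * dist y x powr \<gamma>"
      using assms(1) unfolding 0 local_holder_deriv.simps by (metis SigmaI centre_in_cball insertI1 zero_le_one)
    have lim: "((\<lambda>y. M * dist y x powr \<gamma>) \<longlongrightarrow> M * 0 powr \<gamma>) (at x)"
      using assms(2) by (intro tendsto_intros) (auto intro!: tendsto_eq_intros)
    have "((\<lambda>y. u y t - u x t) \<longlongrightarrow> 0) (at x)"
    proof (rule Lim_null_comparison)
      show "\<forall>\<^sub>F y in at x. norm (u y t - u x t) \<le> M * dist y x powr \<gamma>"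
        unfolding eventually_at by (rule exI[of _ 1]) (use M in \<open>auto simp: dist_commute\<close>)
      show "((\<lambda>y. M * dist y x powr \<gamma>) \<longlongrightarrow> 0) (at x)" using lim by simp
    qed
    then show ?thesis unfolding isCont_def by (simp add: LIM_zero_iff)
  qed
  then show ?thesis by (simp add: continuous_on_eq_continuous_within)
next
  case (Suc k')
  then have "(\<lambda>x. u x t) differentiable (at x)" for x using assms(1) by simp
  then show ?thesis
    by (simp add: continuous_on_eq_continuous_within differentiable_imp_continuous_within)
qed

lemma local_holder_split:
  assumes "0 < a"
  obtains k \<gamma> where "0 < \<gamma>" "\<And>u. local_holder a u = local_holder_deriv k \<gamma> u"
proof -
  have "real (nat (\<lceil>a\<rceil> - 1)) < a" using assms by linarith
  then show thesis using that[of "a - real (nat (\<lceil>a\<rceil> - 1))" "nat (\<lceil>a\<rceil> - 1)"]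
    by (simp add: local_holder_def Let_def)
qed

text \<open>Continuity in \<open>x\<close> at a fixed time is combined with a modulus of continuity
  in \<open>t\<close> that is uniform for \<open>x\<close> in a compact set. For
  \<open>k = 0\<close> this modulus is the Hoelder estimate itself; otherwise it is a Lipschitz
  bound, from \<open>local_holder_deriv_bounded\<close> applied to the time derivative.\<close>

lemma parabolic_local_holder_continuous:
  fixes u :: "'a::euclidean_space \<Rightarrow> real \<Rightarrow> real"
  assumes "parabolic_local_holder a b u" "0 < a" "0 < b"
  shows "continuous_on UNIV (\<lambda>z. u (fst z) (snd z))"
proof -
  have cx: "continuous_on UNIV (\<lambda>x. u x t)" for t
    using assms(1) local_holder_split[OF assms(2)] local_holder_deriv_isCont
    unfolding parabolic_local_holder_def by metis
  obtain k \<gamma> where g: "0 < \<gamma>" and lh: "local_holder_deriv k \<gamma> (\<lambda>t x. u x t)"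
    using assms(1) local_holder_split[OF assms(3)] unfolding parabolic_local_holder_def by metis
  have bd: "\<exists>B. \<forall>x\<in>X. \<bar>u x t\<bar> \<le> B" if "compact X" for X t
  proof -
    have "bounded ((\<lambda>x. u x t) ` X)"
      by (intro compact_imp_bounded compact_continuous_image continuous_on_subset[OF cx] that) auto
    then show ?thesis unfolding bounded_iff by auto
  qed
  have mod: "\<exists>M \<beta>. 0 < \<beta> \<and> (\<forall>x\<in>X. \<forall>r\<in>{a..b}. \<bar>u x r - u x t\<bar> \<le> M * \<bar>r - t\<bar> powr \<beta>)"
    if X: "compact X" and t: "t \<in> {a<..<b}" for X a b t
  proof (cases k)
    case 0
    have "compact ({a..b} \<times> X)" using X by (intro compact_Times) auto
    then obtain M where "\<And>t t' x. (t, x) \<in> {a..b} \<times> X \<Longrightarrow> (t', x) \<in> {a..b} \<times> X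
      \<Longrightarrow> \<bar>u x t - u x t'\<bar> \<le> M * dist t t' powr \<gamma>"
      using lh unfolding 0 local_holder_deriv.simps by meson
    then show ?thesis using g t by (intro exI[of _ M] exI[of _ \<gamma>]) (auto simp: dist_real_def)
  next
    case (Suc k')
    define w' where "w' = (\<lambda>t x. frechet_derivative (\<lambda>z. u x z) (at t) 1)"
    have diff: "(\<lambda>z. u x z) differentiable (at t)" for t x using lh by (simp add: Suc)
    have lh': "local_holder_deriv k' \<gamma> w'" using lh by (simp add: Suc w'_def)
    have der: "((\<lambda>z. u x z) has_real_derivative w' t x) (at t)" for t x
      unfolding w'_def by (rule frechet_derivative_real[OF diff])
    have "\<exists>B. \<forall>x\<in>X. \<forall>t\<in>{a..b}. \<bar>w' t x\<bar> \<le> B"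
    proof (rule local_holder_deriv_bounded[OF lh'])
      fix X and a b :: real assume X: "compact (X::'a set)" and ab: "a < b"
      obtain B1 where B1: "\<And>x. x \<in> X \<Longrightarrow> \<bar>u x a\<bar> \<le> B1" using bd[OF X, of a] by blast
      obtain B2 where B2: "\<And>x. x \<in> X \<Longrightarrow> \<bar>u x b\<bar> \<le> B2" using bd[OF X, of b] by blast
      have "\<exists>t\<in>{a..b}. \<bar>w' t x\<bar> \<le> (B1 + B2) / (b - a)" if x: "x \<in> X" for x
      proof -
        obtain z where z: "z > a" "z < b" "u x b - u x a = (b - a) * w' z x"
          using MVT2[OF ab, of "u x" "\<lambda>z. w' z x"] der by blast
        have "\<bar>w' z x\<bar> * (b - a) = \<bar>u x b - u x a\<bar>" using z ab by (simp add: abs_mult)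
        also have "\<dots> \<le> B1 + B2" using B1[OF x] B2[OF x] by linarith
        finally have "\<bar>w' z x\<bar> \<le> (B1 + B2) / (b - a)" using ab by (simp add: field_simps)
        then show ?thesis using z by force
      qed
      then show "\<exists>B. \<forall>x\<in>X. \<exists>t\<in>{a..b}. \<bar>w' t x\<bar> \<le> B" by blast
    qed (use g X t in auto)
    then obtain B where B: "\<And>x t. x \<in> X \<Longrightarrow> t \<in> {a..b} \<Longrightarrow> \<bar>w' t x\<bar> \<le> B" by blast
    have "norm (u x r - u x t) \<le> B * norm (r - t)" if "x \<in> X" "r \<in> {a..b}" for x r
      by (rule field_differentiable_bound[of "{a..b}" "u x" "\<lambda>z. w' z x"])
        (use der B that t in \<open>auto intro: has_field_derivative_at_within\<close>)
    then show ?thesis by (intro exI[of _ B] exI[of _ 1]) auto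
  qed
  have "isCont (\<lambda>z. u (fst z) (snd z)) (x, t)" for x t
  proof -
    obtain M \<beta> where \<beta>: "0 < \<beta>" and
      M: "\<And>y r. y \<in> cball x 1 \<Longrightarrow> r \<in> {t - 1..t + 1} \<Longrightarrow> \<bar>u y r - u y t\<bar> \<le> M * \<bar>r - t\<bar> powr \<beta>"
      using mod[OF compact_cball, of t "t - 1" "t + 1" x 1] by fastforce
    have 1: "((\<lambda>z. u (fst z) (snd z) - u (fst z) t) \<longlongrightarrow> 0) (at (x, t))"
    proof (rule Lim_null_comparison)
      show "\<forall>\<^sub>F z in at (x, t). norm (u (fst z) (snd z) - u (fst z) t) \<le> M * \<bar>snd z - t\<bar> powr \<beta>"
        unfolding eventually_at
      proof (intro exI[of _ 1] conjI ballI impI)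
        fix z assume "z \<noteq> (x, t) \<and> dist z (x, t) < 1"
        then have "dist (fst z) x < 1" "dist (snd z) t < 1"
          using dist_fst_le[of z "(x, t)"] dist_snd_le[of z "(x, t)"] by auto
        then show "norm (u (fst z) (snd z) - u (fst z) t) \<le> M * \<bar>snd z - t\<bar> powr \<beta>"
          using M[of "fst z" "snd z"] by (simp add: dist_commute dist_real_def abs_less_iff)
      qed auto
      have "((\<lambda>z. M * \<bar>snd z - t\<bar> powr \<beta>) \<longlongrightarrow> M * \<bar>snd (x, t) - t\<bar> powr \<beta>) (at (x, t))"
        using \<beta> by (intro tendsto_intros) auto
      then show "((\<lambda>z. M * \<bar>snd z - t\<bar> powr \<beta>) \<longlongrightarrow> 0) (at (x, t))" by simp
    qed
    have "isCont (\<lambda>z. u (fst z) t) (x, t)"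
      using cx[of t] by (intro isCont_o2[where g = "\<lambda>x. u x t" and f = fst])
        (auto simp: continuous_on_eq_continuous_within)
    then have 2: "((\<lambda>z. u (fst z) t) \<longlongrightarrow> u x t) (at (x, t))" by (simp add: isCont_def)
    show ?thesis using tendsto_add[OF 1 2] by (simp add: isCont_def)
  qed
  then show ?thesis by (auto simp: continuous_on_eq_continuous_within)
qed

subsection \<open>Gaussian moments\<close>

lemma has_bochner_integral_affine_euclidean:
  fixes f :: "'a::euclidean_space \<Rightarrow> real"
  assumes "has_bochner_integral lborel f I" "c \<noteq> 0"
  shows "has_bochner_integral lborel (\<lambda>y. f ((y - x) /\<^sub>R c)) (\<bar>c\<bar> ^ DIM('a) * I)"
proof -
  have [measurable]: "f \<in> borel_measurable borel" using assms(1) by (auto dest: borel_measurable_has_bochner_integral)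
  have eq: "(lborel :: 'a measure) = density (distr lborel borel (\<lambda>z. x + c *\<^sub>R z)) (\<lambda>_. ennreal (\<bar>c\<bar> ^ DIM('a)))"
    using lborel_affine[of c x] assms(2) by (simp add: ennreal_power)
  show ?thesis
    apply (subst eq)
    apply (rule has_bochner_integral_density)
       apply measurable
     apply simp
    apply (rule has_bochner_integral_distr)
      apply measurable
    using has_bochner_integral_mult_right[OF assms(1), of "\<bar>c\<bar> ^ DIM('a)"] assms(2) by simp
qed

lemma integrable_gaussian:
  assumes "c > 0"
  shows "integrable lborel (\<lambda>z::'a::euclidean_space. exp (- c * (norm z)\<^sup>2))"
proof -
  have 1: "(\<integral>\<^sup>+x. ennreal (exp (- c * (x::real)\<^sup>2)) \<partial>lborel) < \<infinity>"
  proof -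
    have "has_bochner_integral lborel (\<lambda>x::real. indicator {0..} x *\<^sub>R exp (- x\<^sup>2)) (sqrt pi / 2)"
      by (rule gaussian_moment_0)
    then have "has_bochner_integral lborel (\<lambda>x::real. exp (- x\<^sup>2)) (2 * (sqrt pi / 2))"
      using has_bochner_integral_even_function[of "\<lambda>x. exp (- x\<^sup>2)" "sqrt pi / 2"] by simp
    from has_bochner_integral_affine_euclidean[OF this, of "1 / sqrt c" 0] assms
    have "integrable lborel (\<lambda>x::real. exp (- c * x\<^sup>2))"
      by (auto simp: has_bochner_integral_iff power_mult_distrib)
    then show ?thesis by (auto simp: integrable_iff_bounded)
  qed
  have "(\<integral>\<^sup>+z. ennreal (exp (- c * (norm (z::'a))\<^sup>2)) \<partial>lborel)
      = (\<integral>\<^sup>+z. (\<Prod>b\<in>(Basis::'a set). ennreal (exp (- c * (z \<bullet> b)\<^sup>2))) \<partial>lborel)"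
    unfolding norm_eq_sqrt_inner
    apply (subst euclidean_inner)
    apply (auto simp: prod_ennreal exp_sum[symmetric] sum_distrib_left power2_eq_square sum_nonneg sum_negf intro!: nn_integral_cong)
    done
  also have "\<dots> = (\<Prod>b\<in>(Basis::'a set). (\<integral>\<^sup>+x. ennreal (exp (- c * (x::real)\<^sup>2)) \<partial>lborel))"
    by (rule nn_integral_lborel_prod) auto
  also have "\<dots> < \<infinity>" using 1 by (simp add: power_less_top_ennreal)
  finally show ?thesis by (auto simp: integrable_iff_bounded)
qed

section \<open>The space-time kernel and its moments\<close>

definition heat_ker :: "real \<Rightarrow> 'a::euclidean_space \<Rightarrow> real \<Rightarrow> real" where
  "heat_ker s z r = r powr - (real DIM('a) / 2 + 1 + s) * exp (- (norm z)\<^sup>2 / (4 * r))"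

text \<open>Of this number, which is 4 * pi to the power n / 2, the estimates use only
  positivity.\<close>

definition gauss_mass :: "'a::euclidean_space itself \<Rightarrow> real" where
  "gauss_mass _ = (LINT z::'a|lborel. exp (- (norm z)\<^sup>2 / 4))"

definition gauss_var :: "'a::euclidean_space itself \<Rightarrow> real" where
  "gauss_var _ = (LINT z::'a|lborel. (norm z)\<^sup>2 * exp (- (norm z)\<^sup>2 / 4))"

lemma heat_ker_nonneg[simp]: "0 \<le> heat_ker s z r" by (simp add: heat_ker_def)

text \<open>Reflection in the origin makes the first moments vanish; the factor
  \<open>(norm z)\<^sup>2\<close> is paid for with half of the Gaussian exponent.\<close>

lemma gauss_moments:
  "has_bochner_integral lborel (\<lambda>z::'a::euclidean_space. exp (- (norm z)\<^sup>2 / 4)) (gauss_mass TYPE('a))"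
  "has_bochner_integral lborel (\<lambda>z::'a. (norm z)\<^sup>2 * exp (- (norm z)\<^sup>2 / 4)) (gauss_var TYPE('a))"
  "has_bochner_integral lborel (\<lambda>z::'a. (e \<bullet> z) * exp (- (norm z)\<^sup>2 / 4)) 0"
proof -
  have 1: "integrable lborel (\<lambda>z::'a. exp (- (norm z)\<^sup>2 / 4))"
    using integrable_gaussian[of "1/4"] by simp
  have 8: "integrable lborel (\<lambda>z::'a. exp (- (norm z)\<^sup>2 / 8))"
    using integrable_gaussian[of "1/8"] by simp
  have bd: "(norm z)\<^sup>2 * exp (- (norm z)\<^sup>2 / 4) \<le> 8 * exp (- (norm z)\<^sup>2 / 8)" for z :: 'a
  proof -
    have "(norm z)\<^sup>2 / 8 \<le> exp ((norm z)\<^sup>2 / 8)" using exp_ge_add_one_self[of "(norm z)\<^sup>2 / 8"] by linarith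
    then have "(norm z)\<^sup>2 * exp (- (norm z)\<^sup>2 / 4) \<le> 8 * exp ((norm z)\<^sup>2 / 8) * exp (- (norm z)\<^sup>2 / 4)"
      by (intro mult_right_mono) auto
    also have "\<dots> = 8 * exp (- (norm z)\<^sup>2 / 8)" by (simp add: exp_add[symmetric])
    finally show ?thesis .
  qed
  have 2: "integrable lborel (\<lambda>z::'a. (norm z)\<^sup>2 * exp (- (norm z)\<^sup>2 / 4))"
    by (rule Bochner_Integration.integrable_bound[OF integrable_mult_right[OF 8, of 8]]) (use bd in auto)
  have 3: "integrable lborel (\<lambda>z::'a. (e \<bullet> z) * exp (- (norm z)\<^sup>2 / 4))"
  proof (rule Bochner_Integration.integrable_bound)
    show "integrable lborel (\<lambda>z::'a. norm e * (exp (- (norm z)\<^sup>2 / 4) + (norm z)\<^sup>2 * exp (- (norm z)\<^sup>2 / 4)))"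
      using 1 2 by auto
    have "\<bar>e \<bullet> z\<bar> \<le> norm e * (1 + (norm z)\<^sup>2)" for z
    proof -
      have "0 \<le> (norm z - 1)\<^sup>2" by simp
      then have "norm z \<le> 1 + (norm z)\<^sup>2" by (simp add: power2_eq_square algebra_simps) (smt (verit) norm_ge_zero mult_nonneg_nonneg)
      then have "norm e * norm z \<le> norm e * (1 + (norm z)\<^sup>2)" by (intro mult_left_mono) auto
      then show ?thesis using Cauchy_Schwarz_ineq2[of e z] by linarith
    qed
    then have "\<bar>e \<bullet> z\<bar> * exp (- (norm z)\<^sup>2 / 4) \<le> norm e * (1 + (norm z)\<^sup>2) * exp (- (norm z)\<^sup>2 / 4)" for z
      by (intro mult_right_mono) auto
    then show "AE z in lborel. norm ((e \<bullet> z) * exp (- (norm z)\<^sup>2 / 4))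
        \<le> norm (norm e * (exp (- (norm z)\<^sup>2 / 4) + (norm z)\<^sup>2 * exp (- (norm z)\<^sup>2 / 4)))"
      by (auto simp: abs_mult algebra_simps)
  qed auto
  show "has_bochner_integral lborel (\<lambda>z::'a. exp (- (norm z)\<^sup>2 / 4)) (gauss_mass TYPE('a))"
    "has_bochner_integral lborel (\<lambda>z::'a. (norm z)\<^sup>2 * exp (- (norm z)\<^sup>2 / 4)) (gauss_var TYPE('a))"
    using 1 2 by (auto simp: gauss_mass_def gauss_var_def has_bochner_integral_iff)
  let ?g = "\<lambda>z::'a. (e \<bullet> z) * exp (- (norm z)\<^sup>2 / 4)"
  have "has_bochner_integral lborel ?g (LINT z|lborel. ?g z)" using 3 by (simp add: has_bochner_integral_integrable)
  from has_bochner_integral_affine_euclidean[OF this, of "-1" 0]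
  have "has_bochner_integral lborel (\<lambda>z. - ?g z) (LINT z|lborel. ?g z)" by simp
  then have "(LINT z|lborel. ?g z) = - (LINT z|lborel. ?g z)"
    by (auto simp: has_bochner_integral_iff)
  then show "has_bochner_integral lborel ?g 0" using 3 by (auto simp: has_bochner_integral_iff)
qed

text \<open>Parabolic scaling reduces this to \<open>gauss_moments\<close>, and the linear term
  drops out. The value shows how barriers are built: a constant costs
  \<open>r powr (- 1 - s)\<close>, integrable at infinity, while a paraboloid vanishing at the base
  point costs only \<open>r powr - s\<close>, integrable at 0.\<close>

lemma heat_ker_moments:
  fixes x e :: "'a::euclidean_space"
  assumes "r > 0"
  shows "has_bochner_integral lborel
    (\<lambda>y. (\<alpha> + e \<bullet> (y - x) + A * ((norm (y - x))\<^sup>2 + r)) * heat_ker s (x - y) r)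
    (\<alpha> * gauss_mass TYPE('a) * r powr (- 1 - s) + A * (gauss_var TYPE('a) + gauss_mass TYPE('a)) * r powr - s)"
proof -
  define c where "c = sqrt r"
  have c: "c > 0" "c\<^sup>2 = r" using assms by (auto simp: c_def)
  define k where "k = real DIM('a) / 2"
  let ?E = "\<lambda>z::'a. exp (- (norm z)\<^sup>2 / 4)"
  have cn: "c ^ DIM('a) = r powr k"
    using assms by (simp add: c_def k_def powr_half_sqrt[symmetric] powr_realpow[symmetric] powr_powr)
  have "has_bochner_integral lborel (\<lambda>z. (\<alpha> + A * r) * ?E z + (c * ((e \<bullet> z) * ?E z) + A * r * ((norm z)\<^sup>2 * ?E z)))
     ((\<alpha> + A * r) * gauss_mass TYPE('a) + (c * 0 + A * r * gauss_var TYPE('a)))" (is "has_bochner_integral _ ?f ?I")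
    by (intro has_bochner_integral_add has_bochner_integral_mult_right gauss_moments)
  from has_bochner_integral_mult_right[OF has_bochner_integral_affine_euclidean[OF this, of c x], of "r powr - (k + 1 + s)"]
  have "has_bochner_integral lborel (\<lambda>y. r powr - (k + 1 + s) * ?f ((y - x) /\<^sub>R c)) (r powr - (k + 1 + s) * (c ^ DIM('a) * ?I))"
    using c(1) by simp
  moreover have "r powr - (k + 1 + s) * ?f ((y - x) /\<^sub>R c) =
     (\<alpha> + e \<bullet> (y - x) + A * ((norm (y - x))\<^sup>2 + r)) * heat_ker s (x - y) r" for y
  proof -
    have "(norm ((y - x) /\<^sub>R c))\<^sup>2 = (norm (y - x))\<^sup>2 / r"
      using c by (simp add: power_mult_distrib power_divide divide_inverse mult.commute power_inverse)
    then have n: "(norm ((y - x) /\<^sub>R c))\<^sup>2 = (norm (y - x))\<^sup>2 / r" .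
    have E: "?E ((y - x) /\<^sub>R c) = exp (- (norm (x - y))\<^sup>2 / (4 * r))"
      unfolding n by (simp add: norm_minus_commute mult.commute)
    have e: "c * (e \<bullet> ((y - x) /\<^sub>R c)) = e \<bullet> (y - x)" using c(1) by simp
    have "?f ((y - x) /\<^sub>R c) = (\<alpha> + A * r + c * (e \<bullet> ((y - x) /\<^sub>R c)) + A * (norm (y - x))\<^sup>2)
        * exp (- (norm (x - y))\<^sup>2 / (4 * r))"
      unfolding E n using assms by (simp add: distrib_left distrib_right norm_minus_commute[of y x] mult_ac)
    also have "\<dots> = (\<alpha> + e \<bullet> (y - x) + A * ((norm (y - x))\<^sup>2 + r)) * exp (- (norm (x - y))\<^sup>2 / (4 * r))"
      unfolding e by (simp only: algebra_simps)
    finally show ?thesis unfolding heat_ker_def k_def by (simp only: mult.left_commute)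
  qed
  moreover have "r powr - (k + 1 + s) * (c ^ DIM('a) * ?I)
     = \<alpha> * gauss_mass TYPE('a) * r powr (- 1 - s) + A * (gauss_var TYPE('a) + gauss_mass TYPE('a)) * r powr - s"
  proof -
    have "r powr - (k + 1 + s) * (c ^ DIM('a)) = r powr (-1 - s)" by (simp add: cn powr_add[symmetric])
    moreover have "r powr - s = r powr (-1 - s) * r" using assms by (simp add: powr_diff field_simps powr_minus)
    ultimately show ?thesis by (simp add: algebra_simps)
  qed
  ultimately show ?thesis by simp
qed

lemma heat_ker_integral:
  "r > 0 \<Longrightarrow> has_bochner_integral lborel (\<lambda>y::'a::euclidean_space. heat_ker s (x - y) r) (gauss_mass TYPE('a) * r powr (- 1 - s))"
  using heat_ker_moments[of r 1 0 x 0 s] by simp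

lemma gauss_mass_pos: "0 < gauss_mass TYPE('a::euclidean_space)"
proof -
  have i: "integrable lborel (\<lambda>z::'a. exp (- (norm z)\<^sup>2 / 4))" using gauss_moments(1) by (auto simp: has_bochner_integral_iff)
  have "gauss_mass TYPE('a) \<noteq> 0"
  proof
    assume "gauss_mass TYPE('a) = 0"
    then have "AE z::'a in lborel. exp (- (norm z)\<^sup>2 / 4) = 0"
      using integral_nonneg_eq_0_iff_AE[OF i] by (simp add: gauss_mass_def)
    then have "AE z::'a in lborel. False" by simp
    then have "ae_filter (lborel :: 'a measure) = bot" by (simp add: eventually_False)
    then show False by (simp add: ae_filter_eq_bot_iff)
  qed
  moreover have "gauss_mass TYPE('a) \<ge> 0" by (simp add: gauss_mass_def)
  ultimately show ?thesis by simp
qed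

lemma gauss_var_nonneg: "0 \<le> gauss_var TYPE('a::euclidean_space)"
  by (simp add: gauss_var_def)

section \<open>Time integrals of the two powers\<close>

lemma has_bochner_integral_reflect:
  fixes f :: "real \<Rightarrow> real"
  assumes "has_bochner_integral lborel f I"
  shows "has_bochner_integral lborel (\<lambda>\<tau>. f (t - \<tau>)) I"
  using lborel_has_bochner_integral_real_affine_iff[of "-1" f I t] assms by simp

lemma time_integral_far:
  fixes s \<delta> t :: real
  assumes "0 < s" "0 < \<delta>"
  shows "has_bochner_integral lborel (\<lambda>\<tau>. indicator {..t - \<delta>} \<tau> * (t - \<tau>) powr (- 1 - s)) (\<delta> powr - s / s)"
proof -
  have "((\<lambda>x. x powr (- 1 - s)) has_integral \<delta> powr - s / s) {\<delta>..}"
  proof -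
    have "- 1 - s + 1 = - s" by simp
    then have "- (\<delta> powr (- 1 - s + 1)) / (- 1 - s + 1) = \<delta> powr - s / s" by (simp only: minus_divide_divide)
    moreover have "- 1 - s < -1" using assms by simp
    ultimately show ?thesis using has_integral_powr_to_inf[of "- 1 - s" \<delta>] assms(2) by metis
  qed
  then have "((\<lambda>x. if x \<in> {\<delta>..} then x powr (- 1 - s) else 0) has_integral \<delta> powr - s / s) UNIV"
    by (rule has_integral_restrict_UNIV[THEN iffD2])
  also have "(\<lambda>x. if x \<in> {\<delta>..} then x powr (- 1 - s) else 0) = (\<lambda>x. indicator {\<delta>..} x * x powr (- 1 - s))"
    by (auto simp: indicator_def)
  finally have "((\<lambda>x. indicator {\<delta>..} x * x powr (- 1 - s)) has_integral \<delta> powr - s / s) UNIV" .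
  then have "(\<integral>\<^sup>+x. ennreal (indicator {\<delta>..} x * x powr (- 1 - s)) \<partial>lborel) = ennreal (\<delta> powr - s / s)"
    by (intro nn_integral_has_integral_lborel) auto
  then have "has_bochner_integral lborel (\<lambda>x. indicator {\<delta>..} x * x powr (- 1 - s)) (\<delta> powr - s / s)"
    using assms by (intro has_bochner_integral_nn_integral) auto
  from has_bochner_integral_reflect[OF this, of t] show ?thesis
    by (rule has_bochner_integral_cong[THEN iffD1, rotated 3]) (auto simp: indicator_def)
qed

lemma time_integral_near:
  fixes s \<delta> t :: real
  assumes "s < 1" "0 < \<delta>"
  shows "has_bochner_integral lborel (\<lambda>\<tau>. indicator {t - \<delta>..t} \<tau> * (t - \<tau>) powr - s) (\<delta> powr (1 - s) / (1 - s))"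
proof -
  have "((\<lambda>x. x powr - s) has_integral \<delta> powr (1 - s) / (1 - s)) {0..\<delta>}"
  proof -
    have "- s + 1 = 1 - s" by simp
    moreover have "- 1 < - s" "0 \<le> \<delta>" using assms by auto
    ultimately show ?thesis using has_integral_powr_from_0[of "- s" \<delta>] by metis
  qed
  then have "((\<lambda>x. if x \<in> {0..\<delta>} then x powr - s else 0) has_integral \<delta> powr (1 - s) / (1 - s)) UNIV"
    by (rule has_integral_restrict_UNIV[THEN iffD2])
  also have "(\<lambda>x. if x \<in> {0..\<delta>} then x powr - s else 0) = (\<lambda>x. indicator {0..\<delta>} x * x powr - s)"
    by (auto simp: indicator_def)
  finally have "((\<lambda>x. indicator {0..\<delta>} x * x powr - s) has_integral \<delta> powr (1 - s) / (1 - s)) UNIV" .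
  then have "(\<integral>\<^sup>+x. ennreal (indicator {0..\<delta>} x * x powr - s) \<partial>lborel) = ennreal (\<delta> powr (1 - s) / (1 - s))"
    by (intro nn_integral_has_integral_lborel) auto
  then have "has_bochner_integral lborel (\<lambda>x. indicator {0..\<delta>} x * x powr - s) (\<delta> powr (1 - s) / (1 - s))"
    using assms by (intro has_bochner_integral_nn_integral) auto
  from has_bochner_integral_reflect[OF this, of t] show ?thesis
    by (rule has_bochner_integral_cong[THEN iffD1, rotated 3]) (auto simp: indicator_def)
qed

subsection \<open>The comparison principle\<close>

text \<open>The right-hand side is an arbitrary function \<open>F\<close> of space-time, because the
  estimates need only inequalities between \<open>F\<close> and \<open>u\<close>. The spatial
  integral is an ordinary one, since for \<tau> < t the kernel has no singularity in
  \<open>y\<close>.\<close>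

definition heat_solution ::
  "real \<Rightarrow> ('a::euclidean_space \<Rightarrow> real \<Rightarrow> real) \<Rightarrow> ('a \<Rightarrow> real \<Rightarrow> real) \<Rightarrow> bool" where
  "heat_solution s u F \<longleftrightarrow> continuous_on UNIV (\<lambda>z. u (fst z) (snd z)) \<and> (\<forall>x t. 0 \<le> u x t) \<and>
     (\<forall>x t. \<exists>H. (AE \<tau> in lborel. \<tau> < t \<longrightarrow>
          has_bochner_integral lborel (\<lambda>y. (u x t - u y \<tau>) * heat_ker s (x - y) (t - \<tau>)) (H \<tau>)) \<and>
        has_bochner_integral lborel (\<lambda>\<tau>. indicator {..<t} \<tau> * H \<tau>) (F x t / master_const DIM('a) s))"

text \<open>This is what the times before \<open>t - \<delta>\<close> contribute to the equation at
  \<open>(x, t)\<close>. Extended values avoid a separate integrability proof; finiteness comes out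
  of the touching estimates.\<close>

definition mass :: "real \<Rightarrow> ('a::euclidean_space \<Rightarrow> real \<Rightarrow> real) \<Rightarrow> 'a \<Rightarrow> real \<Rightarrow> real \<Rightarrow> ennreal" where
  "mass s u x t \<delta> = (\<integral>\<^sup>+\<tau>\<in>{..t - \<delta>}. (\<integral>\<^sup>+y. ennreal (u y \<tau> * heat_ker s (x - y) (t - \<tau>)) \<partial>lborel) \<partial>lborel)"

lemma heat_solution_nonneg: "heat_solution s u F \<Longrightarrow> 0 \<le> u x t"
  by (simp add: heat_solution_def)

lemma heat_solution_measurable:
  assumes "heat_solution s u F"
  shows "(\<lambda>(\<tau>, y). u y \<tau>) \<in> borel_measurable (borel \<Otimes>\<^sub>M borel)"
proof -
  have c: "continuous_on UNIV (\<lambda>z. u (fst z) (snd z))" using assms by (simp add: heat_solution_def)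
  have "continuous_on UNIV (\<lambda>z. u (snd z) (fst z))"
    using continuous_on_compose2[OF c, of UNIV "\<lambda>z. (snd z, fst z)"] by (simp add: continuous_intros)
  then have "(\<lambda>z. u (snd z) (fst z)) \<in> borel_measurable borel" by (rule borel_measurable_continuous_onI)
  then show "(\<lambda>(\<tau>, y). u y \<tau>) \<in> borel_measurable (borel \<Otimes>\<^sub>M borel)"
    by (simp add: borel_prod case_prod_beta')
qed

lemma heat_ker_measurable[measurable]:
  "(\<lambda>(\<tau>, y). heat_ker s (x - y) (t - \<tau>)) \<in> borel_measurable (borel \<Otimes>\<^sub>M borel)"
  unfolding heat_ker_def by measurable

lemma has_bochner_integral_le_nn_integral:
  fixes f :: "'a \<Rightarrow> real"
  assumes "has_bochner_integral M f I"
  shows "ennreal I \<le> (\<integral>\<^sup>+x. ennreal (f x) \<partial>M)"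
proof -
  have i: "integrable M f" and I: "I = integral\<^sup>L M f" using assms by (auto simp: has_bochner_integral_iff)
  have "I \<le> integral\<^sup>L M (\<lambda>x. max 0 (f x))" unfolding I using i by (intro integral_mono) auto
  then have "ennreal I \<le> ennreal (integral\<^sup>L M (\<lambda>x. max 0 (f x)))" by (rule ennreal_leI)
  also have "\<dots> = (\<integral>\<^sup>+x. ennreal (max 0 (f x)) \<partial>M)"
    using i by (intro nn_integral_eq_integral[symmetric]) auto
  also have "\<dots> = (\<integral>\<^sup>+x. ennreal (f x) \<partial>M)" by (intro nn_integral_cong) (auto simp: max_def ennreal_neg)
  finally show ?thesis .
qed

lemma has_bochner_integral_nn_integral_eq:
  fixes f :: "'a \<Rightarrow> real"
  assumes "has_bochner_integral M f I" "\<And>x. 0 \<le> f x"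
  shows "(\<integral>\<^sup>+x. ennreal (f x) \<partial>M) = ennreal I"
  using assms nn_integral_eq_integral[of M f] by (auto simp: has_bochner_integral_iff)

lemma has_bochner_integral_nonneg:
  fixes f :: "'a \<Rightarrow> real"
  shows "has_bochner_integral M f I \<Longrightarrow> AE x in M. 0 \<le> f x \<Longrightarrow> 0 \<le> I"
  using has_bochner_integral_integral_eq[of M f I] integral_nonneg_AE[of f M] by simp

text \<open>Integrating the touching inequality against the kernel gives
  \<open>H \<tau> \<le> G \<tau>\<close> for almost every \<tau>, and the gap \<open>G - H\<close>
  absorbs all of \<open>m\<close>. Thus one barrier \<open>g\<close> bounds both the right-hand side
  and the mass left over.\<close>

lemma heat_solution_upper:
  assumes sol: "heat_solution s u F"
    and le: "\<And>y \<tau>. \<tau> < t \<Longrightarrow> u x t - u y \<tau> \<le> g y \<tau> - m y \<tau>"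
    and m: "\<And>y \<tau>. \<tau> < t \<Longrightarrow> 0 \<le> m y \<tau>"
    and g: "\<And>\<tau>. \<tau> < t \<Longrightarrow> has_bochner_integral lborel (\<lambda>y. g y \<tau> * heat_ker s (x - y) (t - \<tau>)) (G \<tau>)"
    and G: "has_bochner_integral lborel (\<lambda>\<tau>. indicator {..<t} \<tau> * G \<tau>) I"
  shows "F x t / master_const DIM('a::euclidean_space) s \<le> I"
    "(\<integral>\<^sup>+\<tau>\<in>{..<t}. (\<integral>\<^sup>+y. ennreal (m y \<tau> * heat_ker s (x - y :: 'a) (t - \<tau>)) \<partial>lborel) \<partial>lborel)
       \<le> ennreal (I - F x t / master_const DIM('a) s)"
proof -
  obtain H where H: "AE \<tau> in lborel. \<tau> < t \<longrightarrow>
          has_bochner_integral lborel (\<lambda>y. (u x t - u y \<tau>) * heat_ker s (x - y) (t - \<tau>)) (H \<tau>)"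
    and HI: "has_bochner_integral lborel (\<lambda>\<tau>. indicator {..<t} \<tau> * H \<tau>) (F x t / master_const DIM('a) s)"
    using sol unfolding heat_solution_def by blast
  have AE1: "AE \<tau> in lborel. \<tau> < t \<longrightarrow> H \<tau> \<le> G \<tau> \<and>
      (\<integral>\<^sup>+y. ennreal (m y \<tau> * heat_ker s (x - y :: 'a) (t - \<tau>)) \<partial>lborel) \<le> ennreal (G \<tau> - H \<tau>)"
    using H
  proof eventually_elim
    case (elim \<tau>)
    show ?case
    proof
      assume \<tau>: "\<tau> < t"
      have d: "has_bochner_integral lborel (\<lambda>y. g y \<tau> * heat_ker s (x - y) (t - \<tau>)
          - (u x t - u y \<tau>) * heat_ker s (x - y) (t - \<tau>)) (G \<tau> - H \<tau>)"
        using elim \<tau> by (intro has_bochner_integral_diff g) auto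
      have p: "m y \<tau> * heat_ker s (x - y) (t - \<tau>) \<le> g y \<tau> * heat_ker s (x - y) (t - \<tau>)
          - (u x t - u y \<tau>) * heat_ker s (x - y) (t - \<tau>)" for y
      proof -
        have "m y \<tau> \<le> g y \<tau> - (u x t - u y \<tau>)" using le[OF \<tau>, of y] by linarith
        from mult_right_mono[OF this heat_ker_nonneg] show ?thesis by (simp add: left_diff_distrib)
      qed
      have nn: "0 \<le> g y \<tau> * heat_ker s (x - y) (t - \<tau>) - (u x t - u y \<tau>) * heat_ker s (x - y) (t - \<tau>)" for y
        by (rule order_trans[OF mult_nonneg_nonneg[OF m[OF \<tau>] heat_ker_nonneg] p])
      have "(\<integral>\<^sup>+y. ennreal (m y \<tau> * heat_ker s (x - y) (t - \<tau>)) \<partial>lborel) \<le> ennreal (G \<tau> - H \<tau>)"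
        unfolding has_bochner_integral_nn_integral_eq[OF d nn, symmetric]
        by (intro nn_integral_mono ennreal_leI p)
      moreover have "0 \<le> G \<tau> - H \<tau>"
        using nn by (intro has_bochner_integral_nonneg[OF d]) simp
      ultimately show "H \<tau> \<le> G \<tau> \<and>
        (\<integral>\<^sup>+y. ennreal (m y \<tau> * heat_ker s (x - y) (t - \<tau>)) \<partial>lborel) \<le> ennreal (G \<tau> - H \<tau>)" by simp
    qed
  qed
  have d: "has_bochner_integral lborel (\<lambda>\<tau>. indicator {..<t} \<tau> * G \<tau> - indicator {..<t} \<tau> * H \<tau>)
     (I - F x t / master_const DIM('a) s)"
    by (intro has_bochner_integral_diff G HI)
  have nn: "AE \<tau> in lborel. 0 \<le> indicator {..<t} \<tau> * G \<tau> - indicator {..<t} \<tau> * H \<tau>"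
    using AE1 by eventually_elim (auto simp: indicator_def)
  have "0 \<le> I - F x t / master_const DIM('a) s"
    by (rule has_bochner_integral_nonneg[OF d nn])
  then show "F x t / master_const DIM('a) s \<le> I" by simp
  have "(\<integral>\<^sup>+\<tau>\<in>{..<t}. (\<integral>\<^sup>+y. ennreal (m y \<tau> * heat_ker s (x - y :: 'a) (t - \<tau>)) \<partial>lborel) \<partial>lborel)
     \<le> (\<integral>\<^sup>+\<tau>. ennreal (indicator {..<t} \<tau> * G \<tau> - indicator {..<t} \<tau> * H \<tau>) \<partial>lborel)"
    by (rule nn_integral_mono_AE) (use AE1 in eventually_elim, auto simp: indicator_def)
  also have "\<dots> = ennreal (I - F x t / master_const DIM('a) s)"
    using d nn nn_integral_eq_integral[of lborel "\<lambda>\<tau>. indicator {..<t} \<tau> * G \<tau> - indicator {..<t} \<tau> * H \<tau>"]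
    by (auto simp: has_bochner_integral_iff)
  finally show "(\<integral>\<^sup>+\<tau>\<in>{..<t}. (\<integral>\<^sup>+y. ennreal (m y \<tau> * heat_ker s (x - y :: 'a) (t - \<tau>)) \<partial>lborel) \<partial>lborel)
       \<le> ennreal (I - F x t / master_const DIM('a) s)" .
qed

text \<open>Counterpart of \<open>heat_solution_upper\<close> for contact from above: the excess
  \<open>m\<close> of the barrier must carry whatever \<open>F\<close> does not account for.\<close>

lemma heat_solution_lower:
  assumes sol: "heat_solution s u F"
    and le: "\<And>y \<tau>. \<tau> < t \<Longrightarrow> g y \<tau> - m y \<tau> \<le> u x t - u y \<tau>"
    and g: "\<And>\<tau>. \<tau> < t \<Longrightarrow> has_bochner_integral lborel (\<lambda>y. g y \<tau> * heat_ker s (x - y) (t - \<tau>)) (G \<tau>)"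
    and G: "has_bochner_integral lborel (\<lambda>\<tau>. indicator {..<t} \<tau> * G \<tau>) I"
  shows "ennreal (I - F x t / master_const DIM('a) s) \<le>
    (\<integral>\<^sup>+\<tau>\<in>{..<t}. (\<integral>\<^sup>+y. ennreal (m y \<tau> * heat_ker s (x - y :: 'a::euclidean_space) (t - \<tau>)) \<partial>lborel) \<partial>lborel)"
proof -
  obtain H where H: "AE \<tau> in lborel. \<tau> < t \<longrightarrow>
          has_bochner_integral lborel (\<lambda>y. (u x t - u y \<tau>) * heat_ker s (x - y) (t - \<tau>)) (H \<tau>)"
    and HI: "has_bochner_integral lborel (\<lambda>\<tau>. indicator {..<t} \<tau> * H \<tau>) (F x t / master_const DIM('a) s)"
    using sol unfolding heat_solution_def by blast
  have AE1: "AE \<tau> in lborel. \<tau> < t \<longrightarrow>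
      ennreal (G \<tau> - H \<tau>) \<le> (\<integral>\<^sup>+y. ennreal (m y \<tau> * heat_ker s (x - y :: 'a) (t - \<tau>)) \<partial>lborel)"
    using H
  proof eventually_elim
    case (elim \<tau>)
    show ?case
    proof
      assume \<tau>: "\<tau> < t"
      have d: "has_bochner_integral lborel (\<lambda>y. g y \<tau> * heat_ker s (x - y) (t - \<tau>)
          - (u x t - u y \<tau>) * heat_ker s (x - y) (t - \<tau>)) (G \<tau> - H \<tau>)"
        using elim \<tau> by (intro has_bochner_integral_diff g) auto
      have p: "g y \<tau> * heat_ker s (x - y) (t - \<tau>)
          - (u x t - u y \<tau>) * heat_ker s (x - y) (t - \<tau>) \<le> m y \<tau> * heat_ker s (x - y) (t - \<tau>)" for y
      proof -
        have "g y \<tau> - (u x t - u y \<tau>) \<le> m y \<tau>" using le[OF \<tau>, of y] by linarith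
        from mult_right_mono[OF this heat_ker_nonneg] show ?thesis by (simp add: left_diff_distrib)
      qed
      show "ennreal (G \<tau> - H \<tau>) \<le> (\<integral>\<^sup>+y. ennreal (m y \<tau> * heat_ker s (x - y) (t - \<tau>)) \<partial>lborel)"
        by (rule order_trans[OF has_bochner_integral_le_nn_integral[OF d]]) (intro nn_integral_mono ennreal_leI p)
    qed
  qed
  have d: "has_bochner_integral lborel (\<lambda>\<tau>. indicator {..<t} \<tau> * G \<tau> - indicator {..<t} \<tau> * H \<tau>)
     (I - F x t / master_const DIM('a) s)"
    by (intro has_bochner_integral_diff G HI)
  show ?thesis
    by (rule order_trans[OF has_bochner_integral_le_nn_integral[OF d]], rule nn_integral_mono_AE)
      (use AE1 in eventually_elim, auto simp: indicator_def)
qed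

lemma time_integral_split:
  fixes s \<delta> t A B :: real
  assumes "0 < s" "s < 1" "0 < \<delta>"
  shows "has_bochner_integral lborel (\<lambda>\<tau>. indicator {..<t} \<tau> *
      (if \<tau> \<le> t - \<delta> then A * (t - \<tau>) powr (- 1 - s) else B * (t - \<tau>) powr - s))
      (A * (\<delta> powr - s / s) + B * (\<delta> powr (1 - s) / (1 - s)))"
proof -
  have "has_bochner_integral lborel (\<lambda>\<tau>. A * (indicator {..t - \<delta>} \<tau> * (t - \<tau>) powr (- 1 - s)) +
      B * (indicator {t - \<delta>..t} \<tau> * (t - \<tau>) powr - s))
      (A * (\<delta> powr - s / s) + B * (\<delta> powr (1 - s) / (1 - s)))" (is "has_bochner_integral _ ?f ?I")
    using assms by (intro has_bochner_integral_add has_bochner_integral_mult_right time_integral_far time_integral_near)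
  moreover have "AE \<tau> in lborel. ?f \<tau> = indicator {..<t} \<tau> *
      (if \<tau> \<le> t - \<delta> then A * (t - \<tau>) powr (- 1 - s) else B * (t - \<tau>) powr - s)"
    using AE_lborel_singleton[of t] AE_lborel_singleton[of "t - \<delta>"]
    by eventually_elim (use assms in \<open>auto simp: indicator_def\<close>)
  moreover have "?f \<in> borel_measurable lborel" by measurable
  moreover have "(\<lambda>\<tau>. indicator {..<t} \<tau> *
      (if \<tau> \<le> t - \<delta> then A * (t - \<tau>) powr (- 1 - s) else B * (t - \<tau>) powr - s)) \<in> borel_measurable lborel"
    by measurable
  ultimately show ?thesis using has_bochner_integral_cong_AE by blast
qed

section \<open>Touching by paraboloids from below\<close>

lemma compact_past:
  fixes x :: "'a::euclidean_space"
  shows "compact {(y, \<tau>). \<tau> \<le> t \<and> (norm (y - x))\<^sup>2 + (t - \<tau>) \<le> \<delta>}" (is "compact ?K")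
proof -
  have "?K = {z. snd z \<le> t} \<inter> {z. (norm (fst z - x))\<^sup>2 + (t - snd z) \<le> \<delta>}" by auto
  also have "closed \<dots>" by (intro closed_Int closed_Collect_le continuous_intros)
  finally have "closed ?K" .
  moreover have "?K \<subseteq> cball x (sqrt \<delta>) \<times> {t - \<delta>..t}"
  proof
    fix z assume "z \<in> ?K"
    then obtain y \<tau> where z: "z = (y, \<tau>)" and *: "\<tau> \<le> t" "(norm (y - x))\<^sup>2 + (t - \<tau>) \<le> \<delta>" by blast
    have "dist x y \<le> sqrt \<delta>" using * by (intro real_le_rsqrt) (simp add: dist_norm norm_minus_commute)
    moreover have "t \<le> \<tau> + \<delta>" using * zero_le_power2[of "norm (y - x)"] by linarith
    ultimately show "z \<in> cball x (sqrt \<delta>) \<times> {t - \<delta>..t}" using *(1) by (simp add: z)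
  qed
  moreover have "compact (cball x (sqrt \<delta>) \<times> {t - \<delta>..t})" by (intro compact_Times) auto
  ultimately show ?thesis using compact_Int_closed[of "cball x (sqrt \<delta>) \<times> {t - \<delta>..t}" ?K]
    by (simp add: Int_absorb1)
qed

text \<open>The two terms are the costs, for \<open>a = 1\<close> and \<open>\<delta> = 1\<close>,
  of the barrier of \<open>touching_below\<close>: a constant in the remote past and a paraboloid in
  the recent past.\<close>

definition growth_const :: "'a::euclidean_space itself \<Rightarrow> real \<Rightarrow> real" where
  "growth_const T s = gauss_mass T / s + (gauss_var T + gauss_mass T) / (1 - s)"

lemma growth_const_pos: "0 < s \<Longrightarrow> s < 1 \<Longrightarrow> 0 < growth_const TYPE('a::euclidean_space) s"
  unfolding growth_const_def using gauss_mass_pos[where 'a='a] gauss_var_nonneg[where 'a='a]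
  by (intro add_pos_nonneg) auto

lemma norm_add_sq: "(norm (a + b :: 'a::real_inner))\<^sup>2 = (norm a)\<^sup>2 + 2 * (a \<bullet> b) + (norm b)\<^sup>2"
  by (simp add: power2_norm_eq_inner inner_add_left inner_add_right inner_commute)

text \<open>The barrier is \<open>a * q\<close>, with \<open>q\<close> equal to 1 at
  \<open>(x, t)\<close> and at most 0 in the past outside the backward paraboloid \<open>K\<close>.
  As \<open>u - a * q\<close> is negative at \<open>(x, t)\<close>, its minimum over
  \<open>K\<close> is a minimum over the whole past and lies where \<open>q\<close> is positive.
  There \<open>a * q\<close> controls the recent past, and before
  \<open>t\<^sub>1 - \<delta>\<close> the plain bound \<open>u x\<^sub>1 t\<^sub>1 < a\<close>
  leaves all of \<open>u\<close> as mass.\<close>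

lemma touching_below:
  fixes u :: "'a::euclidean_space \<Rightarrow> real \<Rightarrow> real"
  assumes sol: "heat_solution s u F" and s: "0 < s" "s < 1"
    and less: "u x t < a" and \<delta>: "0 < \<delta>"
  obtains x\<^sub>1 t\<^sub>1 where "t\<^sub>1 \<le> t" "(norm (x\<^sub>1 - x))\<^sup>2 + (t - t\<^sub>1) < \<delta>" "u x\<^sub>1 t\<^sub>1 < a"
    "F x\<^sub>1 t\<^sub>1 / master_const DIM('a) s \<le> growth_const TYPE('a) s * a * \<delta> powr - s"
    "mass s u x\<^sub>1 t\<^sub>1 \<delta> \<le> ennreal (growth_const TYPE('a) s * a * \<delta> powr - s - F x\<^sub>1 t\<^sub>1 / master_const DIM('a) s)"
proof -
  define q where "q = (\<lambda>y \<tau>. 1 - ((norm (y - x))\<^sup>2 + (t - \<tau>)) / \<delta>)"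
  define K where "K = {(y, \<tau>). \<tau> \<le> t \<and> (norm (y - x))\<^sup>2 + (t - \<tau>) \<le> \<delta>}"
  have cu: "continuous_on UNIV (\<lambda>z. u (fst z) (snd z))" and u0: "\<And>x t. 0 \<le> u x t"
    using sol by (auto simp: heat_solution_def)
  have a: "0 < a" using less u0[of x t] by linarith
  have "compact K" unfolding K_def by (rule compact_past)
  moreover have "(x, t) \<in> K" using \<delta> by (simp add: K_def)
  moreover have "continuous_on K (\<lambda>z. u (fst z) (snd z) - a * q (fst z) (snd z))"
    unfolding q_def using \<delta> by (intro continuous_intros continuous_on_subset[OF cu]) auto
  ultimately obtain z where z: "z \<in> K"
    "\<And>w. w \<in> K \<Longrightarrow> u (fst z) (snd z) - a * q (fst z) (snd z) \<le> u (fst w) (snd w) - a * q (fst w) (snd w)"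
    using continuous_attains_inf[of K "\<lambda>z. u (fst z) (snd z) - a * q (fst z) (snd z)"] by (metis empty_iff)
  obtain x\<^sub>1 t\<^sub>1 where zz: "z = (x\<^sub>1, t\<^sub>1)" by (cases z)
  have t1: "t\<^sub>1 \<le> t" using z(1) by (simp add: zz K_def)
  have min: "u x\<^sub>1 t\<^sub>1 - a * q x\<^sub>1 t\<^sub>1 \<le> u y \<tau> - a * q y \<tau>" if "(y, \<tau>) \<in> K" for y \<tau>
    using z(2)[OF that] by (simp add: zz)
  have neg: "u x\<^sub>1 t\<^sub>1 - a * q x\<^sub>1 t\<^sub>1 < 0"
    using min[OF \<open>(x, t) \<in> K\<close>] less by (simp add: q_def)
  have q1: "0 < q x\<^sub>1 t\<^sub>1"
    using neg u0[of x\<^sub>1 t\<^sub>1] a by (smt (verit) mult_nonneg_nonpos)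
  have "q x\<^sub>1 t\<^sub>1 \<le> 1" using t1 \<delta> by (simp add: q_def)
  then have ua: "u x\<^sub>1 t\<^sub>1 < a" using neg a mult_left_mono[of "q x\<^sub>1 t\<^sub>1" 1 a] by linarith
  have all: "u x\<^sub>1 t\<^sub>1 - a * q x\<^sub>1 t\<^sub>1 \<le> u y \<tau> - a * q y \<tau>" if "\<tau> \<le> t" for y \<tau>
  proof (cases "(y, \<tau>) \<in> K")
    case False
    then have "q y \<tau> \<le> 0" using that \<delta> by (simp add: K_def q_def)
    then have "a * q y \<tau> \<le> 0" using a by (simp add: mult_nonneg_nonpos)
    then show ?thesis using neg u0[of y \<tau>] by linarith
  qed (rule min)
  \<comment> \<open>Slope of the paraboloid when it is expanded around \<open>x\<^sub>1\<close>
    instead of \<open>x\<close>; its integral vanishes by symmetry. The zero terms in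
    \<open>g\<close> make both branches instances of \<open>heat_ker_moments\<close>.\<close>
  define e where "e = (2 * a / \<delta>) *\<^sub>R (x\<^sub>1 - x)"
  define g where "g = (\<lambda>y \<tau>. if \<tau> \<le> t\<^sub>1 - \<delta> then a + 0 \<bullet> (y - x\<^sub>1) + 0 * ((norm (y - x\<^sub>1))\<^sup>2 + (t\<^sub>1 - \<tau>))
      else 0 + e \<bullet> (y - x\<^sub>1) + (a / \<delta>) * ((norm (y - x\<^sub>1))\<^sup>2 + (t\<^sub>1 - \<tau>)))"
  define m where "m = (\<lambda>y \<tau>. if \<tau> \<le> t\<^sub>1 - \<delta> then u y \<tau> else 0)"
  define G where "G = (\<lambda>\<tau>. if \<tau> \<le> t\<^sub>1 - \<delta> then (a * gauss_mass TYPE('a)) * (t\<^sub>1 - \<tau>) powr (- 1 - s)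
     else (a / \<delta> * (gauss_var TYPE('a) + gauss_mass TYPE('a))) * (t\<^sub>1 - \<tau>) powr - s)"
  have le: "u x\<^sub>1 t\<^sub>1 - u y \<tau> \<le> g y \<tau> - m y \<tau>" if "\<tau> < t\<^sub>1" for y \<tau>
  proof (cases "\<tau> \<le> t\<^sub>1 - \<delta>")
    case True then show ?thesis using ua by (simp add: g_def m_def)
  next
    case False
    have "u x\<^sub>1 t\<^sub>1 - u y \<tau> \<le> a * (q x\<^sub>1 t\<^sub>1 - q y \<tau>)" using all[of \<tau> y] that t1 by (simp add: algebra_simps)
    also have "\<dots> = a / \<delta> * ((norm (y - x))\<^sup>2 - (norm (x\<^sub>1 - x))\<^sup>2 + (t\<^sub>1 - \<tau>))"
      using \<delta> by (simp add: q_def field_simps)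
    also have "(norm (y - x))\<^sup>2 - (norm (x\<^sub>1 - x))\<^sup>2 = 2 * ((x\<^sub>1 - x) \<bullet> (y - x\<^sub>1)) + (norm (y - x\<^sub>1))\<^sup>2"
      using norm_add_sq[of "x\<^sub>1 - x" "y - x\<^sub>1"] by simp
    also have "a / \<delta> * (2 * ((x\<^sub>1 - x) \<bullet> (y - x\<^sub>1)) + (norm (y - x\<^sub>1))\<^sup>2 + (t\<^sub>1 - \<tau>)) = g y \<tau> - m y \<tau>"
      using False by (simp add: g_def m_def e_def algebra_simps)
    finally show ?thesis .
  qed
  have gG: "has_bochner_integral lborel (\<lambda>y. g y \<tau> * heat_ker s (x\<^sub>1 - y) (t\<^sub>1 - \<tau>)) (G \<tau>)" if "\<tau> < t\<^sub>1" for \<tau>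
    using heat_ker_moments[of "t\<^sub>1 - \<tau>" a 0 x\<^sub>1 0 s] heat_ker_moments[of "t\<^sub>1 - \<tau>" 0 e x\<^sub>1 "a / \<delta>" s] that
    unfolding g_def G_def by (cases "\<tau> \<le> t\<^sub>1 - \<delta>") simp_all
  have I: "has_bochner_integral lborel (\<lambda>\<tau>. indicator {..<t\<^sub>1} \<tau> * G \<tau>) (growth_const TYPE('a) s * a * \<delta> powr - s)"
  proof -
    \<comment> \<open>The factor \<open>1 / \<delta>\<close> of the paraboloid turns the near part
      into the same power of \<delta> as the far part.\<close>
    have "\<delta> powr (1 - s) = \<delta> * \<delta> powr - s" using powr_add[of \<delta> 1 "- s"] \<delta> by simp
    then have h: "a / \<delta> * V * (\<delta> powr (1 - s) / (1 - s)) = a * V * (\<delta> powr - s / (1 - s))" for V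
      using \<delta> by simp
    have "a * gauss_mass TYPE('a) * (\<delta> powr - s / s)
         + a / \<delta> * (gauss_var TYPE('a) + gauss_mass TYPE('a)) * (\<delta> powr (1 - s) / (1 - s))
        = growth_const TYPE('a) s * a * \<delta> powr - s"
      unfolding h growth_const_def by (simp add: algebra_simps add_divide_distrib)
    then show ?thesis
      using time_integral_split[OF s \<delta>, of t\<^sub>1 "a * gauss_mass TYPE('a)" "a / \<delta> * (gauss_var TYPE('a) + gauss_mass TYPE('a))"]
      unfolding G_def by simp
  qed
  have m0: "\<And>y \<tau>. \<tau> < t\<^sub>1 \<Longrightarrow> 0 \<le> m y \<tau>" by (simp add: m_def u0)
  note * = heat_solution_upper[where x=x\<^sub>1 and t=t\<^sub>1 and g=g and m=m, OF sol le m0 gG I]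
  have "mass s u x\<^sub>1 t\<^sub>1 \<delta> = (\<integral>\<^sup>+\<tau>\<in>{..<t\<^sub>1}. (\<integral>\<^sup>+y. ennreal (m y \<tau> * heat_ker s (x\<^sub>1 - y) (t\<^sub>1 - \<tau>)) \<partial>lborel) \<partial>lborel)"
    unfolding mass_def by (intro nn_integral_cong) (use \<delta> in \<open>auto simp: m_def indicator_def\<close>)
  then show thesis
    using that[OF t1 _ ua *(1)] *(2) q1 \<delta> by (simp add: q_def)
qed

subsection \<open>Growth and blow-up\<close>

lemma mass_mono_shift:
  fixes u :: "'a::euclidean_space \<Rightarrow> real \<Rightarrow> real"
  assumes sol: "heat_solution s u F" and c: "0 \<le> c"
    and t: "t\<^sub>0 - \<delta>\<^sub>0 \<le> t\<^sub>1 - \<delta>\<^sub>1"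
    and le: "\<And>y \<tau>. \<tau> \<le> t\<^sub>0 - \<delta>\<^sub>0 \<Longrightarrow> c * heat_ker s (x\<^sub>0 - y) (t\<^sub>0 - \<tau>) \<le> heat_ker s (x\<^sub>1 - y) (t\<^sub>1 - \<tau>)"
  shows "ennreal c * mass s u x\<^sub>0 t\<^sub>0 \<delta>\<^sub>0 \<le> mass s u x\<^sub>1 t\<^sub>1 \<delta>\<^sub>1"
proof -
  note [measurable] = heat_solution_measurable[OF sol]
  have "ennreal c * mass s u x\<^sub>0 t\<^sub>0 \<delta>\<^sub>0 = (\<integral>\<^sup>+\<tau>. ennreal c *
      ((\<integral>\<^sup>+y. ennreal (u y \<tau> * heat_ker s (x\<^sub>0 - y) (t\<^sub>0 - \<tau>)) \<partial>lborel) * indicator {..t\<^sub>0 - \<delta>\<^sub>0} \<tau>) \<partial>lborel)"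
    unfolding mass_def by (rule nn_integral_cmult[symmetric]) measurable
  also have "\<dots> \<le> mass s u x\<^sub>1 t\<^sub>1 \<delta>\<^sub>1"
    unfolding mass_def
  proof (rule nn_integral_mono)
    fix \<tau>
    show "ennreal c * ((\<integral>\<^sup>+y. ennreal (u y \<tau> * heat_ker s (x\<^sub>0 - y) (t\<^sub>0 - \<tau>)) \<partial>lborel) * indicator {..t\<^sub>0 - \<delta>\<^sub>0} \<tau>)
       \<le> (\<integral>\<^sup>+y. ennreal (u y \<tau> * heat_ker s (x\<^sub>1 - y) (t\<^sub>1 - \<tau>)) \<partial>lborel) * indicator {..t\<^sub>1 - \<delta>\<^sub>1} \<tau>"
    proof (cases "\<tau> \<le> t\<^sub>0 - \<delta>\<^sub>0")
      case True
      have "ennreal c * (\<integral>\<^sup>+y. ennreal (u y \<tau> * heat_ker s (x\<^sub>0 - y) (t\<^sub>0 - \<tau>)) \<partial>lborel)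
        = (\<integral>\<^sup>+y. ennreal c * ennreal (u y \<tau> * heat_ker s (x\<^sub>0 - y) (t\<^sub>0 - \<tau>)) \<partial>lborel)"
        by (rule nn_integral_cmult[symmetric]) measurable
      also have "\<dots> \<le> (\<integral>\<^sup>+y. ennreal (u y \<tau> * heat_ker s (x\<^sub>1 - y) (t\<^sub>1 - \<tau>)) \<partial>lborel)"
      proof (rule nn_integral_mono)
        fix y
        have "c * (u y \<tau> * heat_ker s (x\<^sub>0 - y) (t\<^sub>0 - \<tau>)) \<le> u y \<tau> * heat_ker s (x\<^sub>1 - y) (t\<^sub>1 - \<tau>)"
          using mult_left_mono[OF le[OF True, of y] heat_solution_nonneg[OF sol, of y \<tau>]] by (simp add: mult.left_commute)
        then show "ennreal c * ennreal (u y \<tau> * heat_ker s (x\<^sub>0 - y) (t\<^sub>0 - \<tau>)) \<le> ennreal (u y \<tau> * heat_ker s (x\<^sub>1 - y) (t\<^sub>1 - \<tau>))"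
          using c by (simp add: ennreal_mult'[symmetric] ennreal_leI)
      qed
      finally show ?thesis using True t by (simp add: indicator_def)
    qed (simp add: indicator_def)
  qed
  finally show ?thesis .
qed

text \<open>Cauchy-Schwarz in Engel form; the defect is an explicit square.\<close>

lemma square_sum_div_le:
  fixes A B r h :: real
  assumes "0 < r" "0 < h"
  shows "(A + B)\<^sup>2 / (r + h) \<le> A\<^sup>2 / r + B\<^sup>2 / h"
proof -
  have "(A\<^sup>2 / r + B\<^sup>2 / h) * (r + h) - (A + B)\<^sup>2 = (h * A - r * B)\<^sup>2 / (r * h)"
    using assms by (simp add: field_simps power2_eq_square)
  also have "\<dots> \<ge> 0" using assms by simp
  finally show ?thesis using assms by (simp add: pos_divide_le_eq)
qed

text \<open>The base point moves later by \<open>h\<close> and sideways by \<open>d\<close>. By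
  \<open>square_sum_div_le\<close> the exponent loses at most \<open>8 / 4 = 2\<close>, and
  \<open>r + h \<le> 3 * r\<close> costs the power of 3.\<close>

lemma heat_ker_shift:
  fixes z d :: "'a::euclidean_space"
  assumes "0 < r" "0 < h" "h \<le> 2 * r" "(norm d)\<^sup>2 \<le> 8 * h" "0 < s"
  shows "3 powr - (real DIM('a) / 2 + 1 + s) * exp (- 2) * heat_ker s z r \<le> heat_ker s (z + d) (r + h)"
proof -
  define k where "k = real DIM('a) / 2 + 1 + s"
  have k: "0 \<le> k" using assms by (simp add: k_def)
  have "(norm (z + d))\<^sup>2 / (r + h) \<le> (norm z + norm d)\<^sup>2 / (r + h)"
    using assms by (intro divide_right_mono power_mono norm_triangle_ineq) auto
  also have "\<dots> \<le> (norm z)\<^sup>2 / r + (norm d)\<^sup>2 / h" by (rule square_sum_div_le) (use assms in auto)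
  also have "(norm d)\<^sup>2 / h \<le> 8" using assms by (simp add: pos_divide_le_eq)
  finally have "(norm (z + d))\<^sup>2 / (r + h) \<le> (norm z)\<^sup>2 / r + 8" by simp
  then have e: "exp (- 2) * exp (- (norm z)\<^sup>2 / (4 * r)) \<le> exp (- (norm (z + d))\<^sup>2 / (4 * (r + h)))"
  proof -
    have 1: "- Z / (4 * w) = - (Z / w / 4)" for Z w :: real by simp
    have "- 2 + - (P / 4) \<le> - (Q / 4)" if "Q \<le> P + 8" for P Q :: real using that by simp
    then show ?thesis
      using \<open>(norm (z + d))\<^sup>2 / (r + h) \<le> (norm z)\<^sup>2 / r + 8\<close>
      unfolding exp_add[symmetric] exp_le_cancel_iff 1 by blast
  qed
  have "(3 * r) powr - k \<le> (r + h) powr - k"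
    using assms k by (intro powr_mono2') auto
  then have p: "3 powr - k * r powr - k \<le> (r + h) powr - k" using assms by (simp add: powr_mult)
  have "(3 powr - k * r powr - k) * (exp (- 2) * exp (- (norm z)\<^sup>2 / (4 * r)))
    \<le> (r + h) powr - k * exp (- (norm (z + d))\<^sup>2 / (4 * (r + h)))"
    by (intro mult_mono p e) auto
  then show ?thesis unfolding heat_ker_def k_def[symmetric] by (simp only: mult_ac)
qed

text \<open>The loss of \<open>heat_ker_shift\<close> divided by the growth constant; the factor
  \<open>2 powr s\<close> comes from touching at scale \<open>\<delta> / 2\<close> in
  \<open>mass_lower_bound\<close>.\<close>

definition mass_const :: "'a::euclidean_space itself \<Rightarrow> real \<Rightarrow> real" where
  "mass_const T s = 3 powr - (real DIM('a) / 2 + 1 + s) * exp (- 2) / (growth_const T s * 2 powr s)"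

lemma mass_const_pos: "0 < s \<Longrightarrow> s < 1 \<Longrightarrow> 0 < mass_const TYPE('a::euclidean_space) s"
  unfolding mass_const_def using growth_const_pos[where 'a='a] by simp

lemma master_const_pos:
  assumes "0 < s" "s < 1"
  shows "0 < master_const n s"
proof -
  \<comment> \<open>At its poles \<open>Gamma\<close> has the value 0 by convention, so these points
    have to be excluded.\<close>
  have "- s \<notin> \<int>\<^sub>\<le>\<^sub>0"
  proof
    assume "- s \<in> \<int>\<^sub>\<le>\<^sub>0"
    then obtain i where "- s = of_int i" by (rule nonpos_Ints_cases)
    then have "of_int i < (0::real)" "of_int (- 1) < (of_int i :: real)" using assms by auto
    then show False unfolding of_int_less_iff by simp
  qed
  then have "Gamma (- s) \<noteq> 0" by (simp add: Gamma_eq_zero_iff)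
  then show ?thesis by (simp add: master_const_def)
qed

text \<open>If \<open>u x t\<close> were below the claimed value, \<open>touching_below\<close> at
  scale \<open>\<delta> / 2\<close> would give a point shortly before \<open>(x, t)\<close> whose
  past mass is too small. That point is still later than \<open>t\<^sub>0\<close> by at least
  \<open>\<delta> / 2\<close>, so by \<open>heat_ker_shift\<close> its kernel dominates a multiple
  of the kernel of \<open>(x\<^sub>0, t\<^sub>0)\<close>.\<close>

lemma mass_lower_bound:
  fixes u :: "'a::euclidean_space \<Rightarrow> real \<Rightarrow> real"
  assumes sol: "heat_solution s u F" and s: "0 < s" "s < 1" and F: "\<And>x t. 0 \<le> F x t"
    and \<delta>: "0 < \<delta>" and m: "0 \<le> m" "ennreal m \<le> mass s u x\<^sub>0 t\<^sub>0 \<delta>"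
    and x: "(norm (x - x\<^sub>0))\<^sup>2 \<le> \<delta>" and t: "t\<^sub>0 + \<delta> \<le> t" "t \<le> t\<^sub>0 + 2 * \<delta>"
  shows "mass_const TYPE('a) s * m * \<delta> powr s \<le> u x t"
proof (rule ccontr)
  define C\<^sub>1 where "C\<^sub>1 = growth_const TYPE('a) s"
  define c\<^sub>3 where "c\<^sub>3 = 3 powr - (real DIM('a) / 2 + 1 + s) * exp (- 2)"
  have C1: "0 < C\<^sub>1" using growth_const_pos s by (simp add: C\<^sub>1_def)
  have c3: "0 < c\<^sub>3" by (simp add: c\<^sub>3_def)
  assume "\<not> ?thesis"
  \<comment> \<open>Both inequalities have to be strict: the first for
    \<open>touching_below\<close>, the second for the contradiction.\<close>
  then obtain a where a: "u x t < a" "a < mass_const TYPE('a) s * m * \<delta> powr s"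
    by (meson dense not_le)
  obtain x\<^sub>1 t\<^sub>1 where *: "t\<^sub>1 \<le> t" "(norm (x\<^sub>1 - x))\<^sup>2 + (t - t\<^sub>1) < \<delta> / 2"
    "mass s u x\<^sub>1 t\<^sub>1 (\<delta> / 2) \<le> ennreal (C\<^sub>1 * a * (\<delta> / 2) powr - s - F x\<^sub>1 t\<^sub>1 / master_const DIM('a) s)"
    by (rule touching_below[OF sol s a(1), of "\<delta> / 2", folded C\<^sub>1_def]) (use \<delta> in simp, blast)
  have tt: "t - t\<^sub>1 < \<delta> / 2" using *(2) zero_le_power2[of "norm (x\<^sub>1 - x)"] by linarith
  have nx: "(norm (x\<^sub>1 - x))\<^sup>2 < \<delta> / 2" using * by linarith
  have "(norm (x\<^sub>1 - x\<^sub>0))\<^sup>2 \<le> (norm (x\<^sub>1 - x) + norm (x - x\<^sub>0))\<^sup>2"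
    using norm_triangle_ineq[of "x\<^sub>1 - x" "x - x\<^sub>0"] by (intro power_mono) simp_all
  also have "\<dots> \<le> 2 * (norm (x\<^sub>1 - x))\<^sup>2 + 2 * (norm (x - x\<^sub>0))\<^sup>2"
    using sum_squares_bound[of "norm (x\<^sub>1 - x)" "norm (x - x\<^sub>0)"] by (simp add: power2_sum)
  finally have nd: "(norm (x\<^sub>1 - x\<^sub>0))\<^sup>2 \<le> 4 * \<delta>" using nx x \<delta> by linarith
  have h: "\<delta> / 2 \<le> t\<^sub>1 - t\<^sub>0" "t\<^sub>1 - t\<^sub>0 \<le> 2 * \<delta>" using t tt *(1) by linarith+
  have h3: "(norm (x\<^sub>1 - x\<^sub>0))\<^sup>2 \<le> 8 * (t\<^sub>1 - t\<^sub>0)"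
    by (rule order_trans[OF nd]) (use h(1) in argo)
  have "ennreal c\<^sub>3 * mass s u x\<^sub>0 t\<^sub>0 \<delta> \<le> mass s u x\<^sub>1 t\<^sub>1 (\<delta> / 2)"
  proof (rule mass_mono_shift[OF sol])
    fix y \<tau> assume \<tau>: "\<tau> \<le> t\<^sub>0 - \<delta>"
    have "0 < t\<^sub>0 - \<tau>" "0 < t\<^sub>1 - t\<^sub>0" using \<tau> h(1) \<delta> by linarith+
    moreover have "t\<^sub>1 - t\<^sub>0 \<le> 2 * (t\<^sub>0 - \<tau>)" using \<tau> h(2) \<delta> by argo
    ultimately have "c\<^sub>3 * heat_ker s (x\<^sub>0 - y) (t\<^sub>0 - \<tau>) \<le> heat_ker s ((x\<^sub>0 - y) + (x\<^sub>1 - x\<^sub>0)) ((t\<^sub>0 - \<tau>) + (t\<^sub>1 - t\<^sub>0))"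
      unfolding c\<^sub>3_def using h3 s(1) by (rule heat_ker_shift)
    then show "c\<^sub>3 * heat_ker s (x\<^sub>0 - y) (t\<^sub>0 - \<tau>) \<le> heat_ker s (x\<^sub>1 - y) (t\<^sub>1 - \<tau>)" by simp
  qed (use c3 h in auto)
  then have "ennreal c\<^sub>3 * ennreal m \<le> mass s u x\<^sub>1 t\<^sub>1 (\<delta> / 2)"
    using m(2) by (meson mult_left_mono order_trans zero_le)
  also have "\<dots> \<le> ennreal (C\<^sub>1 * a * (\<delta> / 2) powr - s)"
    by (rule order_trans[OF *(3)], rule ennreal_leI)
      (use F[of x\<^sub>1 t\<^sub>1] master_const_pos[OF s, of "DIM('a)"] in simp)
  finally have "c\<^sub>3 * m \<le> C\<^sub>1 * a * (\<delta> / 2) powr - s"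
    using c3 m(1) C1 a(1) heat_solution_nonneg[OF sol, of x t]
    by (simp add: ennreal_mult'[symmetric] ennreal_le_iff)
  also have "\<dots> < C\<^sub>1 * (mass_const TYPE('a) s * m * \<delta> powr s) * (\<delta> / 2) powr - s"
    using C1 a(2) \<delta> by simp
  also have "\<dots> = c\<^sub>3 * m"
  proof -
    have "(\<delta> / 2) powr - s = \<delta> powr - s * 2 powr s" using \<delta> by (simp add: powr_divide powr_minus field_simps)
    moreover have "\<delta> powr s * \<delta> powr - s = 1" using \<delta> by (simp add: powr_minus)
    moreover have "mass_const TYPE('a) s = c\<^sub>3 / (C\<^sub>1 * 2 powr s)" by (simp only: mass_const_def C\<^sub>1_def c\<^sub>3_def)
    ultimately show ?thesis using C1 by simp
  qed
  finally show False by simp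
qed

text \<open>\<open>A\<close> is universal: no solution stays above it on a whole unit cylinder.
  Otherwise, on cylinders that halve at each step and all end at
  \<open>(x\<^sub>0, t\<^sub>0 + 1)\<close>, the lower bound is multiplied by \<open>l\<close> each
  time: a point below the improved bound would yield a touching point in the previous cylinder,
  where the superlinear growth of \<open>F\<close> contradicts
  \<open>touching_below\<close>.\<close>

lemma blow_up:
  fixes s p \<kappa> K\<^sub>0 :: real
  assumes s: "0 < s" "s < 1" and p: "1 < p" and \<kappa>: "0 < \<kappa>" and K0: "0 \<le> K\<^sub>0"
  obtains A where "0 < A"
    "\<And>(u :: 'a::euclidean_space \<Rightarrow> real \<Rightarrow> real) F (x\<^sub>0::'a) t\<^sub>0. heat_solution s u F \<Longrightarrow> (\<And>x t. \<kappa> * u x t powr p - K\<^sub>0 \<le> F x t) \<Longrightarrow>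
      \<exists>x t. norm (x - x\<^sub>0) \<le> 1 \<and> t\<^sub>0 \<le> t \<and> t \<le> t\<^sub>0 + 1 \<and> u x t < A"
proof -
  define c where "c = master_const DIM('a) s"
  define C\<^sub>1 where "C\<^sub>1 = growth_const TYPE('a) s"
  \<comment> \<open>Halving the radius costs at most a factor 4 in the bound of
    \<open>touching_below\<close>, and raising the level by \<open>l\<close> gains
    \<open>l powr (p - 1) = 4\<close> in the ratio of \<open>u powr p\<close> to
    \<open>u\<close>.\<close>
  define l where "l = (4::real) powr (1 / (p - 1))"
  \<comment> \<open>After division by \<open>4 ^ j * B\<close>, which is at least 1,
    \<open>D\<close> bounds all terms opposing the growth; \<open>A\<close> is chosen to make
    \<open>\<kappa> * A powr (p - 1)\<close> exceed it.\<close>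
  define D where "D = K\<^sub>0 + 4 * l * c * C\<^sub>1"
  define A where "A = max 1 (((D + 1) / \<kappa>) powr (1 / (p - 1)))"
  have c: "0 < c" using master_const_pos s by (simp add: c_def)
  have C1: "0 < C\<^sub>1" using growth_const_pos s by (simp add: C\<^sub>1_def)
  have l: "1 < l" "l powr (p - 1) = 4" using p by (auto simp: l_def powr_powr)
  have D: "0 \<le> D" using K0 l c C1 by (simp add: D_def)
  have A1: "1 \<le> A" by (simp add: A_def)
  have "(((D + 1) / \<kappa>) powr (1 / (p - 1))) powr (p - 1) \<le> A powr (p - 1)"
    by (rule powr_mono2) (use p in \<open>auto simp: A_def\<close>)
  moreover have "(((D + 1) / \<kappa>) powr (1 / (p - 1))) powr (p - 1) = (D + 1) / \<kappa>"
    using p \<kappa> D by (simp add: powr_powr)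
  ultimately have AD: "D < \<kappa> * A powr (p - 1)" using \<kappa> by (simp add: pos_divide_le_eq mult.commute)
  show thesis
  proof (rule that[of A])
    fix u :: "'a \<Rightarrow> real \<Rightarrow> real" and F and x\<^sub>0 :: 'a and t\<^sub>0
    assume sol: "heat_solution s u F" and F: "\<And>x t. \<kappa> * u x t powr p - K\<^sub>0 \<le> F x t"
    show "\<exists>x t. norm (x - x\<^sub>0) \<le> 1 \<and> t\<^sub>0 \<le> t \<and> t \<le> t\<^sub>0 + 1 \<and> u x t < A"
    proof (rule ccontr)
      assume no: "\<not> ?thesis"
      have *: "l ^ j * A \<le> u x t"
        if "norm (x - x\<^sub>0) \<le> (1/2) ^ j" "t\<^sub>0 + 1 - (1/2) ^ j \<le> t" "t \<le> t\<^sub>0 + 1" for j x t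
        using that
      proof (induction j arbitrary: x t)
        case 0
        then show ?case using no by force
      next
        case (Suc j)
        define \<rho> where "\<rho> = (1/2::real) ^ Suc j"
        have \<rho>: "0 < \<rho>" "\<rho> \<le> 1" unfolding \<rho>_def by (simp, rule power_le_one, auto)
        define B where "B = l ^ j * A"
        have B: "1 \<le> B" using l A1 by (simp add: B_def mult_ge1_I one_le_power)
        show ?case
        proof (rule ccontr)
          assume "\<not> ?thesis"
          then have "u x t < l * B" by (simp add: B_def mult.assoc)
          then obtain x\<^sub>1 t\<^sub>1 where 1: "t\<^sub>1 \<le> t" "(norm (x\<^sub>1 - x))\<^sup>2 + (t - t\<^sub>1) < \<rho>\<^sup>2"
            "F x\<^sub>1 t\<^sub>1 / c \<le> C\<^sub>1 * (l * B) * (\<rho>\<^sup>2) powr - s"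
            by (rule touching_below[OF sol s, of x t "l * B" "\<rho>\<^sup>2", folded C\<^sub>1_def c_def]) (use \<rho> in simp, blast)
          have "(norm (x\<^sub>1 - x))\<^sup>2 < \<rho>\<^sup>2" using 1 by linarith
          then have "norm (x\<^sub>1 - x) < \<rho>" using \<rho> by (simp add: power_less_imp_less_base)
          then have nx: "norm (x\<^sub>1 - x\<^sub>0) \<le> (1/2) ^ j"
            using Suc.prems(1) norm_triangle_ineq[of "x\<^sub>1 - x" "x - x\<^sub>0"] by (simp add: \<rho>_def)
          have "\<rho>\<^sup>2 \<le> \<rho>" using \<rho> by (simp add: power2_eq_square mult_left_le)
          then have "t - t\<^sub>1 \<le> \<rho>" using 1(2) zero_le_power2[of "norm (x\<^sub>1 - x)"] by linarith
          then have "t\<^sub>0 + 1 - (1/2) ^ j \<le> t\<^sub>1" using Suc.prems(2) by (simp add: \<rho>_def)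
          then have u1: "B \<le> u x\<^sub>1 t\<^sub>1" using Suc.IH[of x\<^sub>1 t\<^sub>1] nx 1(1) Suc.prems(3) by (simp add: B_def)
          \<comment> \<open>As \<rho> \<le> 1 and s < 1, the exponent may be replaced by -1, which
            makes the factor per step 4 for every \<open>s\<close>.\<close>
          have "(\<rho>\<^sup>2) powr - s \<le> (\<rho>\<^sup>2) powr - 1"
            using \<rho> s by (intro powr_mono') (auto simp: power_le_one)
          also have "\<dots> = 4 * 4 ^ j"
            using \<rho> by (simp add: powr_minus \<rho>_def power_divide power_mult_distrib power2_eq_square flip: power_mult_distrib)
          finally have \<rho>s: "(\<rho>\<^sup>2) powr - s \<le> 4 * 4 ^ j" .
          have Bp: "B powr p = 4 ^ j * A powr (p - 1) * B"
          proof -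
            have "B powr (p - 1) = (l ^ j) powr (p - 1) * A powr (p - 1)"
              using l A1 by (simp add: B_def powr_mult)
            also have "(l ^ j) powr (p - 1) = (l powr (p - 1)) ^ j"
              using l by (metis powr_realpow powr_powr mult.commute powr_gt_zero zero_less_one less_trans)
            finally show ?thesis using B l(2) powr_add[of B "p - 1" 1] by simp
          qed
          have "\<kappa> * B powr p - K\<^sub>0 \<le> \<kappa> * u x\<^sub>1 t\<^sub>1 powr p - K\<^sub>0"
            using u1 B p \<kappa> by (intro diff_right_mono mult_left_mono powr_mono2) auto
          also have "\<dots> \<le> F x\<^sub>1 t\<^sub>1" by (rule F)
          also have "\<dots> \<le> c * (C\<^sub>1 * (l * B) * (\<rho>\<^sup>2) powr - s)" using 1(3) c by (simp add: pos_divide_le_eq mult.commute)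
          also have "\<dots> \<le> c * (C\<^sub>1 * (l * B) * (4 * 4 ^ j))"
            using c C1 l B \<rho>s by (intro mult_left_mono) auto
          finally have "\<kappa> * A powr (p - 1) * (4 ^ j * B) \<le> K\<^sub>0 + 4 * l * c * C\<^sub>1 * (4 ^ j * B)"
            unfolding Bp by (simp add: mult_ac)
          also have "K\<^sub>0 \<le> K\<^sub>0 * (4 ^ j * B)"
            using K0 B mult_left_mono[of 1 "4 ^ j * B" K\<^sub>0] by (simp add: mult_ge1_I)
          finally have "\<kappa> * A powr (p - 1) * (4 ^ j * B) \<le> D * (4 ^ j * B)"
            by (simp add: D_def distrib_right)
          then have "\<kappa> * A powr (p - 1) \<le> D" using B by simp
          with AD show False by simp
        qed
      qed
      obtain j where "u x\<^sub>0 (t\<^sub>0 + 1) < l ^ j" using real_arch_pow[OF l(1)] by blast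
      moreover have "l ^ j \<le> l ^ j * A" using l A1 by simp
      moreover have "l ^ j * A \<le> u x\<^sub>0 (t\<^sub>0 + 1)" by (rule *) auto
      ultimately show False by linarith
    qed
  qed (use A1 in simp)
qed

text \<open>A larger mass would, by \<open>mass_lower_bound\<close> at scale 1, keep
  \<open>u\<close> above the threshold of \<open>blow_up\<close> on a whole later unit
  cylinder.\<close>

lemma mass_bound:
  fixes s p \<kappa> K\<^sub>0 :: real
  assumes s: "0 < s" "s < 1" and p: "1 < p" and \<kappa>: "0 < \<kappa>" and K0: "0 \<le> K\<^sub>0"
  obtains C where "0 < C"
    "\<And>(u :: 'a::euclidean_space \<Rightarrow> real \<Rightarrow> real) F (x::'a) t. heat_solution s u F \<Longrightarrow> (\<And>x t. 0 \<le> F x t) \<Longrightarrow>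
      (\<And>x t. \<kappa> * u x t powr p - K\<^sub>0 \<le> F x t) \<Longrightarrow> mass s u x t 1 \<le> ennreal C"
proof -
  obtain A where A: "0 < A" 
    "\<And>(u :: 'a \<Rightarrow> real \<Rightarrow> real) F (x\<^sub>0::'a) t\<^sub>0. heat_solution s u F \<Longrightarrow> (\<And>x t. \<kappa> * u x t powr p - K\<^sub>0 \<le> F x t) \<Longrightarrow>
      \<exists>x t. norm (x - x\<^sub>0) \<le> 1 \<and> t\<^sub>0 \<le> t \<and> t \<le> t\<^sub>0 + 1 \<and> u x t < A"
    using blow_up[OF s p \<kappa> K0, where 'a='a] by metis
  define C where "C = A / mass_const TYPE('a) s"
  have mc: "0 < mass_const TYPE('a) s" by (rule mass_const_pos[OF s])
  have C: "0 < C" using A(1) mc by (simp add: C_def)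
  show thesis
  proof (rule that[OF C])
    fix u :: "'a \<Rightarrow> real \<Rightarrow> real" and F and x :: 'a and t
    assume sol: "heat_solution s u F" and F: "\<And>x t. 0 \<le> F x t" "\<And>x t. \<kappa> * u x t powr p - K\<^sub>0 \<le> F x t"
    show "mass s u x t 1 \<le> ennreal C"
    proof (rule ccontr)
      assume "\<not> ?thesis"
      then have m: "ennreal C \<le> mass s u x t 1" by simp
      obtain y \<tau> where y: "norm (y - x) \<le> 1" "t + 1 \<le> \<tau>" "\<tau> \<le> t + 1 + 1" "u y \<tau> < A"
        using A(2)[OF sol F(2), of x "t + 1"] by blast
      have "(norm (y - x))\<^sup>2 \<le> 1" using y(1) by (simp add: power_le_one)
      then have "mass_const TYPE('a) s * C * 1 powr s \<le> u y \<tau>"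
        using y C by (intro mass_lower_bound[OF sol s F(1) _ _ m]) auto
      then show False using y(4) mc by (simp add: C_def)
    qed
  qed
qed

subsection \<open>Spreading of mass\<close>

text \<open>The heat kernel at time \<open>a\<close>, up to the factor
  \<open>(4 * pi) powr (real DIM('a) / 2)\<close>.\<close>

definition gauss_bump :: "real \<Rightarrow> 'a::euclidean_space \<Rightarrow> real" where
  "gauss_bump a z = a powr - (real DIM('a) / 2) * exp (- (norm z)\<^sup>2 / (4 * a))"

lemma gauss_bump_nonneg: "0 \<le> gauss_bump a z" by (simp add: gauss_bump_def)

lemma gauss_exponent:
  fixes x y :: "'a::euclidean_space"
  assumes "0 < r" "0 < a"
  shows "(norm y)\<^sup>2 / a + (norm (x - y))\<^sup>2 / r
    = (norm x)\<^sup>2 / (r + a) + (norm ((a / (r + a)) *\<^sub>R x - y))\<^sup>2 / (r * a / (r + a))"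
proof -
  define X Y Z where "X = x \<bullet> x" and "Y = y \<bullet> y" and "Z = x \<bullet> y"
  have 1: "(norm (x - y))\<^sup>2 = X - 2 * Z + Y"
    by (simp add: power2_norm_eq_inner X_def Y_def Z_def inner_diff_left inner_diff_right inner_commute)
  have 2: "(norm (q *\<^sub>R x - y))\<^sup>2 = q\<^sup>2 * X - 2 * q * Z + Y" for q
    unfolding power2_norm_eq_inner X_def Y_def Z_def
    by (simp add: inner_diff_left inner_diff_right inner_commute[of y x] power2_eq_square algebra_simps)
  have 3: "(norm x)\<^sup>2 = X" "(norm y)\<^sup>2 = Y" by (simp_all add: power2_norm_eq_inner X_def Y_def)
  have "r + a \<noteq> 0" "r \<noteq> 0" "a \<noteq> 0" using assms by auto
  then show ?thesis unfolding 1 2 3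
    by (simp add: divide_simps power2_eq_square) (simp add: algebra_simps)
qed

text \<open>Semigroup property of the heat kernel: convolution adds the times \<open>r\<close> and
  \<open>a\<close>. Completing the square in \<open>y\<close> leaves a single kernel of time
  \<open>b\<close> centred at \<open>z\<close>, which \<open>heat_ker_integral\<close>
  integrates.\<close>

lemma gauss_bump_convolution:
  fixes x x\<^sub>0 :: "'a::euclidean_space"
  assumes r: "0 < r" and a: "0 < a"
  shows "has_bochner_integral lborel (\<lambda>y. gauss_bump a (y - x\<^sub>0) * heat_ker s (x - y) r)
    (gauss_mass TYPE('a) * r powr (- 1 - s) * gauss_bump (r + a) (x - x\<^sub>0))"
proof -
  define k where "k = real DIM('a) / 2"
  define b where "b = r * a / (r + a)"
  define z where "z = x\<^sub>0 + (a / (r + a)) *\<^sub>R (x - x\<^sub>0)"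
  have b: "0 < b" using r a by (simp add: b_def)
  define C where "C = a powr - k * r powr - (k + 1 + s) * b powr (k + 1 + s) * exp (- (norm (x - x\<^sub>0))\<^sup>2 / (4 * (r + a)))"
  have "has_bochner_integral lborel (\<lambda>y. C * heat_ker s (z - y) b) (C * (gauss_mass TYPE('a) * b powr (- 1 - s)))"
    by (intro has_bochner_integral_mult_right heat_ker_integral b)
  moreover have "C * heat_ker s (z - y) b = gauss_bump a (y - x\<^sub>0) * heat_ker s (x - y) r" for y
  proof -
    have e: "(norm (y - x\<^sub>0))\<^sup>2 / a + (norm (x - y))\<^sup>2 / r = (norm (x - x\<^sub>0))\<^sup>2 / (r + a) + (norm (z - y))\<^sup>2 / b"
      using gauss_exponent[OF r a, of "y - x\<^sub>0" "x - x\<^sub>0"] by (simp add: b_def z_def algebra_simps)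
    have quarter: "- U / 4 + - V / 4 = - P / 4 + - Q / 4" if "P + Q = U + V" for P Q U V :: real
      using that by simp
    have q: "- P / (4 * w) = - (P / w) / 4" for P w :: real by simp
    have "exp (- (norm (x - x\<^sub>0))\<^sup>2 / (4 * (r + a))) * exp (- (norm (z - y))\<^sup>2 / (4 * b))
      = exp (- (norm (y - x\<^sub>0))\<^sup>2 / (4 * a)) * exp (- (norm (x - y))\<^sup>2 / (4 * r))"
      unfolding exp_add[symmetric] q by (rule arg_cong[where f = exp], rule quarter) (rule e)
    moreover have "b powr (k + 1 + s) * b powr - (k + 1 + s) = 1" using b unfolding powr_add[symmetric] by simp
    ultimately show ?thesis
      unfolding heat_ker_def gauss_bump_def C_def k_def[symmetric] by algebra
  qed
  moreover have "C * (gauss_mass TYPE('a) * b powr (- 1 - s)) = gauss_mass TYPE('a) * r powr (- 1 - s) * gauss_bump (r + a) (x - x\<^sub>0)"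
  proof -
    have "b powr (k + 1 + s) * b powr (- 1 - s) = b powr k" by (simp add: powr_add[symmetric])
    moreover have "b powr k = r powr k * a powr k * (r + a) powr - k"
      using r a powr_divide[of "r * a" "r + a" k] powr_mult[of r a k]
      by (simp add: b_def powr_minus_divide)
    moreover have "r powr - (k + 1 + s) * r powr k = r powr (- 1 - s)" by (simp add: powr_add[symmetric])
    moreover have "a powr - k * a powr k = 1" using a by (simp add: powr_minus)
    ultimately show ?thesis unfolding C_def gauss_bump_def k_def[symmetric] by algebra
  qed
  ultimately show ?thesis by simp
qed

section \<open>Fractional derivatives of powers in time\<close>

lemma powr_le_weighted:
  fixes y s :: real
  assumes "0 \<le> y" "y \<le> 1" "0 < s" "s < 1"
  shows "y powr s \<le> 1 - s * (1 - y)"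
proof -
  \<comment> \<open>Weighted arithmetic-geometric mean of \<open>y\<close> and 1: the graph of the
    concave power lies below its tangent at 1.\<close>
  have "y powr s * 1 powr (1 - s) \<le> s * y + (1 - s) * 1"
  proof (cases "y = 0")
    case False
    then show ?thesis using assms by (intro Youngs_inequality_0) auto
  qed (use assms in simp)
  then show ?thesis by (simp add: algebra_simps)
qed

text \<open>For \<tau> between 0 and 1 the difference of powers is at most
  \<open>1 - \<tau>\<close>, which lowers the singularity to \<open>(1 - \<tau>) powr - s\<close>;
  for \<tau> \<le> 0 the integrand is the integrable tail.\<close>

lemma frac_power_integral_one:
  fixes s :: real
  assumes s: "0 < s" "s < 1"
  shows "integrable lborel (\<lambda>\<tau>. indicator {..<1} \<tau> * (1 - max 0 \<tau> powr s) * (1 - \<tau>) powr (- 1 - s))"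
proof (rule Bochner_Integration.integrable_bound)
  show "integrable lborel (\<lambda>\<tau>. indicator {..<1} \<tau> * (if \<tau> \<le> 1 - 1 then 1 * (1 - \<tau>) powr (- 1 - s) else 1 * (1 - \<tau>) powr - s))"
    using time_integral_split[OF s, of 1 1 1 1] by (auto simp: has_bochner_integral_iff)
  have "\<bar>(1 - max 0 \<tau> powr s) * (1 - \<tau>) powr (- 1 - s)\<bar> \<le> (1 - \<tau>) powr - s" if "0 < \<tau>" "\<tau> < 1" for \<tau>
  proof -
    have "\<tau> powr 1 \<le> \<tau> powr s" using that s by (intro powr_mono') auto
    moreover have "\<tau> powr s \<le> 1" using that s by (simp add: powr_le1)
    ultimately have "(1 - max 0 \<tau> powr s) * (1 - \<tau>) powr (- 1 - s) \<le> (1 - \<tau>) * (1 - \<tau>) powr (- 1 - s)"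
      "0 \<le> (1 - max 0 \<tau> powr s) * (1 - \<tau>) powr (- 1 - s)"
      using that by (auto intro!: mult_right_mono)
    moreover have "(1 - \<tau>) * (1 - \<tau>) powr (- 1 - s) = (1 - \<tau>) powr - s"
      using powr_add[of "1 - \<tau>" 1 "- 1 - s"] that by simp
    ultimately show ?thesis by simp
  qed
  then show "AE \<tau> in lborel. norm (indicator {..<1} \<tau> * (1 - max 0 \<tau> powr s) * (1 - \<tau>) powr (- 1 - s))
    \<le> norm (indicator {..<1} \<tau> * (if \<tau> \<le> 1 - 1 then 1 * (1 - \<tau>) powr (- 1 - s) else 1 * (1 - \<tau>) powr - s))"
    by (intro AE_I2) (auto simp: indicator_def)
qed measurable

definition frac_const :: "real \<Rightarrow> real" where
  "frac_const s = (LINT \<tau>|lborel. indicator {..<1} \<tau> * (1 - max 0 \<tau> powr s) * (1 - \<tau>) powr (- 1 - s))"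

lemma frac_const_nonneg:
  assumes "0 < s" "s < 1" shows "0 \<le> frac_const s"
  unfolding frac_const_def
proof (rule integral_nonneg_AE, rule AE_I2)
  fix \<tau> :: real
  have "max 0 \<tau> powr s \<le> 1" if "\<tau> < 1" using assms that by (intro powr_le1) auto
  then show "0 \<le> indicator {..<1} \<tau> * (1 - max 0 \<tau> powr s) * (1 - \<tau>) powr (- 1 - s)"
    by (auto simp: indicator_def)
qed

text \<open>By scaling, the Marchaud derivative of order \<open>s\<close> of \<open>max 0 t powr s\<close> is constant on
  \<open>t > 0\<close>; its value is irrelevant.\<close>

lemma frac_power_integral:
  fixes s b t :: real
  assumes s: "0 < s" "s < 1"
  shows "has_bochner_integral lborel (\<lambda>\<tau>. indicator {..<t} \<tau> *
     ((max 0 (t - b) powr s - max 0 (\<tau> - b) powr s) * (t - \<tau>) powr (- 1 - s)))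
     (if b < t then frac_const s else 0)"
proof (cases "b < t")
  case True
  define T where "T = t - b"
  have T: "0 < T" using True by (simp add: T_def)
  let ?f = "\<lambda>\<tau>. indicator {..<1} \<tau> * (1 - max 0 \<tau> powr s) * (1 - \<tau>) powr (- 1 - s)"
  have "has_bochner_integral lborel ?f (frac_const s)"
    using frac_power_integral_one[OF s] by (simp add: has_bochner_integral_iff frac_const_def)
  \<comment> \<open>Substitution of \<open>(\<tau> - b) / T\<close>; after multiplication by
    \<open>1 / T\<close> all powers of \<open>T\<close> cancel.\<close>
  then have "has_bochner_integral lborel (\<lambda>\<tau>. ?f (- b / T + (1 / T) * \<tau>)) (frac_const s /\<^sub>R \<bar>1 / T\<bar>)"
    using lborel_has_bochner_integral_real_affine_iff[of "1 / T" ?f "frac_const s" "- b / T"] T by auto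
  from has_bochner_integral_mult_right[OF this, of "1 / T"]
  have "has_bochner_integral lborel (\<lambda>\<tau>. 1 / T * ?f (- b / T + (1 / T) * \<tau>)) (frac_const s)" using T by simp
  moreover have "1 / T * ?f (- b / T + (1 / T) * \<tau>) = indicator {..<t} \<tau> *
     ((max 0 (t - b) powr s - max 0 (\<tau> - b) powr s) * (t - \<tau>) powr (- 1 - s))" for \<tau>
  proof -
    have 1: "- b / T + (1 / T) * \<tau> = (\<tau> - b) / T" using T by (simp add: field_simps)
    have 2: "(\<tau> - b) / T < 1 \<longleftrightarrow> \<tau> < t" using T by (simp add: T_def)
    show ?thesis
    proof (cases "\<tau> < t")
      case lt: True
      have 3: "1 - (\<tau> - b) / T = (t - \<tau>) / T" using T by (simp add: T_def field_simps)
      have "max 0 ((\<tau> - b) / T) = max 0 (\<tau> - b) / T" using T by (auto simp: max_def divide_simps)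
      then have 4: "max 0 ((\<tau> - b) / T) powr s = max 0 (\<tau> - b) powr s / T powr s"
        using T by (simp add: powr_divide)
      have 5: "((t - \<tau>) / T) powr (- 1 - s) = (t - \<tau>) powr (- 1 - s) * (T * T powr s)"
      proof -
        have "T powr (- 1 - s) = 1 / (T * T powr s)"
          using T powr_add[of T 1 s] powr_minus[of T "1 + s"] by (simp add: divide_inverse)
        then show ?thesis using T lt by (simp add: powr_divide)
      qed
      have "max 0 (t - b) = T" using T by (simp add: T_def)
      then show ?thesis unfolding 1 using lt 2 T unfolding 3 4 5 by (simp add: field_simps)
    qed (unfold 1, use 2 in simp)
  qed
  ultimately show ?thesis using True by simp
next
  case False
  have eq: "(\<lambda>\<tau>. indicator {..<t} \<tau> *
     ((max 0 (t - b) powr s - max 0 (\<tau> - b) powr s) * (t - \<tau>) powr (- 1 - s))) = (\<lambda>_. 0 :: real)"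
    using False by (auto simp: indicator_def max_def fun_eq_iff)
  show ?thesis unfolding eq using False by (simp add: has_bochner_integral_zero)
qed

text \<open>On the target cylinder the barrier is of order \<open>h\<close>: concavity bounds the
  difference of powers below by \<open>s * h * \<theta> powr (s - 1)\<close>, and the Gaussian has
  time at most 3 at distance at most 1 from its centre.\<close>

lemma bump_lower_bound:
  fixes z :: "'a::euclidean_space"
  assumes s: "0 < s" "s < 1" and h: "0 < h" "h \<le> 1" and \<theta>: "1 \<le> \<theta>" "\<theta> \<le> 2" and z: "norm z \<le> 1"
  shows "s * 2 powr (s - 1) * 3 powr - (real DIM('a) / 2) * exp (- 1 / 4) * h
    \<le> (max 0 \<theta> powr s - max 0 (\<theta> - h) powr s) * gauss_bump (\<theta> + h) z"
proof -
  have "((\<theta> - h) / \<theta>) powr s \<le> 1 - s * (1 - (\<theta> - h) / \<theta>)"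
    using \<theta> h s by (intro powr_le_weighted) auto
  also have "1 - (\<theta> - h) / \<theta> = h / \<theta>" using \<theta> by (simp add: field_simps)
  finally have "(\<theta> - h) powr s / \<theta> powr s \<le> 1 - s * (h / \<theta>)" using \<theta> h by (simp add: powr_divide)
  then have "(\<theta> - h) powr s \<le> (1 - s * (h / \<theta>)) * \<theta> powr s" using \<theta> by (simp add: pos_divide_le_eq)
  then have 1: "s * h * (\<theta> powr s / \<theta>) \<le> \<theta> powr s - (\<theta> - h) powr s" by (simp add: left_diff_distrib)
  have "2 powr (s - 1) \<le> \<theta> powr (s - 1)" using \<theta> s by (intro powr_mono2') auto
  also have "\<theta> powr (s - 1) = \<theta> powr s / \<theta>" using \<theta> by (simp add: powr_diff)
  finally have "s * h * 2 powr (s - 1) \<le> s * h * (\<theta> powr s / \<theta>)" using s h by (intro mult_left_mono) auto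
  with 1 have 2: "s * h * 2 powr (s - 1) \<le> max 0 \<theta> powr s - max 0 (\<theta> - h) powr s" using \<theta> h by simp
  have "3 powr - (real DIM('a) / 2) \<le> (\<theta> + h) powr - (real DIM('a) / 2)" using \<theta> h by (intro powr_mono2') auto
  moreover have "exp (- 1 / 4) \<le> exp (- (norm z)\<^sup>2 / (4 * (\<theta> + h)))"
  proof -
    have "(norm z)\<^sup>2 \<le> 1" using z by (simp add: power_le_one)
    also have "1 \<le> \<theta> + h" using \<theta> h by simp
    finally show ?thesis using \<theta> h by (simp add: divide_simps)
  qed
  ultimately have 3: "3 powr - (real DIM('a) / 2) * exp (- 1 / 4) \<le> gauss_bump (\<theta> + h) z"
    unfolding gauss_bump_def by (intro mult_mono) auto
  have "s * h * 2 powr (s - 1) * (3 powr - (real DIM('a) / 2) * exp (- 1 / 4))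
    \<le> (max 0 \<theta> powr s - max 0 (\<theta> - h) powr s) * gauss_bump (\<theta> + h) z"
  proof (intro mult_mono 2 3)
    have "0 \<le> s * h * 2 powr (s - 1)" using s h by simp
    then show "0 \<le> max 0 \<theta> powr s - max 0 (\<theta> - h) powr s" using 2 by linarith
  qed simp
  then show ?thesis by (simp add: mult_ac)
qed

text \<open>Half of the constant in \<open>bump_lower_bound\<close>, so that in
  \<open>spreading\<close> the barrier is at least twice the truncation level \<open>l\<close> at
  the target.\<close>

definition bump_const :: "'a::euclidean_space itself \<Rightarrow> real \<Rightarrow> real" where
  "bump_const T s = s * 2 powr (s - 1) * 3 powr - (real DIM('a) / 2) * exp (- 1 / 4) / 2"

text \<open>The summand 1 keeps the denominator positive, as \<open>frac_const s\<close> is only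
  shown to be nonnegative; in \<open>spreading\<close> it leaves the harmless ratio
  \<open>f / (f + 1)\<close>.\<close>

definition spread_const :: "'a::euclidean_space itself \<Rightarrow> real \<Rightarrow> real" where
  "spread_const T s = bump_const T s / (master_const DIM('a) s * gauss_mass T * (frac_const s + 1))"

lemma spread_const_pos:
  assumes "0 < s" "s < 1"
  shows "0 < bump_const TYPE('a::euclidean_space) s" "0 < spread_const TYPE('a) s"
proof -
  show 1: "0 < bump_const TYPE('a) s" unfolding bump_const_def using assms by simp
  have "0 < frac_const s + 1" using frac_const_nonneg[OF assms] by simp
  then show "0 < spread_const TYPE('a) s"
    unfolding spread_const_def using 1 master_const_pos[OF assms, of "DIM('a)"] gauss_mass_pos[where 'a='a]
    by (intro divide_pos_pos mult_pos_pos)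
qed

text \<open>The barrier is \<open>a * (w - l)\<close>, where \<open>w\<close> is a spreading
  Gaussian multiplied by \<open>\<phi>\<close>. The semigroup property reduces the operator on
  \<open>w\<close> to the fractional time derivative of \<open>\<phi>\<close>, so \<open>w\<close>
  is driven by a source only during the time \<open>h\<close> after \<open>t\<^sub>0\<close>. If
  \<open>u x t\<close> were too small, \<open>u - a * (w - l)\<close> would have a negative minimum:
  after the source this forces \<open>F\<close> to be negative, during it and far from
  \<open>x\<^sub>0\<close> the level \<open>l\<close> is not exceeded, and close to
  \<open>x\<^sub>0\<close> the source of the barrier is weaker than
  \<open>F\<^sub>0\<close>.\<close>

lemma spreading:
  fixes u :: "'a::euclidean_space \<Rightarrow> real \<Rightarrow> real"
  assumes sol: "heat_solution s u F" and s: "0 < s" "s < 1" and F: "\<And>x t. 0 \<le> F x t"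
    and h: "0 < h" "h \<le> 1"
    and small: "h powr (s - real DIM('a) / 2) * exp (- \<delta> / (8 * h)) \<le> bump_const TYPE('a) s * h"
    and F0: "0 < F\<^sub>0" "\<And>x t. (norm (x - x\<^sub>0))\<^sup>2 \<le> \<delta> \<Longrightarrow> t\<^sub>0 < t \<Longrightarrow> t \<le> t\<^sub>0 + h \<Longrightarrow> F\<^sub>0 \<le> F x t"
    and x: "norm (x - x\<^sub>0) \<le> 1" and t: "t\<^sub>0 + 1 \<le> t" "t \<le> t\<^sub>0 + 2"
  shows "spread_const TYPE('a) s * F\<^sub>0 * h powr (real DIM('a) / 2 + 1) \<le> u x t"
proof (rule ccontr)
  define k where "k = real DIM('a) / 2"
  define c where "c = master_const DIM('a) s"
  define M where "M = gauss_mass TYPE('a)"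
  define f where "f = frac_const s"
  define l where "l = bump_const TYPE('a) s * h"
  \<comment> \<open>With this amplitude the source \<open>a * M * h powr - k * f\<close> of the
    barrier stays below \<open>F\<^sub>0 / c\<close>; \<open>h powr - k\<close> bounds the
    Gaussian.\<close>
  define a where "a = F\<^sub>0 * h powr k / (c * M * (f + 1))"
  \<comment> \<open>The two powers have the same constant fractional derivative once they are
    positive, so the derivatives cancel after \<open>t\<^sub>0 + h\<close>.\<close>
  define \<phi> where "\<phi> = (\<lambda>\<tau>. max 0 (\<tau> - t\<^sub>0) powr s - max 0 (\<tau> - (t\<^sub>0 + h)) powr s)"
  define w where "w = (\<lambda>(y::'a) \<tau>. \<phi> \<tau> * gauss_bump (\<tau> - t\<^sub>0 + h) (y - x\<^sub>0))"
  have c: "0 < c" and M: "0 < M" and f: "0 \<le> f" and l: "0 < l"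
    using master_const_pos[OF s] gauss_mass_pos[where 'a='a] frac_const_nonneg[OF s]
      spread_const_pos(1)[OF s, where 'a='a] h
    by (simp_all add: c_def M_def f_def l_def)
  have a: "0 < a" using c M f F0(1) h by (simp add: a_def)
  have u0: "\<And>x t. 0 \<le> u x t" using sol by (simp add: heat_solution_def)
  have al: "a * l = spread_const TYPE('a) s * F\<^sub>0 * h powr (real DIM('a) / 2 + 1)"
    using h by (simp add: a_def l_def spread_const_def c_def M_def f_def k_def powr_add)
  assume "\<not> ?thesis"
  then have less: "u x t < a * l" by (simp add: al)
  have w_target: "2 * l \<le> w x t"
    using bump_lower_bound[OF s h, of "t - t\<^sub>0" "x - x\<^sub>0"] x t
    by (simp add: w_def \<phi>_def l_def bump_const_def diff_diff_eq[symmetric])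
  have \<phi>0: "0 \<le> \<phi> \<tau>" for \<tau> unfolding \<phi>_def using h s by (simp add: powr_mono2)
  have w_past: "w y \<tau> = 0" if "\<tau> \<le> t\<^sub>0" for y \<tau> using that h by (simp add: w_def \<phi>_def)
  have bump_le: "gauss_bump (\<theta> + h) z \<le> h powr - k * exp (- (norm z)\<^sup>2 / (4 * (\<theta> + h)))" if "0 \<le> \<theta>" for \<theta> and z :: 'a
    unfolding gauss_bump_def k_def using that h by (intro mult_right_mono powr_mono2') auto
  \<comment> \<open>Chosen so that \<open>2 * (h powr - k * (1 / X)) = l\<close>. In
    \<open>R\<close>, 12 is four times the largest Gaussian time 3, and the summand 1 puts the
    target point into \<open>K\<close>.\<close>
  define X where "X = 2 * h powr - k / l"
  have X: "0 < X" using h l by (simp add: X_def)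
  define R where "R = 12 * X + 1"
  have w_far: "w y \<tau> \<le> l" if "R \<le> (norm (y - x\<^sub>0))\<^sup>2" "t\<^sub>0 \<le> \<tau>" "\<tau> \<le> t" for y \<tau>
  proof -
    have "\<phi> \<tau> \<le> (\<tau> - t\<^sub>0) powr s" unfolding \<phi>_def using that by simp
    also have "\<dots> \<le> 2 powr s" using that t s by (intro powr_mono2) auto
    also have "\<dots> \<le> 2" using s powr_mono[of s 1 2] by simp
    finally have 1: "\<phi> \<tau> \<le> 2" .
    have "X \<le> (norm (y - x\<^sub>0))\<^sup>2 / 12" using that by (simp add: R_def)
    also have "\<dots> \<le> (norm (y - x\<^sub>0))\<^sup>2 / (4 * (\<tau> - t\<^sub>0 + h))"
      using that t h by (intro divide_left_mono) auto
    finally have "exp (- (norm (y - x\<^sub>0))\<^sup>2 / (4 * (\<tau> - t\<^sub>0 + h))) \<le> exp (- X)" by simp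
    also have "\<dots> \<le> 1 / X"
    proof -
      have "X \<le> exp X" using exp_ge_add_one_self[of X] by linarith
      then have "inverse (exp X) \<le> inverse X" using X by (intro le_imp_inverse_le)
      then show ?thesis by (simp add: exp_minus inverse_eq_divide)
    qed
    finally have "gauss_bump (\<tau> - t\<^sub>0 + h) (y - x\<^sub>0) \<le> h powr - k * (1 / X)"
      using bump_le[of "\<tau> - t\<^sub>0" "y - x\<^sub>0"] that
        mult_left_mono[of _ "1 / X" "h powr - k"] by (meson diff_ge_0_iff_ge order_trans powr_ge_zero)
    then have "w y \<tau> \<le> 2 * (h powr - k * (1 / X))"
      unfolding w_def using 1 by (intro mult_mono) (auto simp: gauss_bump_nonneg)
    also have "\<dots> = l" using h l by (simp add: X_def)
    finally show ?thesis .
  qed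
  define K where "K = cball x\<^sub>0 (sqrt R) \<times> {t\<^sub>0..t}"
  have cK: "compact K" unfolding K_def by (intro compact_Times) auto
  have "1 \<le> sqrt R" using X by (simp add: R_def)
  with x have "norm (x - x\<^sub>0) \<le> sqrt R" by (rule order_trans)
  then have inK: "(x, t) \<in> K" using t by (simp add: K_def dist_norm norm_minus_commute)
  have cu: "continuous_on UNIV (\<lambda>z. u (fst z) (snd z))" using sol by (simp add: heat_solution_def)
  have cw: "continuous_on K (\<lambda>z. w (fst z) (snd z))"
    unfolding w_def \<phi>_def gauss_bump_def K_def using h s
    by (intro continuous_intros continuous_on_powr') (auto simp: max_def)
  have "continuous_on K (\<lambda>z. u (fst z) (snd z) - a * (w (fst z) (snd z) - l))"
    by (intro continuous_intros continuous_on_subset[OF cu] cw) auto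
  then obtain z where z: "z \<in> K"
    "\<And>v. v \<in> K \<Longrightarrow> u (fst z) (snd z) - a * (w (fst z) (snd z) - l) \<le> u (fst v) (snd v) - a * (w (fst v) (snd v) - l)"
    using continuous_attains_inf[OF cK, of "\<lambda>z. u (fst z) (snd z) - a * (w (fst z) (snd z) - l)"] inK by (metis empty_iff)
  obtain x\<^sub>1 t\<^sub>1 where zz: "z = (x\<^sub>1, t\<^sub>1)" by (cases z)
  have t1: "t\<^sub>0 \<le> t\<^sub>1" "t\<^sub>1 \<le> t" using z(1) by (auto simp: zz K_def)
  have min: "u x\<^sub>1 t\<^sub>1 - a * (w x\<^sub>1 t\<^sub>1 - l) \<le> u y \<tau> - a * (w y \<tau> - l)" if "(y, \<tau>) \<in> K" for y \<tau>
    using z(2)[OF that] by (simp add: zz)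
  have "a * l \<le> a * (w x t - l)" using w_target a by (intro mult_left_mono) auto
  then have neg: "u x\<^sub>1 t\<^sub>1 - a * (w x\<^sub>1 t\<^sub>1 - l) < 0" using min[OF inK] less by linarith
  have w1: "l < w x\<^sub>1 t\<^sub>1"
  proof (rule ccontr)
    assume "\<not> ?thesis"
    then have "a * (w x\<^sub>1 t\<^sub>1 - l) \<le> 0" using a by (intro mult_nonneg_nonpos) auto
    then show False using neg u0[of x\<^sub>1 t\<^sub>1] by linarith
  qed
  have t1': "t\<^sub>0 < t\<^sub>1" using w1 w_past[of t\<^sub>1 x\<^sub>1] l by (cases "t\<^sub>0 < t\<^sub>1") auto
  \<comment> \<open>Up to \<open>t\<^sub>0\<close> the truncated barrier is 0 and not
    \<open>- a * l\<close>; this gain of \<open>a * l\<close> produces the strictly negative term in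
    \<open>I\<close>.\<close>
  have le1: "u x\<^sub>1 t\<^sub>1 - u y \<tau> \<le> a * (w x\<^sub>1 t\<^sub>1 - w y \<tau>) - (if \<tau> \<le> t\<^sub>0 then a * l else 0)" if "\<tau> < t\<^sub>1" for y \<tau>
  proof (cases "\<tau> \<le> t\<^sub>0")
    case True
    then show ?thesis using neg u0[of y \<tau>] w_past[of \<tau> y] by (simp add: right_diff_distrib)
  next
    case False
    have "u x\<^sub>1 t\<^sub>1 - a * (w x\<^sub>1 t\<^sub>1 - l) \<le> u y \<tau> - a * (w y \<tau> - l)"
    proof (cases "(y, \<tau>) \<in> K")
      case notK: False
      then have "\<not> norm (y - x\<^sub>0) \<le> sqrt R" using False that t1 by (auto simp: K_def dist_norm norm_minus_commute)
      then have "R \<le> (norm (y - x\<^sub>0))\<^sup>2" by (intro sqrt_le_D) simp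
      then have "a * (w y \<tau> - l) \<le> 0" using w_far[of y \<tau>] False that t1 a by (intro mult_nonneg_nonpos) auto
      then show ?thesis using neg u0[of y \<tau>] by linarith
    qed (rule min)
    then show ?thesis using False by (simp add: right_diff_distrib)
  qed
  \<comment> \<open>The times \<open>t\<^sub>1 - \<tau>\<close> and
    \<open>\<tau> - t\<^sub>0 + h\<close> have a sum free of \<tau>, so the Gaussian factors out of
    the time integral as the constant \<open>E\<close>.\<close>
  define E where "E = gauss_bump (t\<^sub>1 - t\<^sub>0 + h) (x\<^sub>1 - x\<^sub>0)"
  define G where "G = (\<lambda>\<tau>. (a * M * E) * ((\<phi> t\<^sub>1 - \<phi> \<tau>) * (t\<^sub>1 - \<tau>) powr (- 1 - s))
     - (if \<tau> \<le> t\<^sub>0 then a * l else 0) * (M * (t\<^sub>1 - \<tau>) powr (- 1 - s)))"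
  have gG: "has_bochner_integral lborel (\<lambda>y. (a * (w x\<^sub>1 t\<^sub>1 - w y \<tau>) - (if \<tau> \<le> t\<^sub>0 then a * l else 0)) * heat_ker s (x\<^sub>1 - y) (t\<^sub>1 - \<tau>)) (G \<tau>)"
    if "\<tau> < t\<^sub>1" for \<tau>
  proof -
    let ?d = "if \<tau> \<le> t\<^sub>0 then a * l else 0"
    have 1: "has_bochner_integral lborel (\<lambda>y. heat_ker s (x\<^sub>1 - y) (t\<^sub>1 - \<tau>)) (M * (t\<^sub>1 - \<tau>) powr (- 1 - s))"
      unfolding M_def by (rule heat_ker_integral) (use that in simp)
    have 2: "has_bochner_integral lborel (\<lambda>y. w y \<tau> * heat_ker s (x\<^sub>1 - y) (t\<^sub>1 - \<tau>))
      (\<phi> \<tau> * (M * (t\<^sub>1 - \<tau>) powr (- 1 - s) * E))"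
    proof (cases "\<tau> \<le> t\<^sub>0")
      case True
      then show ?thesis using w_past[OF True] h by (simp add: \<phi>_def has_bochner_integral_zero)
    next
      case False
      have "has_bochner_integral lborel (\<lambda>y. \<phi> \<tau> * (gauss_bump (\<tau> - t\<^sub>0 + h) (y - x\<^sub>0) * heat_ker s (x\<^sub>1 - y) (t\<^sub>1 - \<tau>)))
         (\<phi> \<tau> * (M * (t\<^sub>1 - \<tau>) powr (- 1 - s) * gauss_bump ((t\<^sub>1 - \<tau>) + (\<tau> - t\<^sub>0 + h)) (x\<^sub>1 - x\<^sub>0)))"
        unfolding M_def using False that h by (intro has_bochner_integral_mult_right gauss_bump_convolution) auto
      moreover have "(t\<^sub>1 - \<tau>) + (\<tau> - t\<^sub>0 + h) = t\<^sub>1 - t\<^sub>0 + h" by simp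
      ultimately show ?thesis by (simp only: w_def E_def mult.assoc)
    qed
    have "has_bochner_integral lborel (\<lambda>y. (a * w x\<^sub>1 t\<^sub>1 - ?d) * heat_ker s (x\<^sub>1 - y) (t\<^sub>1 - \<tau>)
        - a * (w y \<tau> * heat_ker s (x\<^sub>1 - y) (t\<^sub>1 - \<tau>)))
      ((a * w x\<^sub>1 t\<^sub>1 - ?d) * (M * (t\<^sub>1 - \<tau>) powr (- 1 - s)) - a * (\<phi> \<tau> * (M * (t\<^sub>1 - \<tau>) powr (- 1 - s) * E)))"
      by (intro has_bochner_integral_diff has_bochner_integral_mult_right 1 2)
    moreover have "w x\<^sub>1 t\<^sub>1 = \<phi> t\<^sub>1 * E" by (simp add: w_def E_def)
    moreover have "(a * P - d) * J - a * (Q * J) = (a * (P - Q) - d) * J" for P Q d J :: real by algebra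
    moreover have "(a * (\<phi> t\<^sub>1 * E) - d) * (M * J) - a * (\<phi> \<tau> * (M * J * E))
      = (a * M * E) * ((\<phi> t\<^sub>1 - \<phi> \<tau>) * J) - d * (M * J)" for d J by algebra
    ultimately show ?thesis unfolding G_def by simp
  qed
  define f1 where "f1 = (if t\<^sub>1 \<le> t\<^sub>0 + h then f else 0)"
  define I where "I = a * M * E * f1 - a * l * M * ((t\<^sub>1 - t\<^sub>0) powr - s / s)"
  have GI: "has_bochner_integral lborel (\<lambda>\<tau>. indicator {..<t\<^sub>1} \<tau> * G \<tau>) I"
  proof -
    have "has_bochner_integral lborel (\<lambda>\<tau>. a * M * E * (
        indicator {..<t\<^sub>1} \<tau> * ((max 0 (t\<^sub>1 - t\<^sub>0) powr s - max 0 (\<tau> - t\<^sub>0) powr s) * (t\<^sub>1 - \<tau>) powr (- 1 - s))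
        - indicator {..<t\<^sub>1} \<tau> * ((max 0 (t\<^sub>1 - (t\<^sub>0 + h)) powr s - max 0 (\<tau> - (t\<^sub>0 + h)) powr s) * (t\<^sub>1 - \<tau>) powr (- 1 - s)))
        - a * l * M * (indicator {..t\<^sub>1 - (t\<^sub>1 - t\<^sub>0)} \<tau> * (t\<^sub>1 - \<tau>) powr (- 1 - s)))
      (a * M * E * ((if t\<^sub>0 < t\<^sub>1 then frac_const s else 0) - (if t\<^sub>0 + h < t\<^sub>1 then frac_const s else 0))
        - a * l * M * ((t\<^sub>1 - t\<^sub>0) powr - s / s))" (is "has_bochner_integral _ ?g ?J")
      using t1' by (intro has_bochner_integral_diff has_bochner_integral_mult_right frac_power_integral[OF s] time_integral_far s) auto
    moreover have "?g \<tau> = indicator {..<t\<^sub>1} \<tau> * G \<tau>" for \<tau>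
      using t1' by (auto simp: G_def \<phi>_def indicator_def algebra_simps)
    moreover have "?J = I" using t1' by (auto simp: I_def f1_def f_def)
    ultimately show ?thesis by simp
  qed
  have "F x\<^sub>1 t\<^sub>1 / c \<le> I"
    unfolding c_def
    by (rule heat_solution_upper(1)[where m = "\<lambda>_ _. 0", OF sol _ _ gG GI]) (use le1 in auto)
  also have "I < a * M * E * f1" using a l M t1' s by (simp add: I_def)
  finally have F1: "F x\<^sub>1 t\<^sub>1 / c < a * M * E * f1" .
  show False
  proof (cases "t\<^sub>1 \<le> t\<^sub>0 + h")
    case False
    then show False using F1 F[of x\<^sub>1 t\<^sub>1] c by (simp add: f1_def divide_less_0_iff)
  next
    case True
    have "(norm (x\<^sub>1 - x\<^sub>0))\<^sup>2 \<le> \<delta>"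
    proof (rule ccontr)
      assume far: "\<not> ?thesis"
      have "\<phi> t\<^sub>1 \<le> (t\<^sub>1 - t\<^sub>0) powr s" unfolding \<phi>_def using t1 by simp
      also have "\<dots> \<le> h powr s" using True t1 s by (intro powr_mono2) auto
      finally have 1: "\<phi> t\<^sub>1 \<le> h powr s" .
      have 2: "\<delta> / (8 * h) \<le> (norm (x\<^sub>1 - x\<^sub>0))\<^sup>2 / (4 * (t\<^sub>1 - t\<^sub>0 + h))"
        using far True t1' h by (intro frac_le) auto
      have "E \<le> h powr - k * exp (- (norm (x\<^sub>1 - x\<^sub>0))\<^sup>2 / (4 * (t\<^sub>1 - t\<^sub>0 + h)))"
        unfolding E_def using t1 by (intro bump_le) auto
      also have "\<dots> \<le> h powr - k * exp (- \<delta> / (8 * h))" using 2 by (intro mult_left_mono) auto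
      finally have "\<phi> t\<^sub>1 * E \<le> h powr s * (h powr - k * exp (- \<delta> / (8 * h)))"
        by (rule mult_mono[OF 1]) (simp_all add: E_def gauss_bump_nonneg)
      then have "w x\<^sub>1 t\<^sub>1 \<le> h powr s * (h powr - k * exp (- \<delta> / (8 * h)))"
        by (simp only: w_def E_def)
      also have "\<dots> = h powr (s - k) * exp (- \<delta> / (8 * h))" by (simp add: powr_diff powr_minus_divide)
      also have "\<dots> \<le> l" using small by (simp add: k_def l_def)
      finally show False using w1 by simp
    qed
    then have "F\<^sub>0 \<le> F x\<^sub>1 t\<^sub>1" using F0(2) t1' True by simp
    then have "F\<^sub>0 / c \<le> F x\<^sub>1 t\<^sub>1 / c" using c by (simp add: divide_right_mono)
    also have "\<dots> < a * M * E * f" using F1 True by (simp add: f1_def)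
    also have "\<dots> \<le> a * M * h powr - k * f"
    proof -
      have "h powr - k * exp (- (norm (x\<^sub>1 - x\<^sub>0))\<^sup>2 / (4 * (t\<^sub>1 - t\<^sub>0 + h))) \<le> h powr - k * 1"
        using t1 h by (intro mult_left_mono) auto
      then have "E \<le> h powr - k" unfolding E_def using bump_le[of "t\<^sub>1 - t\<^sub>0" "x\<^sub>1 - x\<^sub>0"] t1 by linarith
      then show ?thesis using a M f by (intro mult_right_mono mult_left_mono) auto
    qed
    also have "\<dots> = F\<^sub>0 / c * (f / (f + 1))"
      using h M c f by (simp add: a_def powr_minus divide_simps)
    also have "\<dots> \<le> F\<^sub>0 / c * 1" using f F0(1) c by (intro mult_left_mono) auto
    finally show False by simp
  qed
qed

subsection \<open>Selection of a nearly maximal point\<close>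

text \<open>Maximizing \<open>u\<close> times a power of the distance to the edge of a unit
  paraboloid gives a point around which \<open>u\<close> exceeds its value at most by the factor
  \<open>2 ^ m\<close>. Contact from above with a paraboloid near this point then replaces any
  quantitative regularity of \<open>u\<close>. The exponent \<open>m\<close> is free: the larger it
  is, the smaller is the negative power of \<open>U\<close> that bounds \<rho> from below.\<close>

lemma doubling_selection:
  fixes u :: "'a::euclidean_space \<Rightarrow> real \<Rightarrow> real"
  assumes cu: "continuous_on UNIV (\<lambda>z. u (fst z) (snd z))" and u0: "\<And>x t. 0 \<le> u x t"
    and m: "0 < m" and ge1: "1 \<le> u x\<^sub>0 t\<^sub>0"
  obtains x\<^sub>1 t\<^sub>1 U \<rho> e A where "u x\<^sub>0 t\<^sub>0 \<le> U" "U \<le> u x\<^sub>1 t\<^sub>1" "u x\<^sub>1 t\<^sub>1 \<le> 2 ^ m * U"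
    "0 < \<rho>" "\<rho> \<le> 1" "1 \<le> U * (18 * 2 ^ m * \<rho>) ^ m" "0 \<le> A" "A \<le> U / \<rho>\<^sup>2"
    "\<And>y \<tau>. \<tau> \<le> t\<^sub>1 \<Longrightarrow> 0 \<le> u x\<^sub>1 t\<^sub>1 + e \<bullet> (y - x\<^sub>1) + A * ((norm (y - x\<^sub>1))\<^sup>2 + (t\<^sub>1 - \<tau>))"
    "\<And>y \<tau>. \<tau> \<le> t\<^sub>1 \<Longrightarrow> (norm (y - x\<^sub>1))\<^sup>2 + (t\<^sub>1 - \<tau>) \<le> \<rho>\<^sup>2 \<Longrightarrow>
      u y \<tau> \<le> u x\<^sub>1 t\<^sub>1 + e \<bullet> (y - x\<^sub>1) + A * ((norm (y - x\<^sub>1))\<^sup>2 + (t\<^sub>1 - \<tau>))"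
proof -
  define q where "q = (\<lambda>y \<tau>. (norm (y - x\<^sub>0))\<^sup>2 + (t\<^sub>0 - \<tau>))"
  define K where "K = {(y, \<tau>). \<tau> \<le> t\<^sub>0 \<and> (norm (y - x\<^sub>0))\<^sup>2 + (t\<^sub>0 - \<tau>) \<le> 1}"
  have K: "compact K" unfolding K_def by (rule compact_past)
  have in0: "(x\<^sub>0, t\<^sub>0) \<in> K" by (simp add: K_def)
  have "continuous_on K (\<lambda>z. u (fst z) (snd z) * (1 - q (fst z) (snd z)) ^ m)"
    unfolding q_def by (intro continuous_intros continuous_on_subset[OF cu]) auto
  then obtain z where z: "z \<in> K" "\<And>w. w \<in> K \<Longrightarrow>
      u (fst w) (snd w) * (1 - q (fst w) (snd w)) ^ m \<le> u (fst z) (snd z) * (1 - q (fst z) (snd z)) ^ m"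
    using continuous_attains_sup[OF K, of "\<lambda>z. u (fst z) (snd z) * (1 - q (fst z) (snd z)) ^ m"] in0
    by (metis empty_iff)
  obtain x t where zz: "z = (x, t)" by (cases z)
  have max: "u y \<tau> * (1 - q y \<tau>) ^ m \<le> u x t * (1 - q x t) ^ m" if "(y, \<tau>) \<in> K" for y \<tau>
    using z(2)[OF that] by (simp add: zz)
  have t: "t \<le> t\<^sub>0" "q x t \<le> 1" using z(1) by (auto simp: zz K_def q_def)
  define U where "U = u x t"
  define D where "D = 1 - q x t"
  have U0: "u x\<^sub>0 t\<^sub>0 \<le> U * D ^ m" using max[OF in0] by (simp add: q_def U_def D_def)
  have "D \<noteq> 0" using U0 ge1 m by (auto simp: zero_power)
  moreover have "0 \<le> q x t" unfolding q_def using t by (intro add_nonneg_nonneg) auto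
  ultimately have D: "0 < D" "D \<le> 1" using t by (auto simp: D_def)
  have Upos: "0 \<le> U" by (simp add: U_def u0)
  have "U * D ^ m \<le> U * 1" using Upos D by (intro mult_left_mono power_le_one) auto
  then have UU: "u x\<^sub>0 t\<^sub>0 \<le> U" using U0 by simp
  define B where "B = (2::real) ^ m"
  have B: "1 \<le> B" by (simp add: B_def)
  \<comment> \<open>Within radius \<open>r\<close> the weight \<open>1 - q\<close> drops by at most
    \<open>3 * r = D / 2\<close>, which costs the factor \<open>2 ^ m\<close> in the bound for
    \<open>u\<close>.\<close>
  define r where "r = D / 6"
  have r: "0 < r" "r \<le> 1" using D by (auto simp: r_def)
  have near: "u y \<tau> \<le> B * U" if "\<tau> \<le> t" "(norm (y - x))\<^sup>2 + (t - \<tau>) \<le> r\<^sup>2" for y \<tau>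
  proof -
    have "(norm (y - x))\<^sup>2 \<le> r\<^sup>2" using that by linarith
    then have nr: "norm (y - x) \<le> r" by (rule power2_le_imp_le) (use r in simp)
    have "(norm (x - x\<^sub>0))\<^sup>2 \<le> 1\<^sup>2" using t by (simp add: q_def)
    then have n1: "norm (x - x\<^sub>0) \<le> 1" by (rule power2_le_imp_le) simp
    have "(x - x\<^sub>0) \<bullet> (y - x) \<le> norm (x - x\<^sub>0) * norm (y - x)" by (rule norm_cauchy_schwarz)
    also have "\<dots> \<le> 1 * r" using nr n1 by (intro mult_mono) auto
    finally have "q y \<tau> \<le> q x t + 2 * r + r\<^sup>2"
      using norm_add_sq[of "x - x\<^sub>0" "y - x"] that by (simp add: q_def)
    also have "r\<^sup>2 \<le> r" using r by (simp add: power2_eq_square mult_left_le)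
    finally have "q y \<tau> \<le> q x t + 2 * r + r" by simp
    moreover have "D = 6 * r" by (simp add: r_def)
    ultimately have qD: "D / 2 \<le> 1 - q y \<tau>" using D_def by linarith
    then have "(y, \<tau>) \<in> K" using D that t by (simp add: K_def q_def)
    then have "u y \<tau> * (1 - q y \<tau>) ^ m \<le> U * D ^ m" using max by (simp add: U_def D_def)
    moreover have "u y \<tau> * (D / 2) ^ m \<le> u y \<tau> * (1 - q y \<tau>) ^ m"
      using qD D u0 by (intro mult_left_mono power_mono) auto
    ultimately have "u y \<tau> * (D / 2) ^ m \<le> U * D ^ m" by linarith
    then have "u y \<tau> * D ^ m \<le> (B * U) * D ^ m"
      by (simp add: power_divide B_def pos_divide_le_eq mult_ac)
    then show ?thesis using D by simp
  qed
  \<comment> \<open>With this opening \<open>A * r\<^sup>2\<close> is the upper bound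
    \<open>B * U\<close> of \<open>u\<close> on \<open>K2\<close>, while the contact value is at
    least \<open>U\<close> above \<open>A * q2\<close>; so the contact point stays away from the
    edge of \<open>K2\<close>.\<close>
  define A where "A = B * U / r\<^sup>2"
  define q2 where "q2 = (\<lambda>y \<tau>. (norm (y - x))\<^sup>2 + (t - \<tau>))"
  define K2 where "K2 = {(y, \<tau>). \<tau> \<le> t \<and> (norm (y - x))\<^sup>2 + (t - \<tau>) \<le> r\<^sup>2}"
  have A: "0 < A" using B UU ge1 r by (simp add: A_def)
  have K2: "compact K2" unfolding K2_def by (rule compact_past)
  have in2: "(x, t) \<in> K2" by (simp add: K2_def)
  have "continuous_on K2 (\<lambda>z. u (fst z) (snd z) - A * q2 (fst z) (snd z))"
    unfolding q2_def by (intro continuous_intros continuous_on_subset[OF cu]) auto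
  then obtain z where z2: "z \<in> K2" "\<And>w. w \<in> K2 \<Longrightarrow>
      u (fst w) (snd w) - A * q2 (fst w) (snd w) \<le> u (fst z) (snd z) - A * q2 (fst z) (snd z)"
    using continuous_attains_sup[OF K2, of "\<lambda>z. u (fst z) (snd z) - A * q2 (fst z) (snd z)"] in2
    by (metis empty_iff)
  obtain x\<^sub>1 t\<^sub>1 where zz2: "z = (x\<^sub>1, t\<^sub>1)" by (cases z)
  have max2: "u y \<tau> - A * q2 y \<tau> \<le> u x\<^sub>1 t\<^sub>1 - A * q2 x\<^sub>1 t\<^sub>1" if "(y, \<tau>) \<in> K2" for y \<tau>
    using z2(2)[OF that] by (simp add: zz2)
  have t1: "t\<^sub>1 \<le> t" "q2 x\<^sub>1 t\<^sub>1 \<le> r\<^sup>2" using z2(1) by (auto simp: zz2 K2_def q2_def)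
  have u1: "u x\<^sub>1 t\<^sub>1 \<le> B * U" using near t1 by (simp add: q2_def)
  have Ule: "U \<le> u x\<^sub>1 t\<^sub>1 - A * q2 x\<^sub>1 t\<^sub>1" using max2[OF in2] by (simp add: q2_def U_def)
  have q20: "0 \<le> q2 y \<tau>" if "\<tau> \<le> t" for y \<tau> using that by (simp add: q2_def)
  have Uu1: "U \<le> u x\<^sub>1 t\<^sub>1" using Ule A q20[OF t1(1)] by (smt (verit) mult_nonneg_nonneg)
  \<comment> \<open>The contact point has the margin \<open>r\<^sup>2 / B\<close> in
    \<open>q2\<close>; with this radius its own paraboloid stays in \<open>K2\<close>.\<close>
  define \<rho> where "\<rho> = r / (3 * B)"
  have \<rho>: "0 < \<rho>" "\<rho> \<le> 1" using r B by (auto simp: \<rho>_def divide_simps)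
  have "A * q2 x\<^sub>1 t\<^sub>1 \<le> A * (r\<^sup>2 - r\<^sup>2 / B)"
  proof -
    have "A * r\<^sup>2 = B * U" using r by (simp add: A_def)
    moreover have "A * (r\<^sup>2 / B) = U" using r B by (simp add: A_def)
    ultimately show ?thesis using u1 Ule by (simp add: right_diff_distrib)
  qed
  then have q21: "q2 x\<^sub>1 t\<^sub>1 \<le> r\<^sup>2 - r\<^sup>2 / B" using A by simp
  have q2_expand: "q2 y \<tau> - q2 x\<^sub>1 t\<^sub>1 = 2 * ((x\<^sub>1 - x) \<bullet> (y - x\<^sub>1)) + ((norm (y - x\<^sub>1))\<^sup>2 + (t\<^sub>1 - \<tau>))" for y \<tau>
    using norm_add_sq[of "x\<^sub>1 - x" "y - x\<^sub>1"] by (simp add: q2_def)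
  define e where "e = (2 * A) *\<^sub>R (x\<^sub>1 - x)"
  have g: "u x\<^sub>1 t\<^sub>1 + e \<bullet> (y - x\<^sub>1) + A * ((norm (y - x\<^sub>1))\<^sup>2 + (t\<^sub>1 - \<tau>)) = u x\<^sub>1 t\<^sub>1 - A * q2 x\<^sub>1 t\<^sub>1 + A * q2 y \<tau>" for y \<tau>
    using arg_cong[OF q2_expand, of "\<lambda>v. A * v" y \<tau>] by (simp add: e_def right_diff_distrib distrib_left)
  show thesis
  proof (rule that[of U x\<^sub>1 t\<^sub>1 \<rho> A e])
    show "1 \<le> U * (18 * 2 ^ m * \<rho>) ^ m"
    proof -
      have "18 * 2 ^ m * \<rho> = D" using B by (simp add: \<rho>_def r_def flip: B_def)
      then show ?thesis using U0 ge1 by simp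
    qed
    show "A \<le> U / \<rho>\<^sup>2"
    proof -
      have "U / \<rho>\<^sup>2 = 9 * B * A" using B by (simp add: \<rho>_def A_def power_divide power_mult_distrib power2_eq_square)
      then show ?thesis using A B mult_right_mono[of 1 "9 * B" A] by simp
    qed
    fix y \<tau> assume \<tau>: "\<tau> \<le> t\<^sub>1"
    show "0 \<le> u x\<^sub>1 t\<^sub>1 + e \<bullet> (y - x\<^sub>1) + A * ((norm (y - x\<^sub>1))\<^sup>2 + (t\<^sub>1 - \<tau>))"
      unfolding g using Ule Upos A q20[of \<tau> y] \<tau> t1 by (smt (verit) mult_nonneg_nonneg)
    assume near1: "(norm (y - x\<^sub>1))\<^sup>2 + (t\<^sub>1 - \<tau>) \<le> \<rho>\<^sup>2"
    have "(norm (y - x\<^sub>1))\<^sup>2 \<le> \<rho>\<^sup>2" using near1 \<tau> by linarith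
    then have n\<rho>: "norm (y - x\<^sub>1) \<le> \<rho>" by (rule power2_le_imp_le) (use \<rho> in simp)
    have "(norm (x\<^sub>1 - x))\<^sup>2 \<le> r\<^sup>2" using t1 by (simp add: q2_def)
    then have nr: "norm (x\<^sub>1 - x) \<le> r" by (rule power2_le_imp_le) (use r in simp)
    have "(x\<^sub>1 - x) \<bullet> (y - x\<^sub>1) \<le> norm (x\<^sub>1 - x) * norm (y - x\<^sub>1)" by (rule norm_cauchy_schwarz)
    also have "\<dots> \<le> r * \<rho>" using nr n\<rho> r by (intro mult_mono) auto
    finally have "q2 y \<tau> \<le> r\<^sup>2 - r\<^sup>2 / B + 2 * (r * \<rho>) + \<rho>\<^sup>2" using q2_expand[of y \<tau>] q21 near1 by linarith
    also have "\<dots> \<le> r\<^sup>2"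
    proof -
      define Q where "Q = r\<^sup>2 / B"
      have Q: "0 \<le> Q" using B by (simp add: Q_def)
      have "r * \<rho> = Q / 3" by (simp add: \<rho>_def Q_def power2_eq_square)
      moreover have "\<rho>\<^sup>2 = Q / (9 * B)" by (simp add: \<rho>_def Q_def power2_eq_square)
      moreover have "Q / (9 * B) \<le> Q / 9" using B Q by (intro divide_left_mono) auto
      ultimately show ?thesis unfolding Q_def[symmetric] using Q by linarith
    qed
    finally have "(y, \<tau>) \<in> K2" using \<tau> t1 by (simp add: K2_def q2_def)
    from max2[OF this] show "u y \<tau> \<le> u x\<^sub>1 t\<^sub>1 + e \<bullet> (y - x\<^sub>1) + A * ((norm (y - x\<^sub>1))\<^sup>2 + (t\<^sub>1 - \<tau>))"
      unfolding g by simp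
  qed (use UU Uu1 u1 \<rho> A in \<open>simp_all add: B_def\<close>)
qed

section \<open>The kernel tail and the remote mass at a contact point\<close>

lemma exp_minus_le_powr:
  fixes k X :: real
  assumes "0 < k" "0 < X"
  shows "exp (- X) \<le> (k / X) powr k"
proof -
  have "X / k \<le> exp (X / k)" using exp_ge_add_one_self[of "X / k"] by linarith
  then have "(X / k) powr k \<le> exp (X / k) powr k" using assms by (intro powr_mono2) auto
  also have "\<dots> = exp X" using assms by (simp add: powr_def)
  finally have "inverse (exp X) \<le> inverse ((X / k) powr k)" using assms by (intro le_imp_inverse_le) auto
  also have "\<dots> = (k / X) powr k" using assms by (simp add: powr_divide)
  finally show ?thesis by (simp add: exp_minus)
qed

text \<open>Off the paraboloid of radius \<rho> the kernel is controlled by the one with base time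
  one unit later, at the cost of a power of \<open>1 / \<rho>\<close>. Either \<open>r\<close> is at
  least \<open>\<rho>\<^sup>2 / 2\<close> and the powers of \<open>r\<close> and
  \<open>1 + r\<close> are compared, or \<open>z\<close> is large: then half of the exponent absorbs
  the singular power of \<open>r\<close>, and the other half suffices for the Gaussian at
  \<open>1 + r\<close>.\<close>

lemma heat_ker_tail:
  fixes z :: "'a::euclidean_space"
  assumes s: "0 < s" and r: "0 < r" and \<rho>: "0 < \<rho>" "\<rho> \<le> 1" and out: "\<rho>\<^sup>2 \<le> (norm z)\<^sup>2 + r"
  defines "k \<equiv> real DIM('a) / 2 + 1 + s"
  shows "heat_ker s z r \<le> (32 * k / \<rho>\<^sup>2) powr k * heat_ker s z (1 + r)"
proof -
  have k: "1 \<le> k" using s by (simp add: k_def)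
  have \<rho>2: "0 < \<rho>\<^sup>2" "\<rho>\<^sup>2 \<le> 1" using \<rho> by (auto simp: power_le_one)
  have e1: "exp (- (norm z)\<^sup>2 / (4 * r)) \<le> exp (- (norm z)\<^sup>2 / (4 * (1 + r)))"
    using r by (simp add: frac_le)
  show ?thesis
  proof (cases "\<rho>\<^sup>2 / 2 \<le> r")
    case True
    have "1 / r \<le> 2 / \<rho>\<^sup>2" using True \<rho>2 r by (simp add: field_simps)
    moreover have "1 \<le> 1 / \<rho>\<^sup>2" using \<rho>2 by simp
    ultimately have "1 + 1 / r \<le> 3 / \<rho>\<^sup>2" by simp
    also have "\<dots> \<le> 32 * k / \<rho>\<^sup>2" using k \<rho>2 by (intro divide_right_mono) auto
    finally have "1 + 1 / r \<le> 32 * k / \<rho>\<^sup>2" .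
    then have "(1 + 1 / r) powr k \<le> (32 * k / \<rho>\<^sup>2) powr k" using k r by (intro powr_mono2) auto
    then have "(1 + 1 / r) powr k * (1 + r) powr - k \<le> (32 * k / \<rho>\<^sup>2) powr k * (1 + r) powr - k"
      by (intro mult_right_mono) auto
    moreover have "(1 + 1 / r) powr k * (1 + r) powr - k = r powr - k"
    proof -
      have "1 + 1 / r = (1 + r) / r" using r by (simp add: field_simps)
      then have "(1 + 1 / r) powr k = (1 + r) powr k / r powr k" using r by (simp add: powr_divide)
      then show ?thesis using r by (simp add: powr_minus_divide)
    qed
    ultimately have p: "r powr - k \<le> (32 * k / \<rho>\<^sup>2) powr k * (1 + r) powr - k" by simp
    have "r powr - k * exp (- (norm z)\<^sup>2 / (4 * r))
      \<le> ((32 * k / \<rho>\<^sup>2) powr k * (1 + r) powr - k) * exp (- (norm z)\<^sup>2 / (4 * (1 + r)))"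
      by (intro mult_mono p e1) auto
    then show ?thesis by (simp only: heat_ker_def k_def mult.assoc)
  next
    case False
    define X where "X = (norm z)\<^sup>2 / (8 * r)"
    have z: "\<rho>\<^sup>2 / 2 \<le> (norm z)\<^sup>2" using False out by linarith
    then have z0: "0 < (norm z)\<^sup>2" using \<rho>2 by linarith
    have X: "0 < X" using r z0 by (simp add: X_def)
    have r1: "r \<le> 1" using False \<rho>2 by linarith
    have "r powr - k * exp (- X) \<le> r powr - k * (k / X) powr k"
      using k X by (intro mult_left_mono exp_minus_le_powr) auto
    also have "\<dots> = (8 * k / (norm z)\<^sup>2) powr k"
    proof -
      have "k / X = r * (8 * k / (norm z)\<^sup>2)" using r z0 by (simp add: X_def)
      then have "(k / X) powr k = r powr k * (8 * k / (norm z)\<^sup>2) powr k"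
        using r k by (simp add: powr_mult[symmetric])
      then show ?thesis using r by (simp add: powr_minus)
    qed
    also have "\<dots> \<le> (16 * k / \<rho>\<^sup>2) powr k"
    proof (intro powr_mono2)
      have "8 * k / (norm z)\<^sup>2 \<le> 8 * k / (\<rho>\<^sup>2 / 2)" using z \<rho>2(1) k by (intro frac_le) auto
      then show "8 * k / (norm z)\<^sup>2 \<le> 16 * k / \<rho>\<^sup>2" by simp
    qed (use k in auto)
    finally have 1: "r powr - k * exp (- X) \<le> (16 * k / \<rho>\<^sup>2) powr k" .
    have "(2::real) powr - k \<le> (1 + r) powr - k" using r r1 k by (intro powr_mono2') auto
    then have "(16 * k / \<rho>\<^sup>2) powr k * 1 \<le> (16 * k / \<rho>\<^sup>2) powr k * (2 powr k * (1 + r) powr - k)"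
      by (intro mult_left_mono) (simp_all add: powr_minus field_simps)
    also have "\<dots> = (32 * k / \<rho>\<^sup>2) powr k * (1 + r) powr - k"
      using powr_mult[of "16 * k / \<rho>\<^sup>2" 2 k] k by (simp add: mult_ac)
    finally have p: "r powr - k * exp (- X) \<le> (32 * k / \<rho>\<^sup>2) powr k * (1 + r) powr - k" using 1 by simp
    have e2: "exp (- X) \<le> exp (- (norm z)\<^sup>2 / (4 * (1 + r)))"
      unfolding X_def using r r1 by (simp add: frac_le)
    have "exp (- (norm z)\<^sup>2 / (4 * r)) = exp (- X) * exp (- X)"
      using r by (simp add: X_def exp_add[symmetric] field_simps)
    then have "r powr - k * exp (- (norm z)\<^sup>2 / (4 * r)) = (r powr - k * exp (- X)) * exp (- X)" by simp
    also have "\<dots> \<le> ((32 * k / \<rho>\<^sup>2) powr k * (1 + r) powr - k) * exp (- (norm z)\<^sup>2 / (4 * (1 + r)))"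
      by (intro mult_mono p e2) auto
    finally show ?thesis by (simp only: heat_ker_def k_def mult.assoc)
  qed
qed

text \<open>The past is cut in three. Before \<open>t - \<delta>\<close> the constant
  \<open>u x t\<close> is integrated exactly and \<open>u\<close> is left as mass; close to the
  point the paraboloid from above bounds the loss; in between \<open>u\<close> is charged to the
  mass seen from \<open>(x, t + 1)\<close>, by \<open>heat_ker_tail\<close>.\<close>

lemma mass_at_touching_point:
  fixes u :: "'a::euclidean_space \<Rightarrow> real \<Rightarrow> real"
  assumes sol: "heat_solution s u F" and s: "0 < s" "s < 1"
    and \<rho>: "0 < \<rho>" "\<rho> \<le> 1" and \<delta>: "0 < \<delta>" and A: "0 \<le> A"
    and pos: "\<And>y \<tau>. \<tau> \<le> t \<Longrightarrow> 0 \<le> u x t + e \<bullet> (y - x) + A * ((norm (y - x))\<^sup>2 + (t - \<tau>))"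
    and near: "\<And>y \<tau>. \<tau> \<le> t \<Longrightarrow> (norm (y - x))\<^sup>2 + (t - \<tau>) \<le> \<rho>\<^sup>2 \<Longrightarrow>
      u y \<tau> \<le> u x t + e \<bullet> (y - x) + A * ((norm (y - x))\<^sup>2 + (t - \<tau>))"
    and C: "0 \<le> C" "mass s u x (t + 1) 1 \<le> ennreal C" and m: "0 \<le> m" "mass s u x t \<delta> \<le> ennreal m"
  defines "k \<equiv> real DIM('a) / 2 + 1 + s"
  shows "u x t * gauss_mass TYPE('a) * (\<delta> powr - s / s)
      - A * (gauss_var TYPE('a) + gauss_mass TYPE('a)) * ((\<rho>\<^sup>2) powr (1 - s) / (1 - s))
      - F x t / master_const DIM('a) s \<le> m + (32 * k / \<rho>\<^sup>2) powr k * C"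
proof -
  note [measurable] = heat_solution_measurable[OF sol]
  have u0: "\<And>x t. 0 \<le> u x t" using sol by (simp add: heat_solution_def)
  \<comment> \<open>The paraboloid of radius \<rho> reaches back only \<open>\<rho>\<^sup>2\<close>
    in time, so the near part must not be longer than that.\<close>
  define \<delta>' where "\<delta>' = min \<delta> (\<rho>\<^sup>2)"
  have \<delta>': "0 < \<delta>'" "\<delta>' \<le> \<delta>" "\<delta>' \<le> \<rho>\<^sup>2" using \<delta> \<rho> by (auto simp: \<delta>'_def)
  define V where "V = gauss_var TYPE('a) + gauss_mass TYPE('a)"
  have V: "0 \<le> V" using gauss_var_nonneg[where 'a='a] gauss_mass_pos[where 'a='a] by (simp add: V_def)
  \<comment> \<open>Wherever \<open>w = u\<close>, the comparison only needs
    \<open>g \<le> u x t\<close>; at near times off the paraboloid this is the hypothesis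
    \<open>pos\<close>.\<close>
  define g where "g = (\<lambda>y \<tau>. if \<tau> \<le> t - \<delta> then u x t + 0 \<bullet> (y - x) + 0 * ((norm (y - x))\<^sup>2 + (t - \<tau>))
    else if \<tau> < t - \<delta>' then 0 else 0 + (- e) \<bullet> (y - x) + (- A) * ((norm (y - x))\<^sup>2 + (t - \<tau>)))"
  define w where "w = (\<lambda>y \<tau>. if \<tau> \<le> t - \<delta> then u y \<tau>
    else if t - \<delta>' \<le> \<tau> \<and> (norm (y - x))\<^sup>2 + (t - \<tau>) \<le> \<rho>\<^sup>2 then 0 else u y \<tau>)"
  define G where "G = (\<lambda>\<tau>. if \<tau> \<le> t - \<delta> then u x t * gauss_mass TYPE('a) * (t - \<tau>) powr (- 1 - s)
    else if \<tau> < t - \<delta>' then 0 else - (A * V) * (t - \<tau>) powr - s)"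
  define I where "I = u x t * gauss_mass TYPE('a) * (\<delta> powr - s / s) - A * V * (\<delta>' powr (1 - s) / (1 - s))"
  have le: "g y \<tau> - w y \<tau> \<le> u x t - u y \<tau>" if "\<tau> < t" for y \<tau>
    using pos[of \<tau> y] near[of \<tau> y] that u0[of x t] by (auto simp: g_def w_def)
  have gG: "has_bochner_integral lborel (\<lambda>y. g y \<tau> * heat_ker s (x - y) (t - \<tau>)) (G \<tau>)" if "\<tau> < t" for \<tau>
  proof -
    consider "\<tau> \<le> t - \<delta>" | "\<not> \<tau> \<le> t - \<delta>" "\<tau> < t - \<delta>'" | "\<not> \<tau> \<le> t - \<delta>" "\<not> \<tau> < t - \<delta>'" by blast
    then show ?thesis
    proof cases
      case 1
      then show ?thesis using heat_ker_moments[of "t - \<tau>" "u x t" 0 x 0 s] that by (simp add: g_def G_def)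
    next
      case 2
      then show ?thesis by (simp add: g_def G_def has_bochner_integral_zero)
    next
      case 3
      then show ?thesis using heat_ker_moments[of "t - \<tau>" 0 "- e" x "- A" s] that
        by (simp add: g_def G_def V_def)
    qed
  qed
  have GI: "has_bochner_integral lborel (\<lambda>\<tau>. indicator {..<t} \<tau> * G \<tau>) I"
  proof -
    have "has_bochner_integral lborel (\<lambda>\<tau>. u x t * gauss_mass TYPE('a) * (indicator {..t - \<delta>} \<tau> * (t - \<tau>) powr (- 1 - s)) -
      A * V * (indicator {t - \<delta>'..t} \<tau> * (t - \<tau>) powr - s)) I" (is "has_bochner_integral _ ?f _")
      unfolding I_def using s \<delta> \<delta>'(1)
      by (intro has_bochner_integral_diff has_bochner_integral_mult_right time_integral_far time_integral_near)
    moreover have "AE \<tau> in lborel. ?f \<tau> = indicator {..<t} \<tau> * G \<tau>"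
      using AE_lborel_singleton[of t] AE_lborel_singleton[of "t - \<delta>"]
      by eventually_elim (use \<delta> \<delta>' in \<open>auto simp: indicator_def G_def\<close>)
    moreover have "?f \<in> borel_measurable lborel" by measurable
    moreover have "(\<lambda>\<tau>. indicator {..<t} \<tau> * G \<tau>) \<in> borel_measurable lborel" unfolding G_def by measurable
    ultimately show ?thesis using has_bochner_integral_cong_AE by blast
  qed
  define D where "D = (32 * k / \<rho>\<^sup>2) powr k"
  have D: "0 \<le> D" by (simp add: D_def)
  have "ennreal (I - F x t / master_const DIM('a) s)
     \<le> (\<integral>\<^sup>+\<tau>\<in>{..<t}. (\<integral>\<^sup>+y. ennreal (w y \<tau> * heat_ker s (x - y) (t - \<tau>)) \<partial>lborel) \<partial>lborel)"
    by (rule heat_solution_lower[OF sol le gG GI])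
  also have "\<dots> \<le> (\<integral>\<^sup>+\<tau>. (\<integral>\<^sup>+y. ennreal (u y \<tau> * heat_ker s (x - y) (t - \<tau>)) \<partial>lborel) * indicator {..t - \<delta>} \<tau>
      + ennreal D * ((\<integral>\<^sup>+y. ennreal (u y \<tau> * heat_ker s (x - y) (t + 1 - \<tau>)) \<partial>lborel) * indicator {..t + 1 - 1} \<tau>) \<partial>lborel)"
  proof (rule nn_integral_mono)
    fix \<tau>
    show "(\<integral>\<^sup>+y. ennreal (w y \<tau> * heat_ker s (x - y) (t - \<tau>)) \<partial>lborel) * indicator {..<t} \<tau>
      \<le> (\<integral>\<^sup>+y. ennreal (u y \<tau> * heat_ker s (x - y) (t - \<tau>)) \<partial>lborel) * indicator {..t - \<delta>} \<tau>
      + ennreal D * ((\<integral>\<^sup>+y. ennreal (u y \<tau> * heat_ker s (x - y) (t + 1 - \<tau>)) \<partial>lborel) * indicator {..t + 1 - 1} \<tau>)"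
    proof (cases "\<tau> \<le> t - \<delta> \<or> t \<le> \<tau>")
      case True
      then show ?thesis using \<delta> by (auto simp: w_def indicator_def)
    next
      case False
      have "(\<integral>\<^sup>+y. ennreal (w y \<tau> * heat_ker s (x - y) (t - \<tau>)) \<partial>lborel)
         \<le> (\<integral>\<^sup>+y. ennreal D * ennreal (u y \<tau> * heat_ker s (x - y) (t + 1 - \<tau>)) \<partial>lborel)"
      proof (rule nn_integral_mono)
        fix y
        have "w y \<tau> * heat_ker s (x - y) (t - \<tau>) \<le> D * (u y \<tau> * heat_ker s (x - y) (t + 1 - \<tau>))"
        proof (cases "t - \<delta>' \<le> \<tau> \<and> (norm (y - x))\<^sup>2 + (t - \<tau>) \<le> \<rho>\<^sup>2")
          case True
          then show ?thesis using False D u0[of y \<tau>] by (simp add: w_def)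
        next
          case out: False
          have "\<rho>\<^sup>2 \<le> (norm (x - y))\<^sup>2 + (t - \<tau>)"
          proof (cases "\<rho>\<^sup>2 \<le> t - \<tau>")
            case True
            then show ?thesis using zero_le_power2[of "norm (x - y)"] by linarith
          next
            case lt: False
            then have "t - \<delta>' \<le> \<tau>" using False by (auto simp: \<delta>'_def)
            then show ?thesis using out by (simp add: norm_minus_commute)
          qed
          then have "heat_ker s (x - y) (t - \<tau>) \<le> D * heat_ker s (x - y) (1 + (t - \<tau>))"
            unfolding D_def k_def using False s \<rho> by (intro heat_ker_tail) auto
          from mult_left_mono[OF this u0[of y \<tau>]]
          have "u y \<tau> * heat_ker s (x - y) (t - \<tau>) \<le> D * (u y \<tau> * heat_ker s (x - y) (1 + (t - \<tau>)))"
            by (simp add: mult.left_commute)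
          moreover have "1 + (t - \<tau>) = t + 1 - \<tau>" by simp
          moreover have "w y \<tau> = u y \<tau>" using False out by (auto simp: w_def)
          ultimately show ?thesis by metis
        qed
        then show "ennreal (w y \<tau> * heat_ker s (x - y) (t - \<tau>)) \<le> ennreal D * ennreal (u y \<tau> * heat_ker s (x - y) (t + 1 - \<tau>))"
          using D by (simp add: ennreal_mult'[symmetric] ennreal_leI)
      qed
      also have "\<dots> = ennreal D * (\<integral>\<^sup>+y. ennreal (u y \<tau> * heat_ker s (x - y) (t + 1 - \<tau>)) \<partial>lborel)"
        by (rule nn_integral_cmult) measurable
      finally show ?thesis using False by (simp add: indicator_def)
    qed
  qed
  also have "\<dots> = mass s u x t \<delta> + ennreal D * mass s u x (t + 1) 1"
    unfolding mass_def by (subst nn_integral_add, measurable, subst nn_integral_cmult, measurable)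
  also have "\<dots> \<le> ennreal m + ennreal D * ennreal C" using m C by (intro add_mono mult_left_mono) auto
  also have "\<dots> = ennreal (m + D * C)" using m C D by (simp add: ennreal_mult' ennreal_plus)
  finally have "I - F x t / master_const DIM('a) s \<le> m + D * C"
    using m C D by (subst (asm) ennreal_le_iff) auto
  moreover have "A * V * (\<delta>' powr (1 - s) / (1 - s)) \<le> A * V * ((\<rho>\<^sup>2) powr (1 - s) / (1 - s))"
    using A V \<delta>' s by (intro mult_left_mono divide_right_mono powr_mono2) auto
  ultimately show ?thesis by (simp add: I_def D_def V_def)
qed

subsection \<open>The universal bound\<close>

lemma powr_ge_beyond:
  fixes X \<omega> :: real
  assumes "0 < \<omega>"
  obtains U\<^sub>0 where "\<And>U. U\<^sub>0 \<le> U \<Longrightarrow> X \<le> U powr \<omega>"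
proof (rule that[of "\<bar>X\<bar> powr (1 / \<omega>)"])
  fix U assume "\<bar>X\<bar> powr (1 / \<omega>) \<le> U"
  then have "(\<bar>X\<bar> powr (1 / \<omega>)) powr \<omega> \<le> U powr \<omega>" using assms by (intro powr_mono2) auto
  then show "X \<le> U powr \<omega>" using assms by (simp add: powr_powr)
qed

text \<open>The hypothesis \<open>le\<close> bounds \<open>1 / \<rho>\<close> by
  \<open>R * U powr (1 / m)\<close>, so the power \<beta> of \<open>1 / \<rho>\<close> costs at most
  \<open>U powr a\<close> as soon as \<open>\<beta> / m \<le> a\<close>.\<close>

lemma powr_radius_bound:
  fixes U R \<rho> \<beta> :: real
  assumes U: "1 \<le> U" and R: "0 < R" and \<rho>: "0 < \<rho>" and m: "0 < m" and le: "1 \<le> U * (R * \<rho>) ^ m"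
    and \<beta>: "0 \<le> \<beta>" "\<beta> \<le> real m * a"
  shows "\<rho> powr - \<beta> \<le> R powr \<beta> * U powr a"
proof -
  have "1 / U \<le> (R * \<rho>) powr real m"
    using le U R \<rho> by (simp add: powr_realpow pos_divide_le_eq mult.commute)
  then have "(1 / U) powr (\<beta> / m) \<le> ((R * \<rho>) powr real m) powr (\<beta> / m)"
    using U \<beta> by (intro powr_mono2) auto
  also have "\<dots> = R powr \<beta> * \<rho> powr \<beta>" using m R \<rho> by (simp add: powr_powr powr_mult)
  finally have "1 \<le> R powr \<beta> * \<rho> powr \<beta> * U powr (\<beta> / m)"
    using U by (simp add: powr_divide pos_divide_le_eq)
  then have "\<rho> powr - \<beta> \<le> R powr \<beta> * U powr (\<beta> / m)"
    using \<rho> by (simp add: powr_minus field_simps)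
  also have "\<dots> \<le> R powr \<beta> * U powr a"
    using U \<beta> m by (intro mult_left_mono powr_mono) (auto simp: pos_divide_le_eq mult.commute)
  finally show ?thesis .
qed

text \<open>For \<open>h = \<delta> powr (1 + \<sigma>)\<close> the quotient
  \<open>\<delta> / h\<close> is a negative power of \<delta>, so the exponential beats every power
  of \<delta>. This supplies the hypothesis \<open>small\<close> of
  \<open>spreading\<close>.\<close>

lemma spreading_small:
  fixes \<delta> \<sigma> s n b :: real
  assumes s: "0 < s" and \<sigma>: "0 < \<sigma>" and n: "0 \<le> n" and b: "0 < b"
  obtains d where "0 < d" "d \<le> 1"
    "\<And>\<delta>. 0 < \<delta> \<Longrightarrow> \<delta> \<le> d \<Longrightarrow> (\<delta> powr (1 + \<sigma>)) powr (s - n) * exp (- \<delta> / (8 * \<delta> powr (1 + \<sigma>))) \<le> b * \<delta> powr (1 + \<sigma>)"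
proof -
  \<comment> \<open>This exponent leaves one spare factor \<delta>, which absorbs the constant
    \<open>(8 * k) powr k\<close> once \<open>\<delta> \<le> d\<close>.\<close>
  define k where "k = ((1 + \<sigma>) * (1 + n) + 1) / \<sigma>"
  have k: "0 < k" "\<sigma> * k = (1 + \<sigma>) * (1 + n) + 1"
    using \<sigma> n by (auto simp: k_def intro!: divide_pos_pos add_pos_nonneg add_nonneg_pos)
  define d where "d = min 1 (b / (8 * k) powr k)"
  show thesis
  proof (rule that[of d])
    show "0 < d" using b k by (simp add: d_def)
    fix \<delta> assume \<delta>: "0 < \<delta>" "\<delta> \<le> d"
    then have \<delta>1: "\<delta> \<le> 1" and \<delta>b: "\<delta> * (8 * k) powr k \<le> b"
      using k by (auto simp: d_def pos_le_divide_eq)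
    have X: "\<delta> / (8 * \<delta> powr (1 + \<sigma>)) = \<delta> powr - \<sigma> / 8"
      using \<delta> by (simp add: powr_add powr_minus_divide)
    have "exp (- \<delta> / (8 * \<delta> powr (1 + \<sigma>))) = exp (- (\<delta> powr - \<sigma> / 8))" using X by simp
    also have "\<dots> \<le> (k / (\<delta> powr - \<sigma> / 8)) powr k" using k \<delta> by (intro exp_minus_le_powr) auto
    also have "k / (\<delta> powr - \<sigma> / 8) = (8 * k) * \<delta> powr \<sigma>" using \<delta> by (simp add: powr_minus_divide)
    also have "((8 * k) * \<delta> powr \<sigma>) powr k = (8 * k) powr k * \<delta> powr (\<sigma> * k)"
      using k \<delta> by (simp add: powr_mult powr_powr)
    finally have "(\<delta> powr (1 + \<sigma>)) powr (s - n) * exp (- \<delta> / (8 * \<delta> powr (1 + \<sigma>)))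
      \<le> (\<delta> powr (1 + \<sigma>)) powr (s - n) * ((8 * k) powr k * \<delta> powr (\<sigma> * k))"
      by (intro mult_left_mono) auto
    also have "\<dots> = (8 * k) powr k * \<delta> powr ((1 + \<sigma>) * (s - n) + \<sigma> * k)"
      unfolding powr_powr powr_add[of \<delta> "(1 + \<sigma>) * (s - n)"] by (simp only: mult_ac)
    also have "\<dots> \<le> (8 * k) powr k * \<delta> powr (1 + (1 + \<sigma>))"
    proof (intro mult_left_mono powr_mono')
      have "0 \<le> (1 + \<sigma>) * s" using s \<sigma> by simp
      then show "1 + (1 + \<sigma>) \<le> (1 + \<sigma>) * (s - n) + \<sigma> * k" unfolding k(2) by (simp add: algebra_simps)
    qed (use \<delta> \<delta>1 in auto)
    also have "\<dots> = (\<delta> * (8 * k) powr k) * \<delta> powr (1 + \<sigma>)"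
      using \<delta> by (subst powr_add) simp
    also have "\<dots> \<le> b * \<delta> powr (1 + \<sigma>)" using \<delta>b by (intro mult_right_mono) auto
    finally show "(\<delta> powr (1 + \<sigma>)) powr (s - n) * exp (- \<delta> / (8 * \<delta> powr (1 + \<sigma>))) \<le> b * \<delta> powr (1 + \<sigma>)" .
  qed (simp add: d_def)
qed

lemma universal_bound:
  fixes s p \<kappa> K\<^sub>0 C\<^sub>0 :: real
  assumes s: "0 < s" "s < 1"
    and p: "1 < p" "p < (real DIM('a) + 2) / (real DIM('a) + 2 - 2 * s)"
    and \<kappa>: "0 < \<kappa>" and K0: "0 \<le> K\<^sub>0" and C0: "0 < C\<^sub>0"
  obtains C where "\<And>(u :: 'a::euclidean_space \<Rightarrow> real \<Rightarrow> real) F x t. heat_solution s u F \<Longrightarrow>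
    (\<And>x t. 0 \<le> F x t) \<Longrightarrow> (\<And>x t. F x t \<le> C\<^sub>0 * (1 + u x t powr p)) \<Longrightarrow>
    (\<And>x t. \<kappa> * u x t powr p - K\<^sub>0 \<le> F x t) \<Longrightarrow> u x t \<le> C"
proof -
  define n where "n = real DIM('a) / 2"
  define k where "k = n + 1 + s"
  define c where "c = master_const DIM('a) s"
  define M where "M = gauss_mass TYPE('a)"
  define V where "V = gauss_var TYPE('a) + gauss_mass TYPE('a)"
  have n: "0 \<le> n" and k: "0 < k" using s by (auto simp: n_def k_def)
  have c: "0 < c" and M: "0 < M" and V: "0 < V"
    using master_const_pos[OF s] gauss_mass_pos[where 'a='a] gauss_var_nonneg[where 'a='a]
    by (simp_all add: c_def M_def V_def)
  obtain A\<^sub>0 where A0: "0 < A\<^sub>0"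
    "\<And>(u :: 'a \<Rightarrow> real \<Rightarrow> real) F (x\<^sub>0::'a) t\<^sub>0. heat_solution s u F \<Longrightarrow> (\<And>x t. \<kappa> * u x t powr p - K\<^sub>0 \<le> F x t) \<Longrightarrow>
      \<exists>x t. norm (x - x\<^sub>0) \<le> 1 \<and> t\<^sub>0 \<le> t \<and> t \<le> t\<^sub>0 + 1 \<and> u x t < A\<^sub>0"
    using blow_up[OF s p(1) \<kappa> K0, where 'a='a] by metis
  obtain C\<^sub>3 where C3: "0 < C\<^sub>3"
    "\<And>(u :: 'a \<Rightarrow> real \<Rightarrow> real) F (x::'a) t. heat_solution s u F \<Longrightarrow> (\<And>x t. 0 \<le> F x t) \<Longrightarrow>
      (\<And>x t. \<kappa> * u x t powr p - K\<^sub>0 \<le> F x t) \<Longrightarrow> mass s u x t 1 \<le> ennreal C\<^sub>3"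
    using mass_bound[OF s p(1) \<kappa> K0, where 'a='a] by metis
  \<comment> \<open>These conditions let \<open>powr_radius_bound\<close> absorb
    \<open>\<rho> powr - (2 * s)\<close> into \<open>U powr (p - 1)\<close> and
    \<open>\<rho> powr - (2 * k)\<close> into \<open>U\<close>.\<close>
  obtain m :: nat where "max 1 (max (2 * s / (p - 1)) (2 * k)) \<le> real m" using real_arch_simple by blast
  then have m: "0 < m" "2 * s \<le> real m * (p - 1)" "2 * k \<le> real m * 1"
    using p(1) by (auto simp: pos_divide_le_eq)
  define B where "B = (2::real) ^ m"
  have B: "1 \<le> B" by (simp add: B_def)
  define R where "R = 18 * B"
  have R: "0 < R" using B by (simp add: R_def)
  define a5 where "a5 = V / (1 - s) * R powr (2 * s)"
  define b5 where "b5 = C\<^sub>0 * (1 + B powr p) / c"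
  define c5 where "c5 = (32 * k) powr k * R powr (2 * k) * C\<^sub>3"
  \<comment> \<open>In units of \<open>U powr p\<close>, the summands bound the near part, the
    right-hand side and the middle part in \<open>mass_at_touching_point\<close>.\<close>
  define C5 where "C5 = a5 + b5 + c5"
  have "0 < a5" "0 < b5" "0 < c5" using V s R C0 c k C3 B by (simp_all add: a5_def b5_def c5_def add_pos_pos)
  then have C5: "0 < C5" by (simp add: C5_def)
  \<comment> \<open>For \<delta> as defined below this makes the remote term
    \<open>U * (M * (\<delta> powr - s / s))\<close> equal to \<open>3 * (C5 * U powr p)\<close>,
    whereas the three errors and a mass of at most \<open>C5 * U powr p\<close> give only twice that
    unit.\<close>
  define \<epsilon> where "\<epsilon> = (M / (3 * s * C5)) powr (1 / s)"
  have \<epsilon>: "0 < \<epsilon>" using M s C5 by (simp add: \<epsilon>_def)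
  have \<epsilon>s: "\<epsilon> powr s = M / (3 * s * C5)" using M s C5 by (simp add: \<epsilon>_def powr_powr)
  define c6 where "c6 = mass_const TYPE('a) s * C5 * \<epsilon> powr s"
  have c6: "0 < c6" using mass_const_pos[OF s, where 'a='a] C5 \<epsilon> by (simp add: c6_def)
  \<comment> \<open>Half of the power growth of \<open>F\<close>; the other half absorbs
    \<open>K\<^sub>0\<close>.\<close>
  define c7 where "c7 = \<kappa> * c6 powr p / 2"
  have c7: "0 < c7" using \<kappa> c6 by (simp add: c7_def)
  \<comment> \<open>The factor \<open>\<delta> powr (n + 1)\<close> is of order
    \<open>U powr - E\<close>, and \<open>E < p\<close> is the upper bound on \<open>p\<close> in
    another form.\<close>
  define E where "E = (p - 1) * (n + 1) / s"
  have E: "0 < E" using p s n by (simp add: E_def)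
  have "E < p"
  proof -
    have "p * (2 * n + 2 - 2 * s) < 2 * n + 2"
      using p(2) s n by (subst (asm) pos_less_divide_eq) (auto simp: n_def)
    then have "(p - 1) * (n + 1) < p * s" by (simp add: algebra_simps)
    then show ?thesis using s by (simp add: E_def pos_divide_less_eq)
  qed
  \<comment> \<open>Puts \<open>(1 + \<sigma>) * E\<close> halfway between \<open>E\<close> and
    \<open>p\<close>, which leaves the positive exponent \<omega>.\<close>
  define \<sigma> where "\<sigma> = (p / E - 1) / 2"
  have \<sigma>: "0 < \<sigma>" using E \<open>E < p\<close> by (simp add: \<sigma>_def)
  have \<sigma>E: "(1 + \<sigma>) * E = (p + E) / 2" using E by (simp add: \<sigma>_def field_simps)
  define \<omega> where "\<omega> = p - (1 + \<sigma>) * E"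
  have \<omega>: "0 < \<omega>" using \<open>E < p\<close> by (simp add: \<omega>_def \<sigma>E)
  define c8 where "c8 = spread_const TYPE('a) s * c7 * \<epsilon> powr ((1 + \<sigma>) * (n + 1))"
  have c8: "0 < c8" using spread_const_pos[OF s, where 'a='a] c7 \<epsilon> by (simp add: c8_def)
  obtain d where d: "0 < d" "d \<le> 1" "\<And>\<delta>. 0 < \<delta> \<Longrightarrow> \<delta> \<le> d \<Longrightarrow>
      (\<delta> powr (1 + \<sigma>)) powr (s - n) * exp (- \<delta> / (8 * \<delta> powr (1 + \<sigma>))) \<le> bump_const TYPE('a) s * \<delta> powr (1 + \<sigma>)"
    using spreading_small[OF s(1) \<sigma> n spread_const_pos(1)[OF s, where 'a='a]] by metis
  have "0 < (p - 1) / s" using p s by simp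
  \<comment> \<open>Beyond \<open>U1\<close> the scale \<delta> is at most \<open>d\<close>, beyond
    \<open>U2\<close> the growth absorbs \<open>K\<^sub>0\<close>, and beyond \<open>U3\<close> the
    transported lower bound reaches the threshold of \<open>blow_up\<close>.\<close>
  then obtain U1 where U1: "\<And>U. U1 \<le> U \<Longrightarrow> \<epsilon> / d \<le> U powr ((p - 1) / s)" using powr_ge_beyond by blast
  obtain U2 where U2: "\<And>U. U2 \<le> U \<Longrightarrow> K\<^sub>0 / c7 \<le> U powr p" using powr_ge_beyond[of p] p by (metis less_trans zero_less_one)
  obtain U3 where U3: "\<And>U. U3 \<le> U \<Longrightarrow> A\<^sub>0 / c8 \<le> U powr \<omega>" using powr_ge_beyond[OF \<omega>] by blast
  define C where "C = max 1 (max U1 (max U2 U3))"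
  show thesis
  proof (rule that[of C])
    fix u :: "'a \<Rightarrow> real \<Rightarrow> real" and F x\<^sub>0 t\<^sub>0
    assume sol: "heat_solution s u F" and F0: "\<And>x t. 0 \<le> F x t"
      and Fup: "\<And>x t. F x t \<le> C\<^sub>0 * (1 + u x t powr p)" and Flow: "\<And>x t. \<kappa> * u x t powr p - K\<^sub>0 \<le> F x t"
    have u0: "\<And>x t. 0 \<le> u x t" and cu: "continuous_on UNIV (\<lambda>z. u (fst z) (snd z))"
      using sol by (auto simp: heat_solution_def)
    show "u x\<^sub>0 t\<^sub>0 \<le> C"
    proof (rule ccontr)
      assume big: "\<not> ?thesis"
      then have ge1: "1 \<le> u x\<^sub>0 t\<^sub>0" by (simp add: C_def)
      obtain x t U \<rho> e A where *: "u x\<^sub>0 t\<^sub>0 \<le> U" "U \<le> u x t" "u x t \<le> 2 ^ m * U"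
        "0 < \<rho>" "\<rho> \<le> 1" "1 \<le> U * (18 * 2 ^ m * \<rho>) ^ m" "0 \<le> A" "A \<le> U / \<rho>\<^sup>2"
        and pos: "\<And>y \<tau>. \<tau> \<le> t \<Longrightarrow> 0 \<le> u x t + e \<bullet> (y - x) + A * ((norm (y - x))\<^sup>2 + (t - \<tau>))"
        and near: "\<And>y \<tau>. \<tau> \<le> t \<Longrightarrow> (norm (y - x))\<^sup>2 + (t - \<tau>) \<le> \<rho>\<^sup>2 \<Longrightarrow>
          u y \<tau> \<le> u x t + e \<bullet> (y - x) + A * ((norm (y - x))\<^sup>2 + (t - \<tau>))"
        using doubling_selection[where u=u and m=m and x\<^sub>0=x\<^sub>0 and t\<^sub>0=t\<^sub>0, OF cu u0 m(1) ge1] by metis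
      have U: "1 \<le> U" "U1 \<le> U" "U2 \<le> U" "U3 \<le> U" using *(1) big by (auto simp: C_def)
      have rad: "1 \<le> U * (R * \<rho>) ^ m" using *(6) by (simp add: R_def B_def)
      have Up: "1 \<le> U powr p" using U p by (simp add: ge_one_powr_ge_zero)
      define \<delta> where "\<delta> = \<epsilon> * U powr - ((p - 1) / s)"
      have \<delta>: "0 < \<delta>" using \<epsilon> U by (simp add: \<delta>_def)
      have \<delta>s: "\<delta> powr s = \<epsilon> powr s * U powr - (p - 1)"
        using \<epsilon> U s by (simp add: \<delta>_def powr_mult powr_powr)
      have "\<epsilon> \<le> d * U powr ((p - 1) / s)" using U1[OF U(2)] d by (simp add: pos_divide_le_eq mult.commute)
      then have \<delta>d: "\<delta> \<le> d" using U by (simp add: \<delta>_def powr_minus_divide pos_divide_le_eq)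
      have UpU: "U * U powr (p - 1) = U powr p" using U powr_add[of U 1 "p - 1"] by simp
      have mass: "ennreal (C5 * U powr p) \<le> mass s u x t \<delta>"
      proof (rule ccontr)
        assume "\<not> ?thesis"
        then have m': "mass s u x t \<delta> \<le> ennreal (C5 * U powr p)" by simp
        have a: "A * V * ((\<rho>\<^sup>2) powr (1 - s) / (1 - s)) \<le> a5 * U powr p"
        proof -
          have "A * V * ((\<rho>\<^sup>2) powr (1 - s) / (1 - s)) \<le> (U / \<rho>\<^sup>2) * V * ((\<rho>\<^sup>2) powr (1 - s) / (1 - s))"
            using *(8) V s by (intro mult_right_mono) auto
          also have "\<dots> = V / (1 - s) * (U * \<rho> powr - (2 * s))"
          proof -
            have "\<rho> powr 2 = \<rho>\<^sup>2" using *(4) powr_realpow[of \<rho> 2] by simp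
            then have "(\<rho>\<^sup>2) powr (1 - s) = \<rho> powr (2 * (1 - s))" using powr_powr[of \<rho> 2 "1 - s"] by simp
            also have "\<dots> = \<rho>\<^sup>2 * \<rho> powr - (2 * s)"
              using powr_add[of \<rho> 2 "- (2 * s)"] \<open>\<rho> powr 2 = \<rho>\<^sup>2\<close> by (simp add: algebra_simps)
            finally show ?thesis using *(4) by simp
          qed
          also have "\<dots> \<le> V / (1 - s) * (U * (R powr (2 * s) * U powr (p - 1)))"
            using V s U m by (intro mult_left_mono powr_radius_bound[OF U(1) R *(4) m(1) rad]) auto
          also have "\<dots> = a5 * U powr p" by (simp add: a5_def UpU[symmetric])
          finally show ?thesis .
        qed
        have b: "F x t / c \<le> b5 * U powr p"
        proof -
          have "u x t powr p \<le> (B * U) powr p" using *(3) u0 p by (intro powr_mono2) (auto simp: B_def)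
          also have "\<dots> = B powr p * U powr p" using B U by (simp add: powr_mult)
          finally have "1 + u x t powr p \<le> (1 + B powr p) * U powr p" using Up by (simp add: distrib_right)
          then have "C\<^sub>0 * (1 + u x t powr p) \<le> C\<^sub>0 * ((1 + B powr p) * U powr p)"
            using C0 by (intro mult_left_mono) auto
          then have "F x t \<le> C\<^sub>0 * ((1 + B powr p) * U powr p)" using Fup[of x t] by linarith
          then show ?thesis using c by (simp add: b5_def divide_right_mono mult.assoc)
        qed
        have r: "(32 * k / \<rho>\<^sup>2) powr k * C\<^sub>3 \<le> c5 * U powr p"
        proof -
          have "\<rho> powr 2 = \<rho>\<^sup>2" using *(4) powr_realpow[of \<rho> 2] by simp
          then have "(\<rho>\<^sup>2) powr k = \<rho> powr (2 * k)" using powr_powr[of \<rho> 2 k] by simp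
          then have "(32 * k / \<rho>\<^sup>2) powr k = (32 * k) powr k * \<rho> powr - (2 * k)"
            using k *(4) by (simp add: powr_divide powr_minus_divide)
          also have "\<dots> \<le> (32 * k) powr k * (R powr (2 * k) * U powr 1)"
            using k m by (intro mult_left_mono powr_radius_bound[OF U(1) R *(4) m(1) rad]) auto
          also have "\<dots> \<le> (32 * k) powr k * (R powr (2 * k) * U powr p)"
            using U p by (intro mult_left_mono powr_mono) auto
          finally have "(32 * k / \<rho>\<^sup>2) powr k * C\<^sub>3 \<le> (32 * k) powr k * (R powr (2 * k) * U powr p) * C\<^sub>3"
            using C3 by (intro mult_right_mono) auto
          then show ?thesis by (simp add: c5_def mult_ac)
        qed
        have "u x t * M * (\<delta> powr - s / s) - A * V * ((\<rho>\<^sup>2) powr (1 - s) / (1 - s)) - F x t / c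
          \<le> C5 * U powr p + (32 * k / \<rho>\<^sup>2) powr k * C\<^sub>3"
          unfolding M_def V_def c_def k_def n_def
        proof (rule mass_at_touching_point[OF sol s *(4,5) \<delta> *(7) pos near])
          show "mass s u x (t + 1) 1 \<le> ennreal C\<^sub>3" using C3(2)[OF sol F0 Flow] .
        qed (use m' C3 C5 Up in auto)
        then have "u x t * M * (\<delta> powr - s / s) \<le> 2 * (C5 * U powr p)"
          using a b r by (simp add: C5_def distrib_right)
        moreover have "U * (M * (\<delta> powr - s / s)) \<le> u x t * (M * (\<delta> powr - s / s))"
          using *(2) M s by (intro mult_right_mono) auto
        moreover have "U * (M * (\<delta> powr - s / s)) = 3 * (C5 * U powr p)"
        proof -
          have "\<delta> powr - s = inverse (\<delta> powr s)" by (simp add: powr_minus)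
          also have "\<dots> = (3 * s * C5) / M * U powr (p - 1)"
            unfolding \<delta>s \<epsilon>s using U by (simp add: powr_minus powr_diff field_simps)
          finally have "U * (M * (\<delta> powr - s / s)) = 3 * C5 * (U * U powr (p - 1))" using M s by simp
          then show ?thesis by (simp add: UpU)
        qed
        moreover have "0 < C5 * U powr p" using C5 U by simp
        ultimately show False by (simp add: mult.assoc)
      qed
      have ulow: "c6 * U \<le> u y \<tau>" if "(norm (y - x))\<^sup>2 \<le> \<delta>" "t + \<delta> \<le> \<tau>" "\<tau> \<le> t + 2 * \<delta>" for y \<tau>
      proof -
        have "mass_const TYPE('a) s * (C5 * U powr p) * \<delta> powr s \<le> u y \<tau>"
          using C5 U by (intro mass_lower_bound[OF sol s F0 \<delta> _ mass that]) auto
        moreover have "U powr p * U powr - (p - 1) = U" using U by (simp add: powr_add[symmetric])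
        then have "mass_const TYPE('a) s * (C5 * U powr p) * \<delta> powr s = c6 * U"
          unfolding \<delta>s c6_def by (metis (no_types) mult.assoc mult.commute)
        ultimately show ?thesis by simp
      qed
      define h where "h = \<delta> powr (1 + \<sigma>)"
      have h: "0 < h" "h \<le> \<delta>" "h \<le> 1"
      proof -
        show "0 < h" using \<delta> by (simp add: h_def)
        have "\<delta> powr (1 + \<sigma>) \<le> \<delta> powr 1" using \<delta> \<delta>d d \<sigma> by (intro powr_mono') auto
        then show "h \<le> \<delta>" using \<delta> by (simp add: h_def)
        then show "h \<le> 1" using \<delta>d d by simp
      qed
      have Flo: "c7 * U powr p \<le> F y \<tau>" if "(norm (y - x))\<^sup>2 \<le> \<delta>" "t + \<delta> < \<tau>" "\<tau> \<le> t + \<delta> + h" for y \<tau>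
      proof -
        have "c6 * U \<le> u y \<tau>" using that h by (intro ulow) auto
        then have "(c6 * U) powr p \<le> u y \<tau> powr p" using c6 U p by (intro powr_mono2) auto
        then have "\<kappa> * (c6 powr p * U powr p) \<le> \<kappa> * u y \<tau> powr p"
          using \<kappa> c6 U by (intro mult_left_mono) (auto simp: powr_mult)
        moreover have "\<kappa> * (c6 powr p * U powr p) = c7 * U powr p + c7 * U powr p" by (simp add: c7_def)
        moreover have "K\<^sub>0 \<le> c7 * U powr p" using U2[OF U(3)] c7 by (simp add: pos_divide_le_eq mult.commute)
        ultimately show ?thesis using Flow[of y \<tau>] by linarith
      qed
      \<comment> \<open>\<open>spreading\<close>, started at \<open>t + \<delta>\<close>, bounds
        \<open>u\<close> below on the whole cylinder one to two time units later;
        \<open>blow_up\<close> provides a low value exactly there.\<close>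
      obtain y \<tau> where y: "norm (y - x) \<le> 1" "(t + \<delta>) + 1 \<le> \<tau>" "\<tau> \<le> (t + \<delta>) + 1 + 1" "u y \<tau> < A\<^sub>0"
        using A0(2)[OF sol Flow, of x "(t + \<delta>) + 1"] by blast
      have "spread_const TYPE('a) s * (c7 * U powr p) * h powr (real DIM('a) / 2 + 1) \<le> u y \<tau>"
      proof (rule spreading[OF sol s F0 h(1,3)])
        show "h powr (s - real DIM('a) / 2) * exp (- \<delta> / (8 * h)) \<le> bump_const TYPE('a) s * h"
          using d(3)[OF \<delta> \<delta>d] by (simp add: h_def n_def)
        show "0 < c7 * U powr p" using c7 U by simp
      qed (use y Flo in auto)
      moreover have "spread_const TYPE('a) s * (c7 * U powr p) * h powr (real DIM('a) / 2 + 1) = c8 * U powr \<omega>"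
      proof -
        have "h powr (n + 1) = \<delta> powr ((1 + \<sigma>) * (n + 1))" by (simp add: h_def powr_powr)
        also have "\<dots> = \<epsilon> powr ((1 + \<sigma>) * (n + 1)) * U powr - ((p - 1) / s * ((1 + \<sigma>) * (n + 1)))"
          using \<epsilon> U by (simp add: \<delta>_def powr_mult powr_powr)
        also have "(p - 1) / s * ((1 + \<sigma>) * (n + 1)) = (1 + \<sigma>) * E" by (simp add: E_def)
        finally have "h powr (n + 1) = \<epsilon> powr ((1 + \<sigma>) * (n + 1)) * U powr - ((1 + \<sigma>) * E)" .
        moreover have "U powr p * U powr - ((1 + \<sigma>) * E) = U powr \<omega>" by (simp add: \<omega>_def powr_add[symmetric])
        ultimately show ?thesis unfolding n_def[symmetric] c8_def by algebra
      qed
      moreover have "A\<^sub>0 \<le> c8 * U powr \<omega>" using U3[OF U(4)] c8 by (simp add: pos_divide_le_eq mult.commute)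
      ultimately show False using y(4) by linarith
    qed
  qed
qed

section \<open>From classical solutions to the integrated equation\<close>

lemma has_principal_value_continuous:
  fixes g :: "'a::euclidean_space \<Rightarrow> real"
  assumes pv: "has_principal_value g x v" and g: "continuous_on UNIV g"
  shows "has_bochner_integral lborel g v"
proof -
  have [measurable]: "g \<in> borel_measurable borel" using g by (rule borel_measurable_continuous_onI)
  have "set_integrable lborel {y. 1 < dist x y} g"
    using pv by (simp add: has_principal_value_def)
  moreover have "set_integrable lborel (cball x 1) g"
    unfolding set_integrable_def
    by (rule borel_integrable_compact) (auto intro: continuous_on_subset[OF g])
  ultimately have "integrable lborel (\<lambda>y. indicator {y. 1 < dist x y} y *\<^sub>R g y + indicator (cball x 1) y *\<^sub>R g y)"
    unfolding set_integrable_def by (rule Bochner_Integration.integrable_add)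
  moreover have "(\<lambda>y. indicator {y. 1 < dist x y} y *\<^sub>R g y + indicator (cball x 1) y *\<^sub>R g y) = g"
    by (auto simp: indicator_def fun_eq_iff)
  ultimately have int: "integrable lborel g" by simp
  \<comment> \<open>Continuity makes the excised ball harmless, so \<open>g\<close> is integrable;
    dominated convergence along these radii identifies the principal value with the full
    integral.\<close>
  have seq: "filterlim (\<lambda>n. inverse (real (Suc n))) (at_right 0) sequentially"
    using LIMSEQ_inverse_real_of_nat by (auto simp: filterlim_at intro: always_eventually)
  have "((\<lambda>\<delta>. LINT y:{y. \<delta> < dist x y}|lborel. g y) \<longlongrightarrow> v) (at_right 0)"
    using pv by (simp add: has_principal_value_def)
  from filterlim_compose[OF this seq]
  have 1: "(\<lambda>n. LINT y|lborel. indicator {y. inverse (real (Suc n)) < dist x y} y *\<^sub>R g y) \<longlonglongrightarrow> v"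
    by (simp add: set_lebesgue_integral_def)
  have 2: "(\<lambda>n. LINT y|lborel. indicator {y. inverse (real (Suc n)) < dist x y} y *\<^sub>R g y) \<longlonglongrightarrow> (LINT y|lborel. g y)"
  proof (rule integral_dominated_convergence)
    show "integrable lborel (\<lambda>y. norm (g y))" using int by simp
    show "AE y in lborel. (\<lambda>n. indicator {y. inverse (real (Suc n)) < dist x y} y *\<^sub>R g y) \<longlonglongrightarrow> g y"
      using AE_lborel_singleton[of x]
    proof eventually_elim
      case (elim y)
      then have "0 < dist x y" by simp
      then have "\<forall>\<^sub>F n in sequentially. inverse (real (Suc n)) < dist x y"
        using LIMSEQ_inverse_real_of_nat by (rule order_tendstoD(2)[rotated])
      then have "\<forall>\<^sub>F n in sequentially. indicator {y. inverse (real (Suc n)) < dist x y} y *\<^sub>R g y = g y"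
        by eventually_elim (simp add: indicator_def)
      then show ?case by (rule tendsto_eventually)
    qed
    show "AE y in lborel. norm (indicator {y. inverse (real (Suc n)) < dist x y} y *\<^sub>R g y) \<le> norm (g y)" for n
      by (rule AE_I2) (simp add: indicator_def)
  qed measurable
  show ?thesis using int LIMSEQ_unique[OF 1 2] by (simp add: has_bochner_integral_iff)
qed

lemma classical_entire_solution_heat_solution:
  fixes u :: "'a::euclidean_space \<Rightarrow> real \<Rightarrow> real"
  assumes sol: "classical_entire_solution s f u" and s: "0 < s" "s < 1" and u0: "\<And>x t. 0 \<le> u x t"
  shows "heat_solution s u (\<lambda>x t. f x (u x t))"
proof -
  obtain \<epsilon> where \<epsilon>: "0 < \<epsilon>" "parabolic_local_holder (2 * s + \<epsilon>) (s + \<epsilon>) u"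
    using sol by (auto simp: classical_entire_solution_def)
  have cu: "continuous_on UNIV (\<lambda>z. u (fst z) (snd z))"
    by (rule parabolic_local_holder_continuous[OF \<epsilon>(2)]) (use s \<epsilon>(1) in simp_all)
  have "\<exists>H. (AE \<tau> in lborel. \<tau> < t \<longrightarrow>
          has_bochner_integral lborel (\<lambda>y. (u x t - u y \<tau>) * heat_ker s (x - y) (t - \<tau>)) (H \<tau>)) \<and>
        has_bochner_integral lborel (\<lambda>\<tau>. indicator {..<t} \<tau> * H \<tau>) (f x (u x t) / master_const DIM('a) s)" for x t
  proof -
    have "has_fractional_heat s u x t (f x (u x t))"
      using sol by (simp add: classical_entire_solution_def)
    then obtain I where I: "AE \<tau> in lborel. \<tau> < t \<longrightarrow> has_principal_value
             (\<lambda>y. (u x t - u y \<tau>) / (t - \<tau>) powr (real DIM('a) / 2 + 1 + s)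
                    * exp (- (norm (x - y))\<^sup>2 / (4 * (t - \<tau>)))) x (I \<tau>)"
      "set_integrable lborel {..<t} I"
      "f x (u x t) = master_const DIM('a) s * (LINT \<tau>:{..<t}|lborel. I \<tau>)"
      unfolding has_fractional_heat_def by blast
    have "AE \<tau> in lborel. \<tau> < t \<longrightarrow>
          has_bochner_integral lborel (\<lambda>y. (u x t - u y \<tau>) * heat_ker s (x - y) (t - \<tau>)) (I \<tau>)"
      using I(1)
    proof eventually_elim
      case (elim \<tau>)
      have eq: "(u x t - u y \<tau>) / (t - \<tau>) powr (real DIM('a) / 2 + 1 + s) * exp (- (norm (x - y))\<^sup>2 / (4 * (t - \<tau>)))
        = (u x t - u y \<tau>) * heat_ker s (x - y) (t - \<tau>)" for y
        unfolding heat_ker_def powr_minus_divide by simp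
      have "continuous_on UNIV (\<lambda>y. u y \<tau>)"
        using continuous_on_compose2[OF cu, of UNIV "\<lambda>y. (y, \<tau>)"] by (simp add: continuous_intros)
      then have "continuous_on UNIV (\<lambda>y. (u x t - u y \<tau>) * heat_ker s (x - y) (t - \<tau>))" if "\<tau> < t"
        unfolding heat_ker_def using that by (intro continuous_intros) auto
      with elim show ?case unfolding eq by (blast intro: has_principal_value_continuous)
    qed
    moreover have "has_bochner_integral lborel (\<lambda>\<tau>. indicator {..<t} \<tau> * I \<tau>) (f x (u x t) / master_const DIM('a) s)"
      using I(2,3) master_const_pos[OF s, of "DIM('a)"]
      by (simp add: has_bochner_integral_iff set_integrable_def set_lebesgue_integral_def)
    ultimately show ?thesis by blast
  qed
  then show ?thesis using cu u0 by (simp add: heat_solution_def)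
qed

text \<open>Off a large ball the limit bounds \<open>K\<close> from below, on the ball compactness
  does.\<close>

lemma continuous_pos_bounded_below:
  fixes K :: "'a::euclidean_space \<Rightarrow> real"
  assumes "continuous_on UNIV K" "\<And>x. 0 < K x" "0 < L" "(K \<longlongrightarrow> L) at_infinity"
  obtains \<kappa> where "0 < \<kappa>" "\<And>x. \<kappa> \<le> K x"
proof -
  have "\<forall>\<^sub>F x in at_infinity. L / 2 < K x" using assms(3,4) by (intro order_tendstoD(1)) auto
  then obtain r where r: "\<And>x. r \<le> norm x \<Longrightarrow> L / 2 < K x" by (auto simp: eventually_at_infinity)
  have "compact (cball 0 \<bar>r\<bar> :: 'a set)" "cball 0 \<bar>r\<bar> \<noteq> ({} :: 'a set)" by auto
  then obtain z where z: "\<And>x. x \<in> cball 0 \<bar>r\<bar> \<Longrightarrow> K z \<le> K x"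
    using continuous_attains_inf[of "cball 0 \<bar>r\<bar>" K] continuous_on_subset[OF assms(1)] by (metis subset_UNIV)
  show thesis
  proof (rule that[of "min (L / 2) (K z)"])
    show "0 < min (L / 2) (K z)" using assms by simp
    fix x show "min (L / 2) (K z) \<le> K x"
    proof (cases "r \<le> norm x")
      case True
      then show ?thesis using r[of x] by simp
    next
      case False
      then have "K z \<le> K x" by (intro z) simp
      then show ?thesis by simp
    qed
  qed
qed

lemma superlinear_lower_bound:
  fixes f :: "'a \<Rightarrow> real \<Rightarrow> real" and p :: real
  assumes lim: "uniform_limit UNIV (\<lambda>\<tau> x. f x \<tau> / \<tau> powr p) K at_top"
    and \<kappa>: "0 < \<kappa>" "\<And>x. \<kappa> \<le> K x" and f0: "\<And>x \<tau>. 0 \<le> \<tau> \<Longrightarrow> 0 \<le> f x \<tau>" and p: "0 \<le> p"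
  obtains K\<^sub>0 where "0 \<le> K\<^sub>0" "\<And>x \<tau>. 0 \<le> \<tau> \<Longrightarrow> \<kappa> / 2 * \<tau> powr p - K\<^sub>0 \<le> f x \<tau>"
proof -
  have "\<forall>\<^sub>F \<tau> in at_top. \<forall>x\<in>UNIV. dist (f x \<tau> / \<tau> powr p) (K x) < \<kappa> / 2"
    using lim half_gt_zero[OF \<kappa>(1)] unfolding uniform_limit_iff by blast
  then obtain T where T: "\<And>\<tau> x. T \<le> \<tau> \<Longrightarrow> dist (f x \<tau> / \<tau> powr p) (K x) < \<kappa> / 2"
    by (auto simp: eventually_at_top_linorder)
  \<comment> \<open>The maximum with 1 keeps \<open>\<tau> powr p\<close> positive where the
    quotient is cleared; below that threshold the left-hand side is at most 0.\<close>
  show thesis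
  proof (rule that[of "\<kappa> / 2 * max 1 T powr p"])
    fix x and \<tau> :: real assume \<tau>: "0 \<le> \<tau>"
    show "\<kappa> / 2 * \<tau> powr p - \<kappa> / 2 * max 1 T powr p \<le> f x \<tau>"
    proof (cases "max 1 T \<le> \<tau>")
      case True
      have "\<kappa> / 2 \<le> f x \<tau> / \<tau> powr p" 
      proof -
        have "\<bar>f x \<tau> / \<tau> powr p - K x\<bar> < \<kappa> / 2" using T[of \<tau> x] True by (simp add: dist_real_def)
        then show ?thesis using \<kappa>(2)[of x] by linarith
      qed
      then have "\<kappa> / 2 * \<tau> powr p \<le> f x \<tau>" using True by (subst (asm) pos_le_divide_eq) auto
      moreover have "0 \<le> \<kappa> / 2 * max 1 T powr p" using \<kappa> by simp
      ultimately show ?thesis by linarith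
    next
      case False
      then have "\<kappa> / 2 * \<tau> powr p \<le> \<kappa> / 2 * max 1 T powr p"
        using \<tau> p \<kappa> by (intro mult_left_mono powr_mono2) auto
      then show ?thesis using f0[OF \<tau>, of x] by linarith
    qed
  qed (use \<kappa> in simp)
qed

theorem theorem7:
  fixes f :: "real ^ 'n \<Rightarrow> real \<Rightarrow> real" and K :: "real ^ 'n \<Rightarrow> real"
    and s p C\<^sub>0 Cbar :: real
  assumes s: "0 < s" "s < 1"
    and f_holder: "holder_in_space f"
    and f_cont: "\<And>x. continuous_on {0..} (f x)"
    and C\<^sub>0: "C\<^sub>0 > 0"
    and f_bounds: "\<And>x \<tau>. \<tau> \<ge> 0 \<Longrightarrow> 0 \<le> f x \<tau> \<and> f x \<tau> \<le> C\<^sub>0 * (1 + \<tau> powr p)"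
    and p: "1 < p" "p < (real CARD('n) + 2) / (real CARD('n) + 2 - 2 * s)"
    and f_limit: "uniform_limit UNIV (\<lambda>\<tau> x. f x \<tau> / \<tau> powr p) K at_top"
    and K_pos: "\<And>x. K x > 0"
    and K_ucont: "uniformly_continuous_on UNIV K"
    and Cbar: "Cbar > 0"
    and K_limit: "(K \<longlongrightarrow> Cbar) at_infinity"
  shows "\<exists>C. \<forall>u. classical_entire_solution s f u \<longrightarrow> (\<forall>x t. 0 \<le> u x t) \<longrightarrow> (\<forall>x t. u x t \<le> C)"
proof -
  obtain \<kappa> where \<kappa>: "0 < \<kappa>" "\<And>x. \<kappa> \<le> K x"
    using continuous_pos_bounded_below[OF uniformly_continuous_imp_continuous[OF K_ucont] K_pos Cbar K_limit]
    by blast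
  obtain K\<^sub>0 where K0: "0 \<le> K\<^sub>0" "\<And>x \<tau>. 0 \<le> \<tau> \<Longrightarrow> \<kappa> / 2 * \<tau> powr p - K\<^sub>0 \<le> f x \<tau>"
    using superlinear_lower_bound[OF f_limit \<kappa>] f_bounds p(1) by (metis less_eq_real_def less_trans zero_less_one)
  have p': "p < (real DIM(real ^ 'n) + 2) / (real DIM(real ^ 'n) + 2 - 2 * s)" using p(2) by simp
  obtain C where C: "\<And>(u :: real ^ 'n \<Rightarrow> real \<Rightarrow> real) F x t. heat_solution s u F \<Longrightarrow>
    (\<And>x t. 0 \<le> F x t) \<Longrightarrow> (\<And>x t. F x t \<le> C\<^sub>0 * (1 + u x t powr p)) \<Longrightarrow>
    (\<And>x t. \<kappa> / 2 * u x t powr p - K\<^sub>0 \<le> F x t) \<Longrightarrow> u x t \<le> C"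
    using universal_bound[OF s p(1) p' half_gt_zero[OF \<kappa>(1)] K0(1) C\<^sub>0] by metis
  have "u x t \<le> C" if "classical_entire_solution s f u" "\<forall>x t. 0 \<le> u x t" for u x t
    by (rule C[OF classical_entire_solution_heat_solution[OF that(1) s]]) (use that(2) f_bounds K0(2) in auto)
  then show ?thesis by blast
qed

end
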